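(* Let $X$ be the inverse limit of a tent map $T_s$, $s\in(\sqrt2,2]$. Take an admissible left-infinite sequence $L=\ldots l_2l_1$ and construct the embedding $\varphi_L$ of $X$ with respect to $L$. Then every point of $X$ with the same symbolic tail as $L$ is accessible. If $A(L)$ is not a spiral point, then $\mathcal U_L$ is fully accessible.
   Context: Tent inverse limits. For $s\in(\sqrt2,2]$ let $T=T_s\colon[0,1]\to[0,1]$, $T_s(t)=\min\{st,s(1-t)\}$, $c=\frac12$, and $X=\{x=(\pi_i(x))_{i\le0}\in[0,1]^{-\mathbb N_0}: T(\pi_i(x))=\pi_{i+1}(x)\ \forall i<0\}$ with the product topology. The core is $X'=\varprojlim([T^2(c),T(c)],T)\subset X$; $X=X'\cup\mathcal C$, where $\mathcal C$ is a ray containing the fixed point $(\ldots,0,0)$. Symbolics. $\#_1(w)$ is the number of ones of a word $w$. The kneading sequence is $\nu=c_1c_2\ldots$, $c_i=0$ if $T^i(c)\in[0,c]$, $c_i=1$ if $T^i(c)\in[c,1]$; if $T^n(c)=c$, $\nu$ is the smaller of $(c_1\ldots c_{n-1}0)^\infty,(c_1\ldots c_{n-1}1)^\infty$ in the parity-lexicographical order: for sequences (or words of equal length) first differing at index $k$, $s\prec t$ iff $s_k<t_k$ and $\#_1(s_1\ldots s_{k-1})$ is even, or $s_k>t_k$ and it is odd. A word $a_1\ldots a_n$ is admissible if $c_2\ldots c_{2+n-i}\preceq a_i\ldots a_n\preceq c_1\ldots c_{1+n-i}$ for all $i$. An infinite sequence is admissible if all its finite subwords are; additionally, sequences $0^\infty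 s_ks_{k+1}\ldots$ with $s_k=1$ and the part from $s_k$ on admissible (and the constant zero sequence) are called admissible; these correspond to points of $\mathcal C$. $X$ is identified with $\Sigma_{adm}/\!\sim$, where $\Sigma_{adm}$ is the set of admissible two-sided sequences $\ldots s_{-1}.s_0s_1\ldots$ and $s\sim t$ iff $s=t$ or they differ at exactly one index $k$ and $s_{k+1}s_{k+2}\ldots=t_{k+1}t_{k+2}\ldots=\nu$; the point $x$ corresponds to the class of $(x_i)$ with $x_i=0$ (resp. $1$) if $\pi_i(x)$ (for $i\le0$) or $T^i(\pi_0(x))$ (for $i>0$) lies in $[0,c]$ (resp. $[c,1]$). Left-infinite sequences are written $\overleftarrow s=\ldots s_2s_1$ ($s_j$ being the entry at index $-j$), and the basic arc $A(\overleftarrow s)$ is the set of points of $X$ having a representative with left part $\overleftarrow s$; it is an arc or a point. A point has the same symbolic tail as $L$ if it has a representative whose left part agrees with $L$ at all sufficiently large indices. Embeddings. For an admissible left-infinite $L=\ldots l_2l_1$ put $\psi_L(\overleftarrow s)=\sum_{i\ge1}(-1)^{\#_1(l_i\ldots l_1)-\#_1(s_i\ldots s_1)}3^{-i}+\frac12$. The embedding $\varphi_L\colon X\to\mathbb R^2$ draws each basic arc $A(\overleftarrow s)$ as the horizontal segment $\pi_0(A(\overleftarrow s))\times\{\psi_L(\overleftarrow s)\}$; whenever two $\sim$-identified two-sided sequences differ only at an index $k<0$, the corresponding endpoints of the two basic arcs are joined by a semicircle, on the left if $\#_1$ of the word at indices $k+1,\ldots,-1$ is odd and on the right if it is even. Other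 notions. The arc-component of $x$ is the union of all arcs containing $x$; $\mathcal U_L$ is the arc-component of $X$ containing $A(L)$. $x\in X$ is a spiral point if there is a ray $R\subset X$ with endpoint $x$ such that for every $y\in R$, $y\ne x$, the arc $[x,y]\subset R$ contains infinitely many basic arcs. A point $a$ of a plane continuum $K$ is accessible if some arc $A\subset\mathbb R^2$ has $A\cap K=\{a\}$; an arc-component is fully accessible if all its points are accessible. Here $K=\varphi_L(X)$. *)

theory Defs
  imports "HOL-Analysis.Analysis"
begin

section \<open>Tent inverse limits\<close>

definition tent :: "real \<Rightarrow> real \<Rightarrow> real" where
  "tent s t = min (s * t) (s * (1 - t))"

text \<open>A point \<open>x\<close> of the inverse limit is written with non-negative indices: \<open>x n\<close> is
  the coordinate \<open>\<pi>\<^sub>-\<^sub>n(x)\<close>. The topology on \<open>nat \<Rightarrow> real\<close> is the product topology.\<close>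

definition inv_limit :: "real \<Rightarrow> (nat \<Rightarrow> real) set" where
  "inv_limit s = {x. (\<forall>n. x n \<in> {0..1}) \<and> (\<forall>n. tent s (x (Suc n)) = x n)}"

definition coord :: "real \<Rightarrow> (nat \<Rightarrow> real) \<Rightarrow> int \<Rightarrow> real" where
  "coord s x i = (if i \<le> 0 then x (nat (- i)) else (tent s ^^ nat i) (x 0))"


section \<open>Symbolic dynamics\<close>

text \<open>The symbols 0 and 1 are \<open>False\<close> and \<open>True\<close>; the library orders them as
  \<open>False < True\<close>.\<close>

definition ones :: "bool list \<Rightarrow> nat" where
  "ones w = length (filter (\<lambda>b. b) w)"

definition word_prec :: "bool list \<Rightarrow> bool list \<Rightarrow> bool" where
  "word_prec u v \<longleftrightarrow> length u = length v \<and>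
     (\<exists>k < length u. take k u = take k v \<and>
        (u ! k < v ! k \<and> even (ones (take k u)) \<or>
         u ! k > v ! k \<and> odd (ones (take k u))))"

definition word_preceq :: "bool list \<Rightarrow> bool list \<Rightarrow> bool" where
  "word_preceq u v \<longleftrightarrow> u = v \<or> word_prec u v"

definition seq_prec :: "(nat \<Rightarrow> bool) \<Rightarrow> (nat \<Rightarrow> bool) \<Rightarrow> bool" where
  "seq_prec u v \<longleftrightarrow> (\<exists>k. (\<forall>i<k. u i = v i) \<and>
        (u k < v k \<and> even (ones (map u [0..<k])) \<or>
         u k > v k \<and> odd (ones (map u [0..<k]))))"

text \<open>The kneading sequence \<open>c\<^sub>1c\<^sub>2\<dots>\<close> is indexed from 0: \<open>kneading s i\<close> is
  \<open>c\<^sub>i\<^sub>+\<^sub>1\<close>. In \<open>periodic_kneading s n b\<close> the number \<open>n\<close> is the least period of the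
  turning point, so that \<open>T\<^sup>j(c) \<noteq> c\<close> whenever \<open>n\<close> does not divide \<open>j\<close>.\<close>

definition periodic_kneading :: "real \<Rightarrow> nat \<Rightarrow> bool \<Rightarrow> nat \<Rightarrow> bool" where
  "periodic_kneading s n b i =
     (if n dvd Suc i then b else (tent s ^^ Suc i) (1/2) \<ge> 1/2)"

definition kneading :: "real \<Rightarrow> nat \<Rightarrow> bool" where
  "kneading s =
     (if \<exists>n>0. (tent s ^^ n) (1/2) = 1/2 then
        (let n = (LEAST n. n > 0 \<and> (tent s ^^ n) (1/2) = 1/2);
             u = periodic_kneading s n False; v = periodic_kneading s n True
         in if seq_prec u v then u else v)
      else (\<lambda>i. (tent s ^^ Suc i) (1/2) \<ge> 1/2))"

definition admissible_word :: "real \<Rightarrow> bool list \<Rightarrow> bool" where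
  "admissible_word s w \<longleftrightarrow> (\<forall>i < length w.
     word_preceq (map (\<lambda>j. kneading s (Suc j)) [0..<length w - i]) (drop i w) \<and>
     word_preceq (drop i w) (map (kneading s) [0..<length w - i]))"

definition subword :: "(int \<Rightarrow> bool) \<Rightarrow> int \<Rightarrow> nat \<Rightarrow> bool list" where
  "subword \<sigma> i n = map (\<lambda>j. \<sigma> (i + int j)) [0..<n]"

definition adm_sequences :: "real \<Rightarrow> (int \<Rightarrow> bool) set" where
  "adm_sequences s = {\<sigma>.
     (\<forall>i n. admissible_word s (subword \<sigma> i n)) \<or>
     (\<exists>k. (\<forall>i<k. \<not> \<sigma> i) \<and> \<sigma> k \<and> (\<forall>i\<ge>k. \<forall>n. admissible_word s (subword \<sigma> i n))) \<or>
     (\<forall>i. \<not> \<sigma> i)}"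

text \<open>A left-infinite sequence \<open>\<dots>a\<^sub>2a\<^sub>1\<close> is a function \<open>a\<close> with \<open>a i\<close> the symbol
  \<open>a\<^sub>i\<^sub>+\<^sub>1\<close>, that is, the entry at index \<open>- (i + 1)\<close>. Its finite subwords, read from left
  to right, are the lists \<open>rev (map a [i..<i + n])\<close>.\<close>

definition left_part :: "(int \<Rightarrow> bool) \<Rightarrow> nat \<Rightarrow> bool" where
  "left_part \<sigma> i = \<sigma> (- int (Suc i))"

definition left_admissible :: "real \<Rightarrow> (nat \<Rightarrow> bool) \<Rightarrow> bool" where
  "left_admissible s a \<longleftrightarrow>
     (\<forall>i n. admissible_word s (rev (map a [i..<i + n]))) \<or>
     (\<exists>k. (\<forall>i>k. \<not> a i) \<and> a k \<and>
          (\<forall>i n. i + n \<le> Suc k \<longrightarrow> admissible_word s (rev (map a [i..<i + n])))) \<or>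
     (\<forall>i. \<not> a i)"

definition represents :: "real \<Rightarrow> (int \<Rightarrow> bool) \<Rightarrow> (nat \<Rightarrow> real) \<Rightarrow> bool" where
  "represents s \<sigma> x \<longleftrightarrow> \<sigma> \<in> adm_sequences s \<and> x \<in> inv_limit s \<and>
     (\<forall>i. coord s x i \<in> (if \<sigma> i then {1/2..1} else {0..1/2}))"

text \<open>\<open>\<sigma>\<close> and \<open>\<tau>\<close> are distinct and identified, differing precisely at index \<open>k\<close>.\<close>

definition identified_at :: "real \<Rightarrow> int \<Rightarrow> (int \<Rightarrow> bool) \<Rightarrow> (int \<Rightarrow> bool) \<Rightarrow> bool" where
  "identified_at s k \<sigma> \<tau> \<longleftrightarrow> \<sigma> \<in> adm_sequences s \<and> \<tau> \<in> adm_sequences s \<and>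
     \<sigma> k \<noteq> \<tau> k \<and> (\<forall>i. i \<noteq> k \<longrightarrow> \<sigma> i = \<tau> i) \<and> (\<forall>j. \<sigma> (k + 1 + int j) = kneading s j)"

definition basic_arc :: "real \<Rightarrow> (nat \<Rightarrow> bool) \<Rightarrow> (nat \<Rightarrow> real) set" where
  "basic_arc s a = {x. \<exists>\<sigma>. represents s \<sigma> x \<and> left_part \<sigma> = a}"

definition same_tail :: "real \<Rightarrow> (nat \<Rightarrow> bool) \<Rightarrow> (nat \<Rightarrow> real) \<Rightarrow> bool" where
  "same_tail s L x \<longleftrightarrow>
     (\<exists>\<sigma>. represents s \<sigma> x \<and> (\<exists>N. \<forall>i\<ge>N. left_part \<sigma> i = L i))"


section \<open>The planar drawing with respect to a left-infinite sequence\<close>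

definition psi :: "(nat \<Rightarrow> bool) \<Rightarrow> (nat \<Rightarrow> bool) \<Rightarrow> real" where
  "psi L a = (\<Sum>i. (- 1) powi (int (ones (map L [0..<Suc i])) - int (ones (map a [0..<Suc i])))
                     / 3 ^ Suc i) + 1/2"

definition segment :: "real \<Rightarrow> (nat \<Rightarrow> bool) \<Rightarrow> (nat \<Rightarrow> bool) \<Rightarrow> (real \<times> real) set" where
  "segment s L a = (\<lambda>x. x 0) ` basic_arc s a \<times> {psi L a}"

definition semicircle :: "real \<Rightarrow> real \<Rightarrow> real \<Rightarrow> bool \<Rightarrow> (real \<times> real) set" where
  "semicircle p y z right =
     {q. dist q (p, (y + z) / 2) = \<bar>y - z\<bar> / 2 \<and> (if right then fst q \<ge> p else fst q \<le> p)}"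

text \<open>The semicircles having an endpoint on \<open>segment s L a\<close>. The point \<open>x\<close>, represented by both
  \<open>\<sigma>\<close> and \<open>\<tau>\<close>, is the common endpoint of the two basic arcs; the word at the indices
  \<open>k + 1, \<dots>, - 1\<close> is \<open>subword \<sigma> (k + 1) (nat (- k - 1))\<close>.\<close>

definition semicircles_at :: "real \<Rightarrow> (nat \<Rightarrow> bool) \<Rightarrow> (nat \<Rightarrow> bool) \<Rightarrow> (real \<times> real) set set" where
  "semicircles_at s L a =
     {semicircle (x 0) (psi L (left_part \<sigma>)) (psi L (left_part \<tau>))
        (even (ones (subword \<sigma> (k + 1) (nat (- k - 1))))) | x \<sigma> \<tau> k.
        k < 0 \<and> identified_at s k \<sigma> \<tau> \<and> represents s \<sigma> x \<and> represents s \<tau> x \<and> left_part \<sigma> = a}"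

definition semicircles :: "real \<Rightarrow> (nat \<Rightarrow> bool) \<Rightarrow> (real \<times> real) set set" where
  "semicircles s L = (\<Union>a. semicircles_at s L a)"

definition drawing :: "real \<Rightarrow> (nat \<Rightarrow> bool) \<Rightarrow> (real \<times> real) set" where
  "drawing s L = (\<Union>a \<in> {a. left_admissible s a}. segment s L a) \<union> \<Union> (semicircles s L)"

text \<open>In the inverse limit the two endpoints joined by a semicircle are one and the same point, so
  the drawing does not by itself specify a map. An embedding \<open>\<phi>\<close> realising the drawing has
  to spread small pieces of the two adjacent basic arcs over the semicircle: the image of a basic
  arc contains its segment and may in addition contain parts of the semicircles attached to it. This
  is the case \<open>F = id\<close> of \<open>embedding_wrt\<close> below.

  Spreading is impossible if both basic arcs meeting at a point consist of this point only, which
  does occur (for instance for the Fibonacci kneading sequence); then the semicircle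
  has to be shrunk to a point. Therefore the drawing is taken up to a map \<open>F\<close> of the plane onto itself
  that shrinks some semicircles, or subarcs of them, to points and is injective elsewhere.\<close>

definition shrinks_semicircles ::
    "real \<Rightarrow> (nat \<Rightarrow> bool) \<Rightarrow> (real \<times> real \<Rightarrow> real \<times> real) \<Rightarrow> bool" where
  "shrinks_semicircles s L F \<longleftrightarrow> continuous_on UNIV F \<and> surj F \<and>
     (\<forall>q. (\<exists>p. F -` {q} = {p}) \<or>
          connected (F -` {q}) \<and> (\<exists>J \<in> semicircles s L. F -` {q} \<subseteq> J))"

definition embedding_wrt ::
    "real \<Rightarrow> (nat \<Rightarrow> bool) \<Rightarrow> ((nat \<Rightarrow> real) \<Rightarrow> real \<times> real) \<Rightarrow> bool" where
  "embedding_wrt s L \<phi> \<longleftrightarrow>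
     (\<exists>F. shrinks_semicircles s L F \<and>
          (\<exists>g. homeomorphism (inv_limit s) (F ` drawing s L) \<phi> g) \<and>
          (\<forall>a. left_admissible s a \<longrightarrow>
               F ` segment s L a \<subseteq> \<phi> ` basic_arc s a \<and>
               \<phi> ` basic_arc s a \<subseteq> F ` (segment s L a \<union> \<Union> (semicircles_at s L a))))"


section \<open>Arc-components, spiral points, accessibility\<close>

text \<open>The predicate \<open>arc\<close> of the library describes non-degenerate arcs. The point \<open>x\<close> is inserted
  because it need not lie on any of these; its arc-component is then the singleton of \<open>x\<close>.\<close>

definition arc_component :: "(nat \<Rightarrow> real) set \<Rightarrow> (nat \<Rightarrow> real) \<Rightarrow> (nat \<Rightarrow> real) set" where
  "arc_component S x =
     insert x (\<Union> {path_image g | g. arc g \<and> path_image g \<subseteq> S \<and> x \<in> path_image g})"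

definition arc_component_of_left :: "real \<Rightarrow> (nat \<Rightarrow> bool) \<Rightarrow> (nat \<Rightarrow> real) set" where
  "arc_component_of_left s L = (\<Union>x \<in> basic_arc s L. arc_component (inv_limit s) x)"

text \<open>The ray is the injective continuous image of \<open>{0..}\<close> under \<open>r\<close>, and its subarc
  from \<open>x\<close> to \<open>r t\<close> is \<open>r ` {0..t}\<close>.\<close>

definition spiral_point :: "real \<Rightarrow> (nat \<Rightarrow> real) \<Rightarrow> bool" where
  "spiral_point s x \<longleftrightarrow>
     (\<exists>r :: real \<Rightarrow> nat \<Rightarrow> real. continuous_on {0..} r \<and> inj_on r {0..} \<and>
        r ` {0..} \<subseteq> inv_limit s \<and> r 0 = x \<and>
        (\<forall>t>0. infinite {B. (\<exists>a. left_admissible s a \<and> B = basic_arc s a) \<and> B \<subseteq> r ` {0..t}}))"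

definition accessible :: "(real \<times> real) set \<Rightarrow> real \<times> real \<Rightarrow> bool" where
  "accessible K a \<longleftrightarrow> (\<exists>g. arc g \<and> path_image g \<inter> K = {a})"

end

theory Submission
  imports Defs
begin

text \<open>The height of \<open>L\<close> is maximal, and every sequence with the same tail as \<open>L\<close> has an extreme height
  within its cylinder of level \<open>N\<close>. Next to the horizontal segment of such a sequence there is
  therefore a strip of width about \<open>3\<^sup>-\<^sup>N\<close> that the drawing does not meet, and next to the semicircles
  attached to the segment there are concentric strips of the same width. Hence all points of these
  pieces are accessible.

  Let an arc in the inverse limit start in \<open>A(L)\<close>. Where a coordinate of the arc is critical, the
  preceding coordinate attains its maximum, so from there to a place of its minimum the arc
  already covers all its values; for large indices this happens only near the two ends of the arc.
  Thus all interior points of the arc have one tail. It is the tail of \<open>L\<close>, as otherwise the arc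
  would exhibit its starting point as a spiral point. If the other end has a different tail, it is
  a degenerate basic arc on which the arc zigzags; the strips along the zigzag then join up to a path
  in the complement that converges to this end.\<close>

section \<open>Symbolic dynamics of tent maps\<close>

text \<open>Base 3 makes room: a cylinder of level \<open>n\<close> occupies an interval of radius
  \<open>gap n\<close>, and centres of different cylinders of level \<open>n\<close> are at least
  \<open>4 * gap n\<close> apart, so the space between two of them is at least as wide as a
  cylinder. This deals with the segments; the difficulty lies with the semicircles, whose radii must
  be kept apart as well. Those of one level are concentric. For different levels the separation
  rests on parity: an admissible sequence can first fall away from the kneading sequence only where
  the latter has had an odd number of ones. The second obstacle is that \<open>F\<close> is known
  only through its continuity and its fibres, so sizes in the drawing say nothing about sizes in the
  embedded continuum. Near a degenerate end, closeness is therefore obtained by compactness: limits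
  of points on the basic arcs that are passed share left symbols with the end, hence equal it. A
  limit semicircle of positive radius has both ends mapped to the image of the end, and the
  condition on the fibres forces all of it there.\<close>

definition half :: "bool \<Rightarrow> real set" where
  "half b = (if b then {1/2..1} else {0..1/2})"

lemma half_iff: "t \<in> half b \<longleftrightarrow> (if b then 1/2 \<le> t \<and> t \<le> 1 else 0 \<le> t \<and> t \<le> 1/2)"
  by (auto simp: half_def)

lemma half_exists: "0 \<le> t \<Longrightarrow> t \<le> 1 \<Longrightarrow> t \<in> half (t \<ge> 1/2)"
  by (auto simp: half_iff)

lemma half_both: "t \<in> half a \<Longrightarrow> t \<in> half b \<Longrightarrow> a \<noteq> b \<Longrightarrow> t = 1/2"
  by (auto simp: half_iff split: if_splits)

lemma ones_simps [simp]:
  "ones [] = 0" "ones (x # xs) = (if x then Suc (ones xs) else ones xs)"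
  "ones (xs @ ys) = ones xs + ones ys"
  by (auto simp: ones_def)

lemma coord_simps: "coord s x 0 = x 0" "coord s x (- int n) = x n" "coord s x (int n) = (tent s ^^ n) (x 0)"
  by (auto simp: coord_def)

lemma map_upt_add: "map f [0..<m + n] = map f [0..<m] @ map (\<lambda>i. f (m + i)) [0..<n]"
  by (induction n) auto

lemma take_map_upt: "k \<le> n \<Longrightarrow> take k (map f [0..<n]) = map f [0..<k]"
  by (simp add: take_map)

text \<open>With two symbols, the first difference is decided by the symbol of the larger word: it
  is 1 exactly if an even number of ones precedes. A comparison of two real orbits delivers
  precisely this.\<close>

lemma word_preceq_order:
  "word_preceq (map \<alpha> [0..<n]) (map \<beta> [0..<n]) \<longleftrightarrow>
   (\<forall>k<n. (\<forall>i<k. \<alpha> i = \<beta> i) \<longrightarrow> \<alpha> k \<noteq> \<beta> k \<longrightarrow> \<beta> k = even (ones (map \<alpha> [0..<k])))"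
proof
  assume l: "word_preceq (map \<alpha> [0..<n]) (map \<beta> [0..<n])"
  show "\<forall>k<n. (\<forall>i<k. \<alpha> i = \<beta> i) \<longrightarrow> \<alpha> k \<noteq> \<beta> k \<longrightarrow> \<beta> k = even (ones (map \<alpha> [0..<k]))"
  proof (intro allI impI)
    fix k assume k: "k < n" "\<forall>i<k. \<alpha> i = \<beta> i" "\<alpha> k \<noteq> \<beta> k"
    from l k(1,3) have "word_prec (map \<alpha> [0..<n]) (map \<beta> [0..<n])"
      by (auto simp: word_preceq_def)
    then obtain m where m: "m < n" "take m (map \<alpha> [0..<n]) = take m (map \<beta> [0..<n])"
      "(\<alpha> m < \<beta> m \<and> even (ones (map \<alpha> [0..<m])) \<or> \<alpha> m > \<beta> m \<and> odd (ones (map \<alpha> [0..<m])))"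
      by (auto simp: word_prec_def take_map_upt)
    have "\<forall>i<m. \<alpha> i = \<beta> i"
      using m(1,2) by (simp add: take_map_upt)
    moreover have "\<alpha> m \<noteq> \<beta> m" using m(3) by auto
    ultimately have "m = k" using k by (metis linorder_neqE_nat)
    with m(3) show "\<beta> k = even (ones (map \<alpha> [0..<k]))" by auto
  qed
next
  assume r: "\<forall>k<n. (\<forall>i<k. \<alpha> i = \<beta> i) \<longrightarrow> \<alpha> k \<noteq> \<beta> k \<longrightarrow> \<beta> k = even (ones (map \<alpha> [0..<k]))"
  show "word_preceq (map \<alpha> [0..<n]) (map \<beta> [0..<n])"
  proof (cases "\<forall>i<n. \<alpha> i = \<beta> i")
    case True then show ?thesis by (auto simp: word_preceq_def)
  next
    case False
    define k where "k = (LEAST i. i < n \<and> \<alpha> i \<noteq> \<beta> i)"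
    have k: "k < n" "\<alpha> k \<noteq> \<beta> k" using LeastI_ex[of "\<lambda>i. i < n \<and> \<alpha> i \<noteq> \<beta> i"] False
      by (auto simp: k_def)
    have lt: "\<forall>i<k. \<alpha> i = \<beta> i"
      using not_less_Least[of _ "\<lambda>i. i < n \<and> \<alpha> i \<noteq> \<beta> i"] k(1) unfolding k_def[symmetric] by auto
    have b: "\<beta> k = even (ones (map \<alpha> [0..<k]))" using r k lt by auto
    have e: "map \<alpha> [0..<k] = map \<beta> [0..<k]" using lt by auto
    have "word_prec (map \<alpha> [0..<n]) (map \<beta> [0..<n])"
      unfolding word_prec_def
    proof (intro conjI exI[of _ k])
      show "(map \<alpha> [0..<n] ! k < map \<beta> [0..<n] ! k \<and> even (ones (take k (map \<alpha> [0..<n]))) \<or>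
         map \<beta> [0..<n] ! k < map \<alpha> [0..<n] ! k \<and> odd (ones (take k (map \<alpha> [0..<n]))))"
        using b k by (simp add: take_map_upt)
    qed (use e k in \<open>auto simp: take_map_upt\<close>)
    then show ?thesis by (simp add: word_preceq_def)
  qed
qed

section \<open>Affine branches and the order of itineraries\<close>

locale tent_map =
  fixes s :: real
  assumes s_gt_1: "1 < s" and s_le_2: "s \<le> 2"
begin

abbreviation T where "T \<equiv> tent s"

abbreviation tc where "tc \<equiv> s / 2"

lemma s_pos: "0 < s" using s_gt_1 by simp

lemma tent_half: "t \<in> half b \<Longrightarrow> T t = (if b then s * (1 - t) else s * t)"
  using s_pos by (auto simp: half_iff tent_def min_def split: if_splits)

lemma tent_c: "T (1/2) = tc" by (simp add: tent_def)

lemma tent_range: assumes "0 \<le> t" "t \<le> 1" shows "0 \<le> T t" "T t \<le> tc" "T t \<le> 1"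
proof -
  have "t \<in> half (t \<ge> 1/2)" using assms by (rule half_exists)
  from tent_half[OF this] show a: "0 \<le> T t" "T t \<le> tc" using s_pos assms by (auto split: if_splits)
  then show "T t \<le> 1" using s_le_2 by simp
qed

lemma tent_eq_tc: assumes "0 \<le> t" "t \<le> 1" "T t = tc" shows "t = 1/2"
proof -
  have "t \<in> half (t \<ge> 1/2)" using assms by (intro half_exists)
  from tent_half[OF this] show ?thesis using s_pos assms by (auto split: if_splits)
qed

lemma tent_pow_range: assumes "0 \<le> t" "t \<le> 1" shows "0 \<le> (T ^^ n) t \<and> (T ^^ n) t \<le> 1"
  by (induction n) (use assms tent_range in auto)

lemma tent_pow_c: "(T ^^ Suc n) (1/2) = (T ^^ n) tc"
  by (simp only: funpow_Suc_right o_apply tent_c)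

lemma tent_half_diff:
  "t \<in> half b \<Longrightarrow> u \<in> half b \<Longrightarrow> T t - T u = s * (if b then - 1 else 1) * (t - u)"
  by (simp add: tent_half algebra_simps)

text \<open>\<open>T\<close> is affine with slope \<open>s\<close> or \<open>- s\<close> on each half; this yields every order comparison.\<close>

lemma tent_pow_diff:
  assumes "\<And>j. j < n \<Longrightarrow> (T ^^ j) t \<in> half (b j) \<and> (T ^^ j) u \<in> half (b j)"
  shows "(T ^^ n) t - (T ^^ n) u = s ^ n * (- 1) ^ ones (map b [0..<n]) * (t - u)"
  using assms
proof (induction n)
  case (Suc n)
  have "(T ^^ Suc n) t - (T ^^ Suc n) u = s * (if b n then - 1 else 1) * ((T ^^ n) t - (T ^^ n) u)"
    using tent_half_diff[of "(T ^^ n) t" "b n" "(T ^^ n) u"] Suc.prems[of n] by simp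
  also have "\<dots> = s * (if b n then - 1 else 1) * (s ^ n * (- 1) ^ ones (map b [0..<n]) * (t - u))"
    using Suc by simp
  finally show ?case by simp
qed simp

text \<open>For equal points the conclusion may fail, because the turning point has two symbols.\<close>

lemma symbols_mono:
  assumes "t < u"
    and \<alpha>: "\<And>j. j < n \<Longrightarrow> (T ^^ j) t \<in> half (\<alpha> j)" and \<beta>: "\<And>j. j < n \<Longrightarrow> (T ^^ j) u \<in> half (\<beta> j)"
  shows "word_preceq (map \<alpha> [0..<n]) (map \<beta> [0..<n])"
  unfolding word_preceq_order
proof (intro allI impI)
  fix k assume k: "k < n" "\<forall>i<k. \<alpha> i = \<beta> i" "\<alpha> k \<noteq> \<beta> k"
  have d: "(T ^^ k) t - (T ^^ k) u = s ^ k * (- 1) ^ ones (map \<alpha> [0..<k]) * (t - u)"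
  proof (rule tent_pow_diff)
    fix j assume "j < k"
    then show "(T ^^ j) t \<in> half (\<alpha> j) \<and> (T ^^ j) u \<in> half (\<alpha> j)"
      using k(1,2) \<alpha>[of j] \<beta>[of j] by auto
  qed
  have p: "s ^ k > 0" using s_pos by simp
  show "\<beta> k = even (ones (map \<alpha> [0..<k]))"
  proof (cases "even (ones (map \<alpha> [0..<k]))")
    case True
    then have "(T ^^ k) t - (T ^^ k) u = s ^ k * (t - u)" using d by simp
    also have "\<dots> < 0" using p assms(1) by (simp add: mult_pos_neg)
    finally have "(T ^^ k) t < (T ^^ k) u" by simp
    then show ?thesis using \<alpha>[OF k(1)] \<beta>[OF k(1)] k(3) True by (auto simp: half_iff split: if_splits)
  next
    case False
    then have "(T ^^ k) t - (T ^^ k) u = s ^ k * (u - t)" using d by (simp add: algebra_simps)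
    also have "\<dots> > 0" using p assms(1) by simp
    finally have "(T ^^ k) t > (T ^^ k) u" by simp
    then show ?thesis using \<alpha>[OF k(1)] \<beta>[OF k(1)] k(3) False by (auto simp: half_iff split: if_splits)
  qed
qed

subsection \<open>The kneading sequence\<close>

abbreviation knd where "knd \<equiv> kneading s"

abbreviation kword where "kword n \<equiv> map knd [0..<n]"

text \<open>The symbol that the kneading sequence has whenever the critical orbit returns to the turning
  point.\<close>

definition return_symbol where
  "return_symbol = knd ((LEAST n. n > 0 \<and> (T ^^ n) (1/2) = 1/2) - 1)"

text \<open>The two candidates first differ at position \<open>n - 1\<close>, so
  \<open>seq_prec\<close> is decided by the parity of the first \<open>n - 1\<close> symbols. The
  smaller candidate takes the symbol that makes the number of ones in a period even.\<close>

lemma periodic_facts: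
  fixes j :: nat
  assumes "j > 0" "(T ^^ j) (1/2) = 1/2"
  defines "n \<equiv> LEAST n. n > 0 \<and> (T ^^ n) (1/2) = 1/2"
  shows "n > 0" "(T ^^ n) (1/2) = 1/2" "\<And>i. (T ^^ i) (1/2) = 1/2 \<longleftrightarrow> n dvd i"
    "knd = periodic_kneading s n (odd (ones (map (periodic_kneading s n False) [0..<n - 1])))"
proof -
  have ex: "\<exists>n. n > 0 \<and> (T ^^ n) (1/2) = 1/2" using assms by auto
  show n: "n > 0" "(T ^^ n) (1/2) = 1/2" using LeastI_ex[OF ex] by (auto simp: n_def)
  have mult: "(T ^^ (n * q)) (1/2) = 1/2" for q
    proof (induction q)
    case (Suc q)
    have "(T ^^ (n * Suc q)) (1/2) = (T ^^ n) ((T ^^ (n * q)) (1/2))" by (simp add: funpow_add)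
    then show ?case by (simp only: Suc n(2))
  qed simp
  show iff: "(T ^^ i) (1/2) = 1/2 \<longleftrightarrow> n dvd i" for i
  proof
    assume i: "(T ^^ i) (1/2) = 1/2"
    have "(T ^^ i) (1/2) = (T ^^ (i mod n)) ((T ^^ (n * (i div n))) (1/2))"
      by (metis funpow_add mod_mult_div_eq o_apply)
    then have "(T ^^ (i mod n)) (1/2) = 1/2" using i mult by simp
    then have "\<not> i mod n > 0"
      using not_less_Least[of "i mod n" "\<lambda>n. n > 0 \<and> (T ^^ n) (1/2) = 1/2"] n(1)
      by (auto simp: n_def)
    then show "n dvd i" by auto
  qed (auto simp: mult)
  let ?u = "periodic_kneading s n False" and ?v = "periodic_kneading s n True"
  have eq: "?u i = ?v i" if "i < n - 1" for i
    using that by (auto simp: periodic_kneading_def dest: dvd_imp_le)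
  have last: "\<not> ?u (n - 1)" "?v (n - 1)" using n(1) by (auto simp: periodic_kneading_def)
  have "seq_prec ?u ?v \<longleftrightarrow> even (ones (map ?u [0..<n - 1]))"
  proof
    assume "seq_prec ?u ?v"
    then obtain k where k: "\<forall>i<k. ?u i = ?v i" "?u k < ?v k \<and> even (ones (map ?u [0..<k])) \<or>
         ?u k > ?v k \<and> odd (ones (map ?u [0..<k]))" by (auto simp: seq_prec_def)
    then have "k = n - 1" using eq last by (metis less_irrefl linorder_neqE_nat)
    then show "even (ones (map ?u [0..<n - 1]))" using k last by auto
  next
    assume "even (ones (map ?u [0..<n - 1]))"
    then show "seq_prec ?u ?v" unfolding seq_prec_def using eq last by (intro exI[of _ "n - 1"]) auto
  qed
  moreover have "\<exists>n>0. (T ^^ n) (1/2) = 1/2" using ex by auto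
  ultimately show "knd = periodic_kneading s n (odd (ones (map ?u [0..<n - 1])))"
    unfolding kneading_def n_def[symmetric] by (simp add: Let_def)
qed

lemma kneading_valid: "(T ^^ i) tc \<in> half (knd i)"
proof (cases "\<exists>n>0. (T ^^ n) (1/2) = 1/2")
  case True
  then obtain j where j: "j > 0" "(T ^^ j) (1/2) = 1/2" by auto
  define n where "n = (LEAST n. n > 0 \<and> (T ^^ n) (1/2) = 1/2)"
  note pf = periodic_facts[OF j, folded n_def]
  have r: "0 \<le> (T ^^ Suc i) (1/2)" "(T ^^ Suc i) (1/2) \<le> 1" using tent_pow_range[of "1/2" "Suc i"] by simp_all
  show ?thesis
  proof (cases "n dvd Suc i")
    case True then have "(T ^^ i) tc = 1/2" using pf(3)[of "Suc i"] unfolding tent_pow_c by simp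
    then show ?thesis by (simp add: half_iff)
  next
    case False
    then have "knd i = ((T ^^ Suc i) (1/2) \<ge> 1/2)"
      using fun_cong[OF pf(4), of i] by (simp only: periodic_kneading_def if_False)
    then show ?thesis using r half_exists unfolding tent_pow_c by auto
  qed
next
  case False
  have r: "0 \<le> (T ^^ Suc i) (1/2)" "(T ^^ Suc i) (1/2) \<le> 1" using tent_pow_range[of "1/2" "Suc i"] by simp_all
  have "knd i = ((T ^^ Suc i) (1/2) \<ge> 1/2)" unfolding kneading_def using False by (simp only: if_False)
  then show ?thesis using r half_exists unfolding tent_pow_c by auto
qed

lemma kneading_0: "knd 0"
  using kneading_valid[of 0] s_gt_1 by (auto simp: half_iff split: if_splits)

text \<open>Return times are multiples of the least period, and each period has an even number of
  ones. Since a deviation of an admissible sequence needs an odd number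
  (\<open>adm_deviation_odd\<close>), the evenness pins down the symbols at returns.\<close>

lemma kneading_return:
  assumes "(T ^^ Suc j) (1/2) = 1/2"
  shows "knd j = return_symbol" "even (ones (kword (Suc j)))"
proof -
  define n where "n = (LEAST n. n > 0 \<and> (T ^^ n) (1/2) = 1/2)"
  note pf = periodic_facts[OF zero_less_Suc assms, folded n_def]
  let ?p = "periodic_kneading s n False"
  define b where "b = odd (ones (map ?p [0..<n - 1]))"
  have k: "knd i = (if n dvd Suc i then b else ?p i)" for i
    using fun_cong[OF pf(4), of i] by (cases "n dvd Suc i") (simp_all only: periodic_kneading_def[of s n _ i] b_def if_True if_False)
  have d: "n dvd Suc j" using pf(3) assms by blast
  have "knd j = b" using d k[of j] by simp
  moreover have "knd (n - 1) = b" using k[of "n - 1"] pf(1) by simp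
  ultimately show "knd j = return_symbol" by (simp only: return_symbol_def n_def[symmetric])
  have kn: "map knd [0..<n - 1] = map ?p [0..<n - 1]"
  proof (rule map_cong)
    fix i assume "i \<in> set [0..<n - 1]"
    then have "\<not> n dvd Suc i" by (auto dest: dvd_imp_le)
    then show "knd i = ?p i" by (subst k) simp
  qed simp
  have ev1: "even (ones (kword n))"
  proof -
    have "kword n = map knd [0..<n - 1] @ [knd (n - 1)]"
      using pf(1) by (cases n) auto
    moreover have "knd (n - 1) = odd (ones (map knd [0..<n - 1]))"
      unfolding kn using k[of "n - 1"] pf(1) by (simp add: b_def)
    ultimately show ?thesis by (simp only: ones_simps) auto
  qed
  have per: "knd (n + i) = knd i" for i
  proof -
    have "(T ^^ Suc (n + i)) (1/2) = (T ^^ Suc i) ((T ^^ n) (1/2))"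
      by (metis add.commute add_Suc_right funpow_add o_apply)
    then have e: "(T ^^ Suc (n + i)) (1/2) = (T ^^ Suc i) (1/2)" using pf(2) by simp
    have "n dvd Suc (n + i) \<longleftrightarrow> n dvd Suc i" using dvd_add_right_iff[of n n "Suc i"] by simp
    then show ?thesis by (simp only: k periodic_kneading_def e)
  qed
  have "even (ones (kword (n * q)))" for q
  proof (induction q)
    case (Suc q)
    have "kword (n * Suc q) = kword n @ kword (n * q)"
      using map_upt_add[of knd n "n * q"] per by simp
    then show ?case using Suc ev1 by simp
  qed simp
  then show "even (ones (kword (Suc j)))" using d by (metis dvd_def)
qed

lemma kneading_split: "ones (kword (m + n)) = ones (kword m) + ones (map (\<lambda>i. knd (m + i)) [0..<n])"
  by (simp add: map_upt_add)

subsection \<open>Itineraries of points of the inverse limit\<close>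

abbreviation X where "X \<equiv> inv_limit s"

abbreviation valid where "valid \<sigma> x \<equiv> \<forall>i. coord s x i \<in> half (\<sigma> i)"

lemma X_range: "x \<in> X \<Longrightarrow> 0 \<le> x n \<and> x n \<le> 1" by (auto simp: inv_limit_def)

lemma X_step: "x \<in> X \<Longrightarrow> T (x (Suc n)) = x n" by (auto simp: inv_limit_def)

lemma X_pow: "x \<in> X \<Longrightarrow> (T ^^ k) (x (n + k)) = x n"
  by (induction k) (auto simp: X_step funpow_swap1)

lemma X_le_tc: "x \<in> X \<Longrightarrow> x n \<le> tc"
  using X_step[of x n] tent_range(2)[of "x (Suc n)"] X_range[of x "Suc n"] by simp

lemma coord_range: assumes "x \<in> X" shows "0 \<le> coord s x i" "coord s x i \<le> 1"
  using X_range[OF assms] tent_pow_range[of "x 0"] by (auto simp: coord_def)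

lemma coord_pow_nat:
  assumes "x \<in> X" shows "(T ^^ j) (x n) = coord s x (int j - int n)"
proof (cases "j \<le> n")
  case True
  then have "coord s x (int j - int n) = x (n - j)" by (auto simp: coord_def nat_diff_distrib')
  with True show ?thesis using X_pow[OF assms, of j "n - j"] by simp
next
  case False
  have "(T ^^ j) (x n) = (T ^^ (j - n)) ((T ^^ n) (x n))"
    using False by (metis funpow_add le_add_diff_inverse2 nat_le_linear o_apply)
  also have "\<dots> = (T ^^ (j - n)) (x 0)" using X_pow[OF assms, of n 0] by simp
  also have "\<dots> = coord s x (int j - int n)" using False by (auto simp: coord_def nat_diff_distrib')
  finally show ?thesis .
qed

lemma coord_pow:
  assumes "x \<in> X" shows "(T ^^ j) (coord s x i) = coord s x (i + int j)"
proof (cases "i \<le> 0")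
  case True
  then have "coord s x i = x (nat (- i))" by (simp add: coord_def)
  then show ?thesis using coord_pow_nat[OF assms, of j "nat (- i)"] True by (simp add: algebra_simps)
next
  case False
  then have "(T ^^ j) (coord s x i) = (T ^^ (j + nat i)) (x 0)" by (simp add: coord_def funpow_add)
  then show ?thesis using coord_pow_nat[OF assms, of "j + nat i" 0] False by (simp add: algebra_simps)
qed

lemma coord_step: assumes "x \<in> X" shows "T (coord s x i) = coord s x (i + 1)"
  using coord_pow[OF assms, of 1 i] by simp

lemma coord_le_tc: assumes "x \<in> X" shows "coord s x i \<le> tc"
  using tent_range(2)[OF coord_range[OF assms, of "i - 1"]] coord_step[OF assms, of "i - 1"] by simp

lemma coord_crit_forward:
  assumes "x \<in> X" "coord s x k = 1/2" shows "coord s x (k + 1 + int j) = (T ^^ j) tc"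
  using coord_pow[OF assms(1), of "Suc j" k] assms(2) tent_pow_c[of j] by (simp add: algebra_simps)

lemma coord_crit_return:
  assumes "x \<in> X" "coord s x k = 1/2" "coord s x (k + 1 + int j) = 1/2"
  shows "(T ^^ Suc j) (1/2) = 1/2"
  using coord_crit_forward[OF assms(1,2), of j] assms(3) tent_pow_c[of j] by simp

section \<open>The core interval, with left end \<open>low\<close> and right end
  \<open>tc\<close>\<close>

abbreviation low where "low \<equiv> T tc"

lemma low_eq: "low = s * (1 - s / 2)"
  using tent_half[of tc True] s_gt_1 s_le_2 by (simp add: half_iff)

lemma low_lt_half: "low < 1/2"
proof -
  have "(s - 1) * (s - 1) > 0" using s_gt_1 by (intro mult_pos_pos) auto
  then show ?thesis unfolding low_eq by (simp add: algebra_simps)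
qed

lemma low_nonneg: "0 \<le> low" unfolding low_eq using s_pos s_le_2 by simp

lemma core_invariant: assumes "low \<le> t" "t \<le> tc" shows "low \<le> T t"
proof -
  have t: "0 \<le> t" "t \<le> 1" using assms low_nonneg s_le_2 by auto
  have h: "t \<in> half (t \<ge> 1/2)" using half_exists t by blast
  show ?thesis
  proof (cases "t \<ge> 1/2")
    case True
    then have "T t = s * (1 - t)" using tent_half[OF h] by simp
    also have "\<dots> \<ge> s * (1 - s / 2)" using assms(2) s_pos by simp
    finally show ?thesis by (simp add: low_eq)
  next
    case False
    then have "T t = s * t" using tent_half[OF h] by simp
    also have "\<dots> \<ge> 1 * t" using t s_gt_1 by (intro mult_right_mono) auto
    finally show ?thesis using assms by simp
  qed
qed

lemma core_forward:
  assumes "x \<in> X" "low \<le> coord s x k" "k \<le> i" shows "low \<le> coord s x i"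
proof -
  have "low \<le> coord s x (k + int j)" for j
  proof (induction j)
    case (Suc j)
    then have "low \<le> T (coord s x (k + int j))" using coord_le_tc[OF assms(1)] by (intro core_invariant)
    then show ?case using coord_step[OF assms(1)] by (simp add: algebra_simps)
  qed (use assms in simp)
  from this[of "nat (i - k)"] assms(3) show ?thesis by simp
qed

lemma subword_drop: "drop j (subword \<sigma> i n) = subword \<sigma> (i + int j) (n - j)"
  by (rule nth_equalityI) (auto simp: subword_def algebra_simps)

lemma subword_length [simp]: "length (subword \<sigma> i n) = n" by (simp add: subword_def)

text \<open>A critical coordinate fits both symbols, but after an earlier critical coordinate the
  kneading sequence dictates the choice. Only the earliest critical index, if there is one, stays
  free.\<close>

definition crit_rule :: "(int \<Rightarrow> bool) \<Rightarrow> (nat \<Rightarrow> real) \<Rightarrow> bool" where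
  "crit_rule \<sigma> x \<longleftrightarrow> (\<forall>k k'. k' < k \<longrightarrow> coord s x k' = 1/2 \<longrightarrow> coord s x k = 1/2 \<longrightarrow> \<sigma> k = return_symbol)"

lemma valid_crit_kneading:
  assumes x: "x \<in> X" "valid \<sigma> x" "crit_rule \<sigma> x" "coord s x k = 1/2"
  shows "\<sigma> (k + 1 + int j) = knd j"
proof (cases "coord s x (k + 1 + int j) = 1/2")
  case True
  then have "\<sigma> (k + 1 + int j) = return_symbol"
    using x(3,4) unfolding crit_rule_def by (meson add_strict_increasing less_add_one of_nat_0_le_iff order_less_le_trans le_add_same_cancel1)
  then show ?thesis using kneading_return(1)[OF coord_crit_return[OF x(1,4) True]] by simp
next
  case False
  then show ?thesis
    using x(2) kneading_valid[of j] coord_crit_forward[OF x(1,4), of j] half_both by metis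
qed

text \<open>Words are compared through points, as every coordinate in question lies between
  \<open>low\<close> and \<open>tc\<close>. Because \<open>symbols_mono\<close> needs a strict
  inequality, the end values are treated apart: \<open>tc\<close> occurs only after a critical
  coordinate, and \<open>k2\<close> guarantees that a coordinate equal to \<open>low\<close> has a
  predecessor that is at least \<open>low\<close>.\<close>

lemma admissible_above:
  assumes x: "x \<in> X" "valid \<sigma> x" "crit_rule \<sigma> x" and k: "\<And>i. k \<le> i \<Longrightarrow> low \<le> coord s x i"
    and k2: "low < coord s x k \<or> (\<forall>i. low \<le> coord s x i)" and "k \<le> i"
  shows "admissible_word s (subword \<sigma> i n)"
  unfolding admissible_word_def
proof (intro allI impI conjI)
  fix m assume m: "m < length (subword \<sigma> i n)"
  define l where "l = i + int m"
  define N where "N = n - m"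
  have d: "drop m (subword \<sigma> i n) = map (\<lambda>j. \<sigma> (l + int j)) [0..<N]"
    unfolding subword_drop by (simp add: subword_def l_def N_def)
  have v: "(T ^^ j) (coord s x l) \<in> half (\<sigma> (l + int j))" for j
    using x(2) coord_pow[OF x(1)] by simp
  have len: "length (subword \<sigma> i n) - m = N" by (simp add: N_def)
  have eq: "\<sigma> (l' + int j) = knd j" if "coord s x l' = tc" for l' j
  proof -
    have "T (coord s x (l' - 1)) = tc" using coord_step[OF x(1), of "l' - 1"] that by simp
    then have "coord s x (l' - 1) = 1/2" using tent_eq_tc coord_range[OF x(1)] by blast
    from valid_crit_kneading[OF x this, of j] show ?thesis by simp
  qed
  show "word_preceq (drop m (subword \<sigma> i n)) (map knd [0..<length (subword \<sigma> i n) - m])"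
    unfolding d len
  proof (cases "coord s x l = tc")
    case True
    then show "word_preceq (map (\<lambda>j. \<sigma> (l + int j)) [0..<N]) (kword N)"
      using eq by (simp add: word_preceq_def)
  next
    case False
    then have "coord s x l < tc" using coord_le_tc[OF x(1), of l] by simp
    then show "word_preceq (map (\<lambda>j. \<sigma> (l + int j)) [0..<N]) (kword N)"
      by (rule symbols_mono) (use v kneading_valid in auto)
  qed
  have low_v: "(T ^^ j) low \<in> half (knd (Suc j))" for j
    using kneading_valid[of "Suc j"] by (simp only: funpow_Suc_right o_apply)
  have lk: "k \<le> l" using assms(6) by (simp add: l_def)
  show "word_preceq (map (\<lambda>j. kneading s (Suc j)) [0..<length (subword \<sigma> i n) - m]) (drop m (subword \<sigma> i n))"
    unfolding d len
  proof (cases "coord s x l = low")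
    case False
    then have "low < coord s x l" using k[OF lk] by simp
    then show "word_preceq (map (\<lambda>j. knd (Suc j)) [0..<N]) (map (\<lambda>j. \<sigma> (l + int j)) [0..<N])"
      by (rule symbols_mono) (use v low_v in auto)
  next
    case True
    have p: "low \<le> coord s x (l - 1)"
      using k2
    proof
      assume "low < coord s x k"
      then have "l \<noteq> k" using True by auto
      then show ?thesis using lk k[of "l - 1"] by simp
    qed auto
    let ?t = "coord s x (l - 1)"
    have Tt: "T ?t = s * (1 - s / 2)" using coord_step[OF x(1), of "l - 1"] True low_eq by simp
    have h: "?t \<in> half (?t \<ge> 1/2)" using half_exists coord_range[OF x(1)] by blast
    show "word_preceq (map (\<lambda>j. knd (Suc j)) [0..<N]) (map (\<lambda>j. \<sigma> (l + int j)) [0..<N])"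
    proof (cases "?t \<ge> 1/2")
      case True
      then have "?t = tc" using tent_half[OF h] Tt s_pos by simp
      from eq[OF this, of "Suc _"] show ?thesis by (simp add: word_preceq_def algebra_simps)
    next
      case f: False
      then have t: "?t = 1 - s / 2" using tent_half[OF h] Tt s_pos by simp
      \<comment> \<open>The left preimage \<open>1 - s / 2\<close> of \<open>low\<close> lies below
        \<open>low\<close> unless \<open>s = 2\<close>; in that case \<open>low\<close> is the fixed
        point 0, and both sequences consist of zeros.\<close>
      have "s = 2"
      proof (rule ccontr)
        assume "s \<noteq> 2"
        then have "1 * (1 - s / 2) < s * (1 - s / 2)" using s_gt_1 s_le_2 by (intro mult_strict_right_mono) auto
        then show False using t p low_eq by simp
      qed
      then have l0: "low = 0" unfolding low_eq by simp
      have T0: "(T ^^ j) 0 = 0" for j by (induction j) (auto simp: tent_def \<open>s = 2\<close>)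
      have "\<not> \<sigma> (l + int j)" "\<not> knd (Suc j)" for j
        using v[of j] low_v[of j] T0[of j] \<open>coord s x l = low\<close> by (auto simp: l0 half_iff split: if_splits)
      then show ?thesis by (simp add: word_preceq_def)
    qed
  qed
qed

text \<open>If all coordinates are in the core, all subwords are admissible. Otherwise some
  coordinate is below \<open>low\<close>; then so are all earlier ones, and they carry 0 because
  \<open>low < 1/2\<close>. The first 1, if any, marks a coordinate above \<open>low\<close>, after
  which the orbit stays in the core.\<close>

lemma valid_represents:
  assumes x: "x \<in> X" "valid \<sigma> x" "crit_rule \<sigma> x"
  shows "represents s \<sigma> x"
proof -
  have "\<sigma> \<in> adm_sequences s"
  proof (cases "\<forall>i. low \<le> coord s x i")
    case True
    then have "\<forall>i n. admissible_word s (subword \<sigma> i n)" using admissible_above[OF x, of _ _] by blast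
    then show ?thesis by (simp add: adm_sequences_def)
  next
    case False
    then obtain i0 where i0: "coord s x i0 < low" by (auto simp: not_le)
    have z: "\<not> \<sigma> i" if "i \<le> i0" for i
    proof -
      have "coord s x i < low" using core_forward[OF x(1) _ that] i0 by (meson not_le)
      then have "coord s x i < 1/2" using low_lt_half by simp
      then show ?thesis using x(2)[rule_format, of i] by (auto simp: half_iff split: if_splits)
    qed
    show ?thesis
    proof (cases "\<forall>i. \<not> \<sigma> i")
      case False
      then obtain i1 where i1: "\<sigma> i1" by auto
      then have "i1 > i0" using z by (meson not_le)
      define m where "m = (LEAST m. \<sigma> (i0 + int m))"
      have ex: "\<sigma> (i0 + int (nat (i1 - i0)))" using i1 \<open>i1 > i0\<close> by simp
      define k where "k = i0 + int m"
      have k1: "\<sigma> k" unfolding k_def m_def using ex by (rule LeastI)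
      have k2: "\<not> \<sigma> i" if "i < k" for i
      proof (cases "i \<le> i0")
        case False
        then have "nat (i - i0) < m" using that by (auto simp: k_def)
        then have "\<not> \<sigma> (i0 + int (nat (i - i0)))" unfolding m_def by (rule not_less_Least)
        then show ?thesis using False by simp
      qed (use z in auto)
      have lk: "low < coord s x k"
        using x(2)[rule_format, of k] k1 low_lt_half by (auto simp: half_iff)
      have "admissible_word s (subword \<sigma> i n)" if "k \<le> i" for i n
        using admissible_above[OF x _ _ that] core_forward[OF x(1) less_imp_le[OF lk]] lk by blast
      then show ?thesis unfolding adm_sequences_def using k1 k2 by blast
    qed (simp add: adm_sequences_def)
  qed
  then show ?thesis using x unfolding represents_def half_def by simp
qed

lemma representsD:
  assumes "represents s \<sigma> x" shows "\<sigma> \<in> adm_sequences s" "x \<in> X" "valid \<sigma> x"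
  using assms unfolding represents_def half_def by auto

lemma represents_exists:
  assumes "x \<in> X" shows "\<exists>\<sigma>. represents s \<sigma> x"
proof -
  define \<sigma> where "\<sigma> k = (if coord s x k = 1/2 then return_symbol else coord s x k \<ge> 1/2)" for k
  have "valid \<sigma> x"
    using half_exists coord_range[OF assms] by (auto simp: \<sigma>_def half_iff)
  moreover have "crit_rule \<sigma> x" by (simp add: crit_rule_def \<sigma>_def)
  ultimately show ?thesis using valid_represents assms by blast
qed

text \<open>Admissibility keeps the sequence below the kneading sequence, so at the first difference
  the latter carries 1 exactly if an even number of ones precedes. Counting this symbol too makes
  the number odd.\<close>

lemma adm_deviation_odd:
  assumes adm: "\<sigma> \<in> adm_sequences s" and eq: "\<And>l. l < j \<Longrightarrow> \<sigma> (i + int l) = knd l"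
    and ne: "\<sigma> (i + int j) \<noteq> knd j" and ex: "\<exists>i'\<ge>i. \<sigma> i'"
  shows "odd (ones (kword (Suc j)))"
proof (cases "j = 0")
  case True then show ?thesis using kneading_0 by simp
next
  case False
  then have "\<sigma> i" using eq[of 0] kneading_0 by simp
  then have "admissible_word s (subword \<sigma> i (Suc j))"
    using adm unfolding adm_sequences_def by (auto simp: not_less[symmetric])
  then have "word_preceq (drop 0 (subword \<sigma> i (Suc j))) (kword (Suc j))"
    unfolding admissible_word_def by fastforce
  then have "word_preceq (map (\<lambda>l. \<sigma> (i + int l)) [0..<Suc j]) (kword (Suc j))"
    by (simp add: subword_def del: upt_Suc)
  then have "knd j = even (ones (map (\<lambda>l. \<sigma> (i + int l)) [0..<j]))"
    unfolding word_preceq_order using eq ne by blast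
  moreover have "map (\<lambda>l. \<sigma> (i + int l)) [0..<j] = kword j" using eq by simp
  ultimately show ?thesis by auto
qed

text \<open>A deviation is possible only at another critical coordinate, hence at a return of the
  critical orbit. There the kneading word has an even number of ones, whereas a first deviation
  requires an odd number.\<close>

lemma represents_crit_kneading:
  assumes r: "represents s \<sigma> x" and c: "coord s x k = 1/2"
  shows "\<sigma> (k + 1 + int j) = knd j"
proof (rule ccontr)
  note rd = representsD[OF r]
  assume "\<sigma> (k + 1 + int j) \<noteq> knd j"
  then obtain j where ne: "\<sigma> (k + 1 + int j) \<noteq> knd j" and lt: "\<And>l. l < j \<Longrightarrow> \<sigma> (k + 1 + int l) = knd l"
    using exists_least_iff[of "\<lambda>j. \<sigma> (k + 1 + int j) \<noteq> knd j"] by auto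
  have h: "coord s x (k + 1 + int j) = 1/2"
    using rd(3) kneading_valid[of j] coord_crit_forward[OF rd(2) c, of j] half_both ne by metis
  have ret: "(T ^^ Suc j) (1/2) = 1/2" using coord_crit_return[OF rd(2) c h] .
  have "\<sigma> (k + 1)"
  proof -
    have "coord s x (k + 1) = tc" using coord_crit_forward[OF rd(2) c, of 0] by simp
    then show ?thesis using rd(3)[rule_format, of "k + 1"] s_gt_1 by (auto simp: half_iff split: if_splits)
  qed
  then have "odd (ones (kword (Suc j)))" by (intro adm_deviation_odd[OF rd(1) lt ne]) auto
  then show False using kneading_return(2)[OF ret] by simp
qed

text \<open>Disagreement occurs only at critical coordinates, and to the right of such an index both
  sequences continue with the kneading sequence. So there cannot be two indices of
  disagreement.\<close>

lemma represents_unique: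
  assumes r: "represents s \<sigma> x" "represents s \<tau> x" and "\<sigma> \<noteq> \<tau>"
  shows "\<exists>k. identified_at s k \<sigma> \<tau>"
proof -
  obtain k where k: "\<sigma> k \<noteq> \<tau> k" using \<open>\<sigma> \<noteq> \<tau>\<close> by auto
  have crit: "coord s x i = 1/2" if "\<sigma> i \<noteq> \<tau> i" for i
    using representsD(3)[OF r(1)] representsD(3)[OF r(2)] that half_both by blast
  have fw: "\<sigma> i = \<tau> i" if "l < i" "\<sigma> l \<noteq> \<tau> l" for i l
    using represents_crit_kneading[OF r(1) crit[OF that(2)], of "nat (i - l - 1)"]
      represents_crit_kneading[OF r(2) crit[OF that(2)], of "nat (i - l - 1)"] that by simp
  have "identified_at s k \<sigma> \<tau>"
    unfolding identified_at_def
  proof (intro conjI allI impI)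
    fix i :: int assume "i \<noteq> k" then show "\<sigma> i = \<tau> i" using fw k by (metis linorder_neqE)
  qed (use r representsD(1) k represents_crit_kneading[OF r(1) crit[OF k]] in auto)
  then show ?thesis ..
qed

text \<open>Fitting symbols without admissibility: unlike membership in a basic arc, this condition
  visibly passes to limits and to convex combinations. \<open>lvalid_represents\<close> and
  \<open>basic_arc_eq\<close> lead back.\<close>

abbreviation lvalid where "lvalid a x \<equiv> \<forall>i. x (Suc i) \<in> half (a i)"

lemma represents_lvalid: "represents s \<sigma> x \<Longrightarrow> lvalid (left_part \<sigma>) x"
proof
  fix i assume r: "represents s \<sigma> x"
  have "coord s x (- int (Suc i)) \<in> half (\<sigma> (- int (Suc i)))" using representsD(3)[OF r] by blast
  then show "x (Suc i) \<in> half (left_part \<sigma> i)" unfolding left_part_def coord_simps(2) .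
qed

lemma represents_left_admissible:
  assumes "represents s \<sigma> x" shows "left_admissible s (left_part \<sigma>)"
proof -
  have w: "rev (map (left_part \<sigma>) [i..<i + n]) = subword \<sigma> (- int (i + n)) n" for i n
    by (rule nth_equalityI) (auto simp: rev_nth left_part_def subword_def of_nat_diff algebra_simps)
  consider "\<forall>i n. admissible_word s (subword \<sigma> i n)" | "\<forall>i. \<not> \<sigma> i"
    | k where "\<forall>i<k. \<not> \<sigma> i" "\<sigma> k" "\<forall>i\<ge>k. \<forall>n. admissible_word s (subword \<sigma> i n)"
    using representsD(1)[OF assms] unfolding adm_sequences_def by blast
  then show ?thesis
  proof cases
    case 1 then show ?thesis by (simp add: left_admissible_def w)
  next
    case 2 then show ?thesis by (simp add: left_admissible_def left_part_def)
  next
    case 3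
    show ?thesis
    proof (cases "k < 0")
      case True
      define m where "m = nat (- k - 1)"
      have k: "k = - int (Suc m)" using True by (simp add: m_def)
      have "\<forall>i>m. \<not> left_part \<sigma> i" "left_part \<sigma> m" using 3(1,2) by (auto simp: left_part_def k)
      moreover have "\<forall>i n. i + n \<le> Suc m \<longrightarrow> admissible_word s (rev (map (left_part \<sigma>) [i..<i + n]))"
        using 3(3) unfolding w k by simp
      ultimately show ?thesis unfolding left_admissible_def by blast
    next
      case False
      then show ?thesis using 3(1) by (simp add: left_admissible_def left_part_def)
    qed
  qed
qed

lemma level_diff:
  assumes "x \<in> X" "w \<in> X"
    and "\<And>i. m \<le> i \<Longrightarrow> i < m + n \<Longrightarrow> x (Suc i) \<in> half (a i) \<and> w (Suc i) \<in> half (a i)"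
  shows "x m - w m = s ^ n * (- 1) ^ ones (map (\<lambda>j. a (m + n - 1 - j)) [0..<n]) * (x (m + n) - w (m + n))"
proof -
  have "(T ^^ n) (x (m + n)) - (T ^^ n) (w (m + n)) =
    s ^ n * (- 1) ^ ones (map (\<lambda>j. a (m + n - 1 - j)) [0..<n]) * (x (m + n) - w (m + n))"
  proof (rule tent_pow_diff)
    fix j assume j: "j < n"
    have e: "(T ^^ j) (y (m + n)) = y (Suc (m + n - 1 - j))" if "y \<in> X" for y
      using X_pow[OF that, of j "m + n - j"] j by (simp add: Suc_diff_Suc)
    show "(T ^^ j) (x (m + n)) \<in> half (a (m + n - 1 - j)) \<and> (T ^^ j) (w (m + n)) \<in> half (a (m + n - 1 - j))"
      unfolding e[OF assms(1)] e[OF assms(2)] using assms(3)[of "m + n - 1 - j"] j by auto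
  qed
  then show ?thesis using X_pow[OF assms(1)] X_pow[OF assms(2)] by simp
qed

text \<open>Under common symbols a difference of coordinates is only multiplied by a nonzero factor,
  so equality at level \<open>m\<close> propagates to all deeper levels; the other coordinates are
  images under \<open>T\<close>.\<close>

lemma level_inj:
  assumes "x \<in> X" "w \<in> X"
    and "\<And>i. m \<le> i \<Longrightarrow> x (Suc i) \<in> half (a i) \<and> w (Suc i) \<in> half (a i)"
    and "x m = w m"
  shows "x = w"
proof
  fix i
  show "x i = w i"
  proof (cases "m \<le> i")
    case True
    then obtain n where i: "i = m + n" using le_Suc_ex by blast
    have "x m - w m = s ^ n * (- 1) ^ ones (map (\<lambda>j. a (m + n - 1 - j)) [0..<n]) * (x (m + n) - w (m + n))"
      using assms by (intro level_diff) auto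
    then show ?thesis using assms(4) s_pos i by simp
  next
    case False
    then obtain n where m: "m = i + n" using le_Suc_ex nat_le_linear by blast
    show ?thesis using X_pow[OF assms(1), of n i] X_pow[OF assms(2), of n i] assms(4) m by simp
  qed
qed

text \<open>A second point with the same symbols shows on which side the critical orbit folds; hence the
  symbols forced at its returns are the admissible ones.\<close>

lemma lvalid_represents:
  assumes x: "x \<in> X" "lvalid a x" and w: "w \<in> X" "lvalid a w" and ne: "x \<noteq> w"
  shows "\<exists>\<sigma>. represents s \<sigma> x \<and> left_part \<sigma> = a"
proof -
  define \<sigma> where "\<sigma> k = (if k < 0 then a (nat (- k - 1)) else if coord s x k = 1/2 then return_symbol
    else coord s x k \<ge> 1/2)" for k
  have lp: "left_part \<sigma> = a" by (auto simp: left_part_def \<sigma>_def)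
  have xn: "x n \<noteq> w n" for n using level_inj[of x w n a] x w ne by blast
  have key: "a n = return_symbol" if n: "x (Suc n) = 1/2" "x (Suc n + Suc l) = 1/2" for n l
  proof -
    obtain j where j: "x (Suc n + Suc j) = 1/2" and lt: "\<And>i. i < j \<Longrightarrow> x (Suc n + Suc i) \<noteq> 1/2"
      using exists_least_iff[of "\<lambda>j. x (Suc n + Suc j) = 1/2"] n(2) by auto
    have xt: "x (Suc n + j) = tc" using X_step[OF x(1), of "Suc n + j", symmetric] j tent_c by (simp only: add_Suc_right)
    have orb: "(T ^^ i) tc = x (Suc n + j - i)" if "i \<le> j" for i
      using X_pow[OF x(1), of i "Suc n + j - i"] that unfolding xt[symmetric] by simp
    have sym: "a (n + j - i) = knd i" if "i < j" for i
    proof -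
      have "x (Suc n + j - i) \<noteq> 1/2" using lt[of "j - i - 1"] that by (simp add: Suc_diff_Suc Suc_diff_le)
      moreover have "x (Suc n + j - i) \<in> half (a (n + j - i))"
        using x(2)[rule_format, of "n + j - i"] that by (simp add: Suc_diff_le)
      moreover have "x (Suc n + j - i) \<in> half (knd i)" using kneading_valid[of i] orb[of i] that by simp
      ultimately show ?thesis using half_both by blast
    qed
    have ret: "(T ^^ Suc j) (1/2) = 1/2" using orb[of j] n(1) unfolding tent_pow_c by simp
    have kj: "knd j = odd (ones (kword j))" using kneading_return(2)[OF ret] by auto
    have mk: "map (\<lambda>i. a (Suc n + j - 1 - i)) [0..<j] = kword j" using sym by simp
    \<comment> \<open>At level \<open>Suc n + j\<close> the point \<open>w\<close> is strictly below
      the maximum \<open>tc\<close> attained by \<open>x\<close>. The affine map therefore sends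
      \<open>w (Suc n)\<close> to the side of \<open>1/2\<close> given by the parity of
      \<open>kword j\<close>, and \<open>a n\<close> has to name this side.\<close>
    have d: "x (Suc n) - w (Suc n) = s ^ j * (- 1) ^ ones (kword j) * (tc - w (Suc n + j))"
      unfolding xt[symmetric] mk[symmetric] using x(2) w(2) by (intro level_diff x(1) w(1)) blast
    have "w (Suc n + j) < tc" using X_le_tc[OF w(1), of "Suc n + j"] xn[of "Suc n + j"] xt by simp
    then have p: "s ^ j * (tc - w (Suc n + j)) > 0" using s_pos by simp
    have wn: "w (Suc n) \<in> half (a n)" using w(2) by blast
    have "a n = odd (ones (kword j))"
    proof (cases "even (ones (kword j))")
      case True
      then have "w (Suc n) < 1/2" using d p n(1) by simp
      then show ?thesis using wn True by (auto simp: half_iff split: if_splits)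
    next
      case False
      then have "w (Suc n) > 1/2" using d p n(1) by simp
      then show ?thesis using wn False by (auto simp: half_iff split: if_splits)
    qed
    then show ?thesis using kj kneading_return(1)[OF ret] by simp
  qed
  have "valid \<sigma> x"
  proof
    fix i :: int
    show "coord s x i \<in> half (\<sigma> i)"
    proof (cases "i < 0")
      case True
      then obtain n where i: "i = - int (Suc n)" by (metis int_cases negD)
      show ?thesis unfolding i coord_simps(2) using x(2) by (simp add: \<sigma>_def)
    next
      case False
      then show ?thesis using half_exists coord_range[OF x(1)] by (auto simp: \<sigma>_def half_iff)
    qed
  qed
  moreover have "crit_rule \<sigma> x"
    unfolding crit_rule_def
  proof (intro allI impI)
    fix k k' assume k: "k' < k" "coord s x k' = 1/2" "coord s x k = 1/2"
    show "\<sigma> k = return_symbol"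
    proof (cases "k < 0")
      case True
      then obtain n where kn: "k = - int (Suc n)" by (metis int_cases negD)
      define l where "l = nat (k - k' - 1)"
      have k': "k' = - int (Suc n + Suc l)" using k(1) kn by (simp add: l_def)
      show ?thesis using key[of n l] k(2,3) unfolding kn k' coord_simps(2) by (simp add: \<sigma>_def)
    qed (use k in \<open>simp add: \<sigma>_def\<close>)
  qed
  ultimately show ?thesis using valid_represents[OF x(1)] lp by blast
qed

subsection \<open>Identified left parts\<close>

text \<open>A semicircle of level \<open>n\<close> joins left parts that differ exactly at the symbol \<open>n\<close> and start with the
  first \<open>n\<close> symbols of the kneading sequence in reverse order. It opens to the right if \<open>orient n = 1\<close>, to
  the left otherwise.\<close>

definition kmatch :: "nat \<Rightarrow> (nat \<Rightarrow> bool) \<Rightarrow> bool" where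
  "kmatch n a \<longleftrightarrow> (\<forall>i<n. a i = knd (n - 1 - i))"

definition orient :: "nat \<Rightarrow> real" where
  "orient n = (- 1) ^ ones (kword n)"

lemma orient_cases: "orient n = 1 \<or> orient n = - 1"
  unfolding orient_def by (cases "even (ones (kword n))") auto

text \<open>On points with these symbols \<open>T ^^ n\<close> is affine with a slope of sign
  \<open>orient n\<close>, and no coordinate exceeds \<open>tc\<close>. Geometrically, every segment
  matching at level \<open>n\<close> stays on the side away from the semicircles of that
  level.\<close>

lemma kmatch_side:
  assumes "x \<in> X" "lvalid a x" "kmatch n a"
  shows "orient n * (x 0 - (T ^^ n) tc) \<le> 0"
proof -
  have "(T ^^ n) (x n) - (T ^^ n) tc = s ^ n * (- 1) ^ ones (kword n) * (x n - tc)"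
  proof (rule tent_pow_diff)
    fix j assume j: "j < n"
    have "(T ^^ j) (x n) = x (Suc (n - 1 - j))"
      using X_pow[OF assms(1), of j "n - j"] j by (simp add: Suc_diff_Suc)
    moreover have "a (n - 1 - j) = knd j" using assms(3)[unfolded kmatch_def, rule_format, of "n - 1 - j"] j by simp
    ultimately show "(T ^^ j) (x n) \<in> half (knd j) \<and> (T ^^ j) tc \<in> half (knd j)"
      using assms(2)[rule_format, of "n - 1 - j"] kneading_valid by simp
  qed
  then have "x 0 - (T ^^ n) tc = s ^ n * orient n * (x n - tc)"
    using X_pow[OF assms(1), of n 0] by (simp add: orient_def)
  then have "orient n * (x 0 - (T ^^ n) tc) = s ^ n * (orient n * orient n) * (x n - tc)"
    by (simp only: mult_ac)
  also have "orient n * orient n = 1" using orient_cases[of n] by auto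
  also have "s ^ n * 1 * (x n - tc) \<le> 0"
    using X_le_tc[OF assms(1), of n] s_pos by (simp add: mult_nonneg_nonpos)
  finally show ?thesis .
qed

text \<open>All that the planar argument retains of two identified sequences; \<open>x\<close> is
  the common endpoint of the two basic arcs. In the last clause, proved in
  \<open>kmatch_longer\<close>, admissibility enters the geometry.\<close>

definition joined :: "nat \<Rightarrow> (nat \<Rightarrow> bool) \<Rightarrow> (nat \<Rightarrow> bool) \<Rightarrow> (nat \<Rightarrow> real) \<Rightarrow> bool" where
  "joined n a b x \<longleftrightarrow> x \<in> X \<and> lvalid a x \<and> lvalid b x \<and> kmatch n a \<and> kmatch n b \<and> a n \<noteq> b n \<and>
     (\<forall>i. i \<noteq> n \<longrightarrow> a i = b i) \<and> x 0 = (T ^^ n) tc \<and>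
     (\<forall>m>n. kmatch m a \<or> kmatch m b \<longrightarrow> orient m \<noteq> orient n)"

text \<open>If \<sigma> matches at level \<open>m\<close>, then \<tau> first leaves the kneading
  sequence at the index where both differ, which is position \<open>j = m - n - 1\<close> of the
  word. Hence \<open>kword (Suc j)\<close> has an odd number of ones. The remaining \<open>n\<close>
  symbols form \<open>kword n\<close> again, so the parities for \<open>m\<close> and
  \<open>n\<close> differ.\<close>

lemma kmatch_longer:
  assumes i: "identified_at s (- int (Suc n)) \<sigma> \<tau>" and m: "n < m" "kmatch m (left_part \<sigma>)"
  shows "orient m \<noteq> orient n"
proof -
  have sig: "\<sigma> (int l - int m) = knd l" if "l < m" for l
    using m(2)[unfolded kmatch_def, rule_format, of "m - 1 - l"] that
    by (simp add: left_part_def of_nat_diff algebra_simps)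
  define j where "j = m - n - 1"
  have sj: "m = Suc j + n" using m(1) by (simp add: j_def)
  have \<tau>0: "\<tau> (- int n)" and \<tau>: "\<And>i. i \<noteq> - int (Suc n) \<Longrightarrow> \<sigma> i = \<tau> i" "\<sigma> (- int (Suc n)) \<noteq> \<tau> (- int (Suc n))"
    and nu: "\<And>j. \<sigma> (- int n + int j) = knd j"
  proof -
    show nu: "\<sigma> (- int n + int j) = knd j" for j
      using i unfolding identified_at_def by (simp add: algebra_simps)
    show "\<And>i. i \<noteq> - int (Suc n) \<Longrightarrow> \<sigma> i = \<tau> i" "\<sigma> (- int (Suc n)) \<noteq> \<tau> (- int (Suc n))"
      using i unfolding identified_at_def by auto
    from this(1)[of "- int n"] nu[of 0] show "\<tau> (- int n)" using kneading_0 by simp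
  qed
  have "odd (ones (kword (Suc j)))"
  proof (rule adm_deviation_odd[of \<tau> _ "- int m"])
    show "\<tau> \<in> adm_sequences s" using i unfolding identified_at_def by auto
    show "\<tau> (- int m + int l) = knd l" if "l < j" for l
      using sig[of l] \<tau>(1)[of "- int m + int l"] that sj by (simp add: algebra_simps)
    show "\<tau> (- int m + int j) \<noteq> knd j"
      using sig[of j] \<tau>(2) sj by (simp add: algebra_simps)
    show "\<exists>i'\<ge>- int m. \<tau> i'" using \<tau>0 m(1) by (intro exI[of _ "- int n"]) auto
  qed
  moreover have "ones (kword m) = ones (kword (Suc j)) + ones (kword n)"
  proof -
    have "knd (Suc j + i) = knd i" if "i < n" for i
      using sig[of "Suc j + i"] nu[of i] that sj by (simp add: algebra_simps)
    then have "map (\<lambda>i. knd (Suc j + i)) [0..<n] = kword n" by simp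
    then show ?thesis using kneading_split[of "Suc j" n] unfolding sj by (simp only:)
  qed
  ultimately show ?thesis by (cases "even (ones (kword n))") (auto simp: orient_def)
qed

lemma identified_at_sym: "identified_at s k \<sigma> \<tau> \<Longrightarrow> identified_at s k \<tau> \<sigma>"
  unfolding identified_at_def by auto

lemma identified_joined:
  assumes i: "identified_at s k \<sigma> \<tau>" and "k < 0" and r: "represents s \<sigma> x" "represents s \<tau> x"
  defines "n \<equiv> nat (- k - 1)"
  shows "k = - int (Suc n)" "joined n (left_part \<sigma>) (left_part \<tau>) x"
    "ones (subword \<sigma> (k + 1) n) = ones (kword n)"
proof -
  show k: "k = - int (Suc n)" using \<open>k < 0\<close> by (simp add: n_def)
  note rd = representsD[OF r(1)] representsD[OF r(2)]
  have nu: "\<sigma> (- int n + int j) = knd j" for j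
    using i unfolding identified_at_def k by (simp add: algebra_simps)
  have ne: "\<sigma> k \<noteq> \<tau> k" and eq: "\<And>i. i \<noteq> k \<Longrightarrow> \<sigma> i = \<tau> i" using i unfolding identified_at_def by auto
  have "subword \<sigma> (k + 1) n = kword n" using nu by (simp add: subword_def k)
  then show "ones (subword \<sigma> (k + 1) n) = ones (kword n)" by simp
  have "coord s x k = 1/2" using rd(3,6) ne half_both by blast
  from coord_crit_forward[OF rd(2) this, of n] have "x 0 = (T ^^ n) tc" by (simp add: k coord_simps)
  moreover have m: "kmatch n (left_part \<sigma>)" unfolding kmatch_def
  proof (intro allI impI)
    fix i assume "i < n"
    then show "left_part \<sigma> i = knd (n - 1 - i)" using nu[of "n - 1 - i"] by (simp add: left_part_def of_nat_diff)
  qed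
  moreover have l: "\<forall>i. i \<noteq> n \<longrightarrow> left_part \<sigma> i = left_part \<tau> i" using eq k by (auto simp: left_part_def)
  moreover have "kmatch n (left_part \<tau>)" using m l by (simp add: kmatch_def)
  moreover have "left_part \<sigma> n \<noteq> left_part \<tau> n" using ne by (simp add: left_part_def k)
  moreover have "orient m \<noteq> orient n" if "m > n" "kmatch m (left_part \<sigma>) \<or> kmatch m (left_part \<tau>)" for m
    using kmatch_longer[of n \<sigma> \<tau> m] kmatch_longer[of n \<tau> \<sigma> m] i identified_at_sym[OF i] that k by blast
  ultimately show "joined n (left_part \<sigma>) (left_part \<tau>) x"
    unfolding joined_def using rd(2) represents_lvalid[OF r(1)] represents_lvalid[OF r(2)] by blast
qed

lemma represents_left_cases:
  assumes r: "represents s \<sigma> x" "represents s \<tau> x" and "left_part \<sigma> \<noteq> left_part \<tau>"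
  shows "\<exists>k<0. identified_at s k \<sigma> \<tau>"
proof -
  have "\<sigma> \<noteq> \<tau>" using assms by auto
  then obtain k where k: "identified_at s k \<sigma> \<tau>" using represents_unique r by blast
  obtain i where "left_part \<sigma> i \<noteq> left_part \<tau> i" using assms(3) by auto
  then have "k = - int (Suc i)" using k unfolding identified_at_def left_part_def by metis
  then show ?thesis using k by (intro exI[of _ k]) auto
qed

end

section \<open>Geometry of the drawing\<close>

subsection \<open>Heights\<close>

text \<open>The sign in the series for \<open>psi\<close>, see \<open>flip_eq_powi\<close>. As a
  product it visibly changes at the disagreements with \<open>L\<close> and nowhere else.\<close>

definition flip :: "(nat \<Rightarrow> bool) \<Rightarrow> (nat \<Rightarrow> bool) \<Rightarrow> nat \<Rightarrow> real" where
  "flip L a n = (\<Prod>i<n. if L i = a i then 1 else - 1)"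

text \<open>The heights of all sequences with the same first \<open>n\<close> symbols as \<open>a\<close> lie within \<open>gap n\<close> of
  \<open>ctr L n a\<close>.\<close>

definition ctr :: "(nat \<Rightarrow> bool) \<Rightarrow> nat \<Rightarrow> (nat \<Rightarrow> bool) \<Rightarrow> real" where
  "ctr L n a = 1/2 + (\<Sum>i<n. flip L a (Suc i) / 3 ^ Suc i)"

text \<open>The sum of all \<open>3 ^ (- i)\<close> with \<open>i > n\<close>, hence the most that
  the symbols after the first \<open>n\<close> can move a height.\<close>

definition gap :: "nat \<Rightarrow> real" where "gap n = 1 / (2 * 3 ^ n)"

lemma gap_pos: "gap n > 0" and gap_Suc: "gap n = 3 * gap (Suc n)"
  by (auto simp: gap_def)

lemma gap_mono: "m \<le> n \<Longrightarrow> gap n \<le> gap m"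
  by (auto simp: gap_def intro!: divide_left_mono power_increasing)

lemma gap_lim: "gap \<longlonglongrightarrow> 0"
proof -
  have "(\<lambda>n. (1/2) * (1/3::real) ^ n) \<longlonglongrightarrow> (1/2) * 0"
    by (intro tendsto_mult tendsto_const LIMSEQ_power_zero) auto
  then show ?thesis by (simp add: gap_def[abs_def] power_one_over)
qed

lemma flip_cases: "flip L a n = 1 \<or> flip L a n = - 1"
  by (induction n) (auto simp: flip_def)

lemma flip_sq: "flip L a n * flip L a n = 1" using flip_cases[of L a n] by auto

lemma flip_Suc: "flip L a (Suc n) = (if L n = a n then flip L a n else - flip L a n)"
  by (simp add: flip_def)

lemma flip_eq_powi: "(- 1) powi (int (ones (map L [0..<n])) - int (ones (map a [0..<n]))) = flip L a n"
proof (induction n)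
  case (Suc n)
  let ?k = "int (ones (map L [0..<n])) - int (ones (map a [0..<n]))"
  have "(- 1 :: real) powi (?k + 1) = - ((- 1) powi ?k)" "(- 1 :: real) powi (?k - 1) = - ((- 1) powi ?k)"
    by (simp_all add: power_int_add power_int_diff)
  moreover have "int (ones (map L [0..<Suc n])) - int (ones (map a [0..<Suc n])) =
      (if L n = a n then ?k else if L n then ?k + 1 else ?k - 1)" by auto
  ultimately show ?case using Suc by (simp add: flip_Suc)
qed (simp add: flip_def)

lemma psi_flip: "psi L a = (\<Sum>i. flip L a (Suc i) / 3 ^ Suc i) + 1/2"
  unfolding psi_def flip_eq_powi ..

lemma ctr_Suc: "ctr L (Suc n) a = ctr L n a + 2 * flip L a (Suc n) * gap (Suc n)"
  by (simp add: ctr_def gap_def)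

lemma ctr_lim: "(\<lambda>n. ctr L n a) \<longlonglongrightarrow> psi L a"
proof -
  have "summable (\<lambda>i. flip L a (Suc i) / 3 ^ Suc i)"
  proof (rule summable_comparison_test')
    show "summable (\<lambda>i. (1/3::real) ^ Suc i)" by (intro summable_Suc_iff[THEN iffD2] summable_geometric) simp
    show "norm (flip L a (Suc i) / 3 ^ Suc i) \<le> (1/3) ^ Suc i" for i
      using flip_cases[of L a "Suc i"] by (auto simp: power_one_over)
  qed
  from summable_LIMSEQ[OF this] show ?thesis unfolding ctr_def psi_flip
    by (subst add.commute) (intro tendsto_add tendsto_const)
qed

text \<open>One step moves the centre by \<open>2 * gap (Suc n) = gap n - gap (Suc n)\<close>, so
  the intervals of the cylinders are nested.\<close>

lemma ctr_ctr: "n \<le> m \<Longrightarrow> \<bar>ctr L m a - ctr L n a\<bar> \<le> gap n - gap m"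
proof (induction m rule: dec_induct)
  case (step m)
  then show ?case using flip_cases[of L a "Suc m"] gap_Suc[of m] gap_pos[of "Suc m"] unfolding ctr_Suc by auto
qed simp

lemma psi_ctr: "\<bar>psi L a - ctr L n a\<bar> \<le> gap n"
proof (rule LIMSEQ_le_const2)
  show "(\<lambda>m. \<bar>ctr L m a - ctr L n a\<bar>) \<longlonglongrightarrow> \<bar>psi L a - ctr L n a\<bar>"
    by (intro tendsto_intros ctr_lim)
  show "\<exists>N. \<forall>m\<ge>N. \<bar>ctr L m a - ctr L n a\<bar> \<le> gap n"
    using ctr_ctr[of n _ L a] gap_pos by (smt (verit) less_imp_le)
qed

lemma flip_agree: "(\<And>i. i < n \<Longrightarrow> a i = b i) \<Longrightarrow> flip L a n = flip L b n"
  unfolding flip_def by (intro prod.cong) auto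

lemma ctr_agree: "(\<And>i. i < n \<Longrightarrow> a i = b i) \<Longrightarrow> ctr L n a = ctr L n b"
  unfolding ctr_def by (intro arg_cong2[where f = "(+)"] sum.cong arg_cong2[where f = "(/)"] flip_agree refl) auto

text \<open>At the first difference the signs become opposite, which puts the centres
  \<open>4 * gap (Suc j)\<close> apart; afterwards each of them moves by at most
  \<open>gap (Suc j) - gap n\<close>.\<close>

lemma ctr_separated:
  assumes "i < n" "a i \<noteq> b i" shows "4 * gap n \<le> \<bar>ctr L n a - ctr L n b\<bar>"
proof -
  obtain j where j: "a j \<noteq> b j" "\<And>i. i < j \<Longrightarrow> a i = b i" "j \<le> i"
    using exists_least_iff[of "\<lambda>i. a i \<noteq> b i"] assms(2) by (meson not_le)
  have "ctr L j a = ctr L j b" "flip L a j = flip L b j" using j(2) by (auto intro: ctr_agree flip_agree)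
  then have "\<bar>ctr L (Suc j) a - ctr L (Suc j) b\<bar> = 4 * gap (Suc j)"
    using j(1) gap_pos[of "Suc j"] flip_cases[of L b j] unfolding ctr_Suc flip_Suc by auto
  moreover have "Suc j \<le> n" using j(3) assms(1) by simp
  ultimately show ?thesis using ctr_ctr[of "Suc j" n L a] ctr_ctr[of "Suc j" n L b] gap_mono[of "Suc j" n]
    by linarith
qed

text \<open>A sequence with the same tail as \<open>L\<close> has an extreme height in its cylinder, so the gap next
  to the cylinder is free of other heights.\<close>

context
  fixes L a :: "nat \<Rightarrow> bool" and N :: nat
  assumes tail: "\<forall>i\<ge>N. a i = L i"
begin

lemma flip_tail: "N \<le> n \<Longrightarrow> flip L a n = flip L a N"
  by (induction n rule: dec_induct) (auto simp: flip_Suc tail)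

text \<open>From \<open>N\<close> on all terms have one sign, so the geometric rest adds up to the
  full \<open>gap N\<close>.\<close>

lemma psi_tail: "psi L a = ctr L N a + flip L a N * gap N"
proof (rule LIMSEQ_unique[OF ctr_lim])
  have e: "ctr L n a = ctr L N a + flip L a N * (gap N - gap n)" if "N \<le> n" for n
    using that
  proof (induction n rule: dec_induct)
    case (step n)
    then show ?case using flip_tail[of "Suc n"] gap_Suc[of n] by (simp add: ctr_Suc algebra_simps)
  qed simp
  have "(\<lambda>n. ctr L N a + flip L a N * (gap N - gap n)) \<longlonglongrightarrow> ctr L N a + flip L a N * (gap N - 0)"
    by (intro tendsto_intros gap_lim)
  then have "(\<lambda>n. ctr L N a + flip L a N * (gap N - gap n)) \<longlonglongrightarrow> ctr L N a + flip L a N * gap N"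
    by simp
  then show "(\<lambda>n. ctr L n a) \<longlonglongrightarrow> ctr L N a + flip L a N * gap N"
    by (rule Lim_transform_eventually) (rule eventually_sequentiallyI[of N], rule e[symmetric])
qed

text \<open>The shifted height keeps away from level-\<open>n\<close> semicircles centred in another
  cylinder, as their radius is at most \<open>gap n\<close>. If the cylinders already differ within
  the first \<open>N\<close> symbols, separation of centres leaves room for \<open>d\<close>;
  otherwise \<open>psi L a\<close> is extreme in the common cylinder and the shift leads out of
  it.\<close>

lemma gap_ctr:
  assumes d: "0 \<le> d" "d \<le> gap N" and "i < n" "a i \<noteq> b i"
  shows "2 * gap n \<le> \<bar>psi L a + flip L a N * d - ctr L n b\<bar>"
proof -
  have sep: "4 * gap n \<le> \<bar>ctr L n a - ctr L n b\<bar>" if "i < n" "a i \<noteq> b i" for i n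
    using that by (rule ctr_separated)
  have fd: "\<bar>flip L a N * d\<bar> = d" using flip_cases[of L a N] d by auto
  have low: "2 * gap n \<le> \<bar>psi L a + flip L a N * d - ctr L n b\<bar>" if "n \<le> N" "i < n" "a i \<noteq> b i" for i n
    using sep[OF that(2,3)] psi_ctr[of L a n] gap_mono[OF that(1)] fd d by linarith
  show ?thesis
  proof (cases "n \<le> N")
    case False
    show ?thesis
    proof (cases "\<exists>i<N. a i \<noteq> b i")
      case True
      then have "2 * gap N \<le> \<bar>psi L a + flip L a N * d - ctr L N b\<bar>" using low by blast
      then show ?thesis using ctr_ctr[of N n L b] gap_mono[of N n] False by linarith
    next
      case agree: False
      then have c: "ctr L N a = ctr L N b" by (intro ctr_agree) auto
      have "3 * gap n \<le> \<bar>psi L a - ctr L n b\<bar>" using sep[OF assms(3,4)] psi_ctr[of L a n] by linarith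
      moreover have "\<bar>ctr L n b - ctr L N b\<bar> \<le> gap N - gap n" using ctr_ctr[of N n L b] False by simp
      ultimately show ?thesis using flip_cases[of L a N] gap_pos[of n] d c unfolding psi_tail by auto
    qed
  qed (use low assms in blast)
qed

lemma gap_psi:
  assumes d: "0 < d" "d \<le> gap N"
  shows "psi L a + flip L a N * d \<noteq> psi L b"
proof (cases "\<exists>i<N. a i \<noteq> b i")
  case True
  then show ?thesis using gap_ctr[of d _ N b] d psi_ctr[of L b N] gap_pos[of N] by fastforce
next
  case False
  then have "ctr L N a = ctr L N b" by (intro ctr_agree) auto
  then show ?thesis using psi_ctr[of L b N] flip_cases[of L a N] d unfolding psi_tail by auto
qed

end

text \<open>A point at height about \<open>H\<close> and close to the vertical through the centre of
  a circle determines the radius up to little more than \<open>k\<close>. The factor 3/2 is small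
  enough for both uses: separations of \<open>2 * gap m\<close> with \<open>k = gap m\<close>, and
  of \<open>3 * gap n\<close> with \<open>k = 2 * gap n\<close>.\<close>

lemma pythagoras_bound:
  fixes A B H k \<rho> :: real
  assumes "A\<^sup>2 + B\<^sup>2 = \<rho>\<^sup>2" "0 \<le> \<rho>" "\<bar>A\<bar> \<le> k" "\<bar>B - H\<bar> \<le> k" "0 < k" "k \<le> H"
  shows "\<bar>\<rho> - H\<bar> < 3 / 2 * k"
proof -
  have "0 \<le> B" using assms by linarith
  have "B\<^sup>2 \<le> \<rho>\<^sup>2" using assms(1) by (smt (verit) zero_le_power2)
  then have "B \<le> \<rho>" using assms(2) by (rule power2_le_imp_le)
  moreover have "\<rho> < H + 3 / 2 * k"
  proof (rule power_less_imp_less_base)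
    have "A\<^sup>2 \<le> k\<^sup>2" using assms(3) by (simp add: abs_le_square_iff[symmetric])
    moreover have "B\<^sup>2 \<le> (H + k)\<^sup>2" using \<open>0 \<le> B\<close> assms(4) by (intro power_mono) auto
    moreover have "k\<^sup>2 + (H + k)\<^sup>2 < (H + 3 / 2 * k)\<^sup>2"
    proof -
      have "H * k > 0" "k * k > 0" using assms(5,6) by auto
      then show ?thesis by (simp add: power2_eq_square algebra_simps)
    qed
    ultimately show "\<rho>\<^sup>2 < (H + 3 / 2 * k)\<^sup>2" using assms(1) by linarith
  qed (use assms in auto)
  ultimately show ?thesis using assms unfolding abs_less_iff abs_le_iff by (intro conjI) linarith+
qed

lemma semicircle_iff:
  "(u, v) \<in> semicircle p y z right \<longleftrightarrow>
   (u - p)\<^sup>2 + (v - (y + z) / 2)\<^sup>2 = ((y - z) / 2)\<^sup>2 \<and> (if right then u \<ge> p else u \<le> p)"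
proof -
  have r: "\<bar>y - z\<bar> / 2 = sqrt (((y - z) / 2)\<^sup>2)" by simp
  have "dist (u, v) (p, (y + z) / 2) = sqrt ((u - p)\<^sup>2 + (v - (y + z) / 2)\<^sup>2)"
    by (simp only: dist_Pair_Pair dist_real_def power2_abs)
  then show ?thesis unfolding semicircle_def mem_Collect_eq r fst_conv by (simp only: real_sqrt_eq_iff)
qed

context tent_map begin

subsection \<open>Points off the drawing\<close>

definition crit_pos :: "nat \<Rightarrow> real" where "crit_pos n = (T ^^ n) tc"

text \<open>The radius is a free, possibly negative parameter, so the same formula gives the
  semicircles of the drawing and the concentric copies beside them.\<close>

definition arch :: "(nat \<Rightarrow> bool) \<Rightarrow> nat \<Rightarrow> (nat \<Rightarrow> bool) \<Rightarrow> real \<Rightarrow> (real \<times> real) set" where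
  "arch L n a \<rho> = {(u, v). 0 \<le> orient n * (u - crit_pos n) \<and> (u - crit_pos n)\<^sup>2 + (v - ctr L n a)\<^sup>2 = \<rho>\<^sup>2}"

lemma kmatch_agree: "kmatch n a \<Longrightarrow> kmatch n b \<Longrightarrow> i < n \<Longrightarrow> a i = b i"
  unfolding kmatch_def by simp

lemma kmatch_ctr: "kmatch n a \<Longrightarrow> kmatch n b \<Longrightarrow> ctr L n a = ctr L n b"
  by (intro ctr_agree kmatch_agree)

lemma kmatch_differ: "kmatch n a \<Longrightarrow> \<not> kmatch n b \<Longrightarrow> \<exists>i<n. b i \<noteq> a i"
  unfolding kmatch_def by auto

lemma joined_flip:
  assumes "joined n a b x" "n < m" shows "flip L b m = - flip L a m"
  using assms(2)
proof (induction m)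
  case (Suc m)
  show ?case
  proof (cases "m = n")
    case True
    have "flip L b n = flip L a n" using assms(1) unfolding joined_def by (intro flip_agree) (auto simp: kmatch_agree)
    then show ?thesis using True assms(1) unfolding joined_def flip_Suc by auto
  next
    case False
    then show ?thesis using Suc assms(1) unfolding joined_def flip_Suc by auto
  qed
qed simp

lemma joined_ctr:
  assumes "joined n a b x" "n \<le> m" shows "ctr L m b - ctr L n b = - (ctr L m a - ctr L n a)"
  using assms(2) by (induction m rule: dec_induct) (auto simp: ctr_Suc joined_flip[OF assms(1)])

text \<open>The one changed symbol reverses all signs after level \<open>n\<close>, so the two
  heights are mirror images in the level-\<open>n\<close> centre. This centre depends only on the
  matched symbols, whence all semicircles of one level are concentric.\<close>

lemma joined_psi:
  assumes "joined n a b x"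
  shows "psi L b - ctr L n a = - (psi L a - ctr L n a)" "(psi L a + psi L b) / 2 = ctr L n a"
    "(psi L a - psi L b) / 2 = psi L a - ctr L n a"
proof -
  have "(\<lambda>m. ctr L m b - ctr L n b) \<longlonglongrightarrow> psi L b - ctr L n b" by (intro tendsto_intros ctr_lim)
  moreover have "(\<lambda>m. ctr L m b - ctr L n b) \<longlonglongrightarrow> - (psi L a - ctr L n a)"
  proof (rule Lim_transform_eventually)
    show "(\<lambda>m. - (ctr L m a - ctr L n a)) \<longlonglongrightarrow> - (psi L a - ctr L n a)" by (intro tendsto_intros ctr_lim)
    show "\<forall>\<^sub>F m in sequentially. - (ctr L m a - ctr L n a) = ctr L m b - ctr L n b"
      using joined_ctr[OF assms] by (intro eventually_sequentiallyI[of n]) simp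
  qed
  ultimately have "psi L b - ctr L n b = - (psi L a - ctr L n a)" by (rule LIMSEQ_unique)
  moreover have "ctr L n b = ctr L n a" using assms kmatch_ctr unfolding joined_def by blast
  ultimately show 1: "psi L b - ctr L n a = - (psi L a - ctr L n a)" by simp
  then show "(psi L a + psi L b) / 2 = ctr L n a" "(psi L a - psi L b) / 2 = psi L a - ctr L n a"
    by (simp_all add: field_simps)
qed

text \<open>The next term of the series contributes \<open>2 * gap (Suc n)\<close>, and all later
  ones together at most \<open>gap (Suc n)\<close> against it.\<close>

lemma psi_upper:
  "gap (Suc n) \<le> flip L a (Suc n) * (psi L a - ctr L n a)"
proof -
  have "flip L a (Suc n) * (psi L a - ctr L n a) =
     2 * gap (Suc n) + flip L a (Suc n) * (psi L a - ctr L (Suc n) a)"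
    using flip_cases[of L a "Suc n"] by (auto simp: ctr_Suc)
  then show ?thesis using flip_cases[of L a "Suc n"] psi_ctr[of L a "Suc n"] by auto
qed

lemma ctr_upper:
  assumes "n < m" shows "gap (Suc n) + gap m \<le> flip L a (Suc n) * (ctr L m a - ctr L n a)"
proof -
  have "flip L a (Suc n) * (ctr L m a - ctr L n a) =
     2 * gap (Suc n) + flip L a (Suc n) * (ctr L m a - ctr L (Suc n) a)"
    using flip_cases[of L a "Suc n"] by (auto simp: ctr_Suc)
  then show ?thesis using flip_cases[of L a "Suc n"] ctr_ctr[of "Suc n" m L a] assms by auto
qed

lemma semicircle_arch:
  assumes "joined n a b x"
  shows "semicircle (x 0) (psi L a) (psi L b) (even (ones (kword n))) = arch L n a (psi L a - ctr L n a)"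
proof -
  have e: "even (ones (kword n)) \<longleftrightarrow> orient n = 1"
    by (cases "even (ones (kword n))") (auto simp: orient_def)
  have x: "x 0 = crit_pos n" using assms by (simp add: joined_def crit_pos_def)
  show ?thesis unfolding arch_def set_eq_iff x e
    using orient_cases[of n] by (auto simp: semicircle_iff joined_psi[OF assms, unfolded minus_diff_eq])
qed

lemma semicircles_atD:
  assumes "J \<in> semicircles_at s L a"
  obtains n b x where "joined n a b x" "J = arch L n a (psi L a - ctr L n a)"
proof -
  obtain x \<sigma> \<tau> k where J: "J = semicircle (x 0) (psi L (left_part \<sigma>)) (psi L (left_part \<tau>))
        (even (ones (subword \<sigma> (k + 1) (nat (- k - 1)))))" "k < 0" "identified_at s k \<sigma> \<tau>"
    "represents s \<sigma> x" "represents s \<tau> x" "left_part \<sigma> = a"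
    using assms unfolding semicircles_at_def by blast
  note i = identified_joined[OF J(3,2,4,5)]
  show thesis
    by (rule that[OF i(2)[unfolded J(6)]])
      (use J(1,6) i(3) semicircle_arch[OF i(2)] in simp)
qed

lemma drawing_cases:
  assumes "q \<in> drawing s L"
  obtains (seg) e w where "w \<in> X" "lvalid e w" "q = (w 0, psi L e)"
  | (arch) n e f w where "joined n e f w" "q \<in> arch L n e (psi L e - ctr L n e)"
proof -
  consider a where "left_admissible s a" "q \<in> segment s L a" | J where "J \<in> semicircles s L" "q \<in> J"
    using assms unfolding drawing_def by blast
  then show thesis
  proof cases
    case (1 a)
    then obtain w where w: "w \<in> basic_arc s a" "q = (w 0, psi L a)" unfolding segment_def by auto
    then obtain \<sigma> where "represents s \<sigma> w" "left_part \<sigma> = a" unfolding basic_arc_def by auto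
    then show ?thesis using seg[of w a, OF _ _ w(2)] representsD(2) represents_lvalid by blast
  next
    case (2 J)
    then show ?thesis unfolding semicircles_def using arch by (metis UN_E semicircles_atD)
  qed
qed

lemma joined_props:
  assumes "joined n a b x"
  shows "x \<in> X" "lvalid a x" "lvalid b x" "kmatch n a" "kmatch n b" "x 0 = crit_pos n"
  using assms unfolding joined_def crit_pos_def by auto

lemma crit_side:
  assumes "x \<in> X" "lvalid a x" "kmatch n a" shows "orient n * (x 0 - crit_pos n) \<le> 0"
  using kmatch_side[OF assms] by (simp add: crit_pos_def)

lemma arch_height: "(u, v) \<in> arch L n a \<rho> \<Longrightarrow> \<bar>v - ctr L n a\<bar> \<le> \<bar>\<rho>\<bar>"
  unfolding arch_def by (simp add: abs_le_square_iff) (smt (verit) zero_le_power2)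

lemma arch_width: "(u, v) \<in> arch L n a \<rho> \<Longrightarrow> \<bar>u - crit_pos n\<bar> \<le> \<bar>\<rho>\<bar>"
  unfolding arch_def by (simp add: abs_le_square_iff) (smt (verit) zero_le_power2)

text \<open>No segment has this height by \<open>gap_psi\<close>. A semicircle of a level at which
  \<open>a\<close> matches opens away from the strip and could meet it only at an endpoint, again at
  the height of a segment. For the other levels the strip is more than a radius away from the
  centre.\<close>

lemma strip_off_drawing:
  assumes tail: "\<forall>i\<ge>N. a i = L i" and w: "w \<in> X" "lvalid a w" and d: "0 < d" "d \<le> gap N"
  shows "(w 0, psi L a + flip L a N * d) \<notin> drawing s L"
proof
  let ?y = "psi L a + flip L a N * d"
  have g1: "?y \<noteq> psi L b" for b using gap_psi[OF tail d] by blast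
  assume "(w 0, ?y) \<in> drawing s L"
  then show False
  proof (cases rule: drawing_cases)
    case (seg e w')
    then show ?thesis using g1 by simp
  next
    case (arch n e f x)
    note j = joined_props[OF arch(1)]
    show ?thesis
    proof (cases "kmatch n a")
      case True
      have "orient n * (w 0 - crit_pos n) \<le> 0" by (rule crit_side[OF w True])
      moreover have "0 \<le> orient n * (w 0 - crit_pos n)" using arch(2) by (simp add: arch_def)
      ultimately have "w 0 = crit_pos n" using orient_cases[of n] by auto
      then have "(?y - ctr L n e)\<^sup>2 = (psi L e - ctr L n e)\<^sup>2" using arch(2) by (simp add: arch_def)
      then have "?y - ctr L n e = psi L e - ctr L n e \<or> ?y - ctr L n e = psi L f - ctr L n e"
        unfolding joined_psi(1)[OF arch(1)] by (simp only: power2_eq_iff)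
      then show ?thesis using g1 by auto
    next
      case False
      then obtain i where i: "i < n" "a i \<noteq> e i" using kmatch_differ[OF j(4)] by blast
      have "2 * gap n \<le> \<bar>?y - ctr L n e\<bar>" by (rule gap_ctr[of N a L d i n e, OF tail]) (use d i in auto)
      then show ?thesis using arch_height[OF arch(2)] psi_ctr[of L e n] gap_pos[of n] by linarith
    qed
  qed
qed

text \<open>Two overlapping semicircles of different levels either open to different sides, or the radius
  of one of them avoids the heights of the other. This uses that a sequence joined at level \<open>n\<close>
  does not match the kneading sequence at a higher level of the same orientation.\<close>

lemma arch_off_drawing:
  assumes jn: "joined n a b x" and tail: "\<forall>i\<ge>N. a i = L i" and N: "Suc n \<le> N"
    and d: "0 < d" "d \<le> gap N"
    and q: "(u, v) \<in> arch L n a (psi L a + flip L a N * d - ctr L n a)"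
  shows "(u, v) \<notin> drawing s L"
proof
  \<comment> \<open>\<open>c\<close> is the side of the centre on which \<open>a\<close> lies. It
    makes the radius \<rho> nonnegative, and the arch then ends at the shifted heights of
    \<open>a\<close> and \<open>b\<close>, which are the centre plus and minus
    \<open>c * \<rho>\<close>.\<close>
  define c where "c = flip L a (Suc n)"
  define \<rho> where "\<rho> = c * (psi L a + flip L a N * d - ctr L n a)"
  note j = joined_props[OF jn]
  have c: "c * c = 1" "c = 1 \<or> c = - 1" unfolding c_def by (rule flip_sq flip_cases)+
  have tailb: "\<forall>i\<ge>N. b i = L i" using jn tail N unfolding joined_def by (metis Suc_n_not_le_n order_trans)
  have ya: "psi L a + flip L a N * d = ctr L n a + c * \<rho>"
    using c(1) by (simp add: \<rho>_def mult.assoc[symmetric])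
  have fb: "flip L b m = - flip L a m" if "n < m" for m using joined_flip[OF jn that] .
  have yb: "psi L b + flip L b N * d = ctr L n a - c * \<rho>"
    using ya fb[of N] N joined_psi(1)[OF jn, of L] by (simp add: algebra_simps)
  have fN: "\<bar>flip L a N * d\<bar> = d" using flip_cases[of L a N] d by auto
  have gN: "gap N \<le> gap (Suc n)" using N gap_mono by blast
  have "\<bar>c * (flip L a N * d)\<bar> = d" using fN c(2) by auto
  moreover have "gap (Suc n) \<le> c * (psi L a - ctr L n a)" unfolding c_def by (rule psi_upper)
  moreover have "\<rho> = c * (psi L a - ctr L n a) + c * (flip L a N * d)" by (simp add: \<rho>_def algebra_simps)
  ultimately have \<rho>0: "0 \<le> \<rho>" using d gN by linarith
  have "\<bar>c * (psi L a - ctr L n a)\<bar> \<le> gap n" using psi_ctr[of L a n] c(2) by auto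
  then have \<rho>2: "\<rho> \<le> 2 * gap n"
    using \<open>\<bar>c * (flip L a N * d)\<bar> = d\<close> \<open>\<rho> = c * _ + _\<close> d gN gap_Suc[of n] gap_pos[of "Suc n"] by linarith
  have q': "(u - crit_pos n)\<^sup>2 + (v - ctr L n a)\<^sup>2 = \<rho>\<^sup>2" "0 \<le> orient n * (u - crit_pos n)"
    using q c(1) unfolding arch_def \<rho>_def by (auto simp: power_mult_distrib power2_eq_square[of c])
  have qh: "\<bar>v - ctr L n a\<bar> \<le> \<rho>" "\<bar>u - crit_pos n\<bar> \<le> \<rho>"
    using q' \<rho>0 arch_height[of u v L n a \<rho>] arch_width[of u v L n a \<rho>] by (auto simp: arch_def)
  assume D: "(u, v) \<in> drawing s L"
  show False
  proof (cases "u = crit_pos n")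
    case True
    then have "v - ctr L n a = \<rho> \<or> v - ctr L n a = - \<rho>" using q'(1) by (simp add: power2_eq_iff)
    then have "v = ctr L n a + c * \<rho> \<or> v = ctr L n a - c * \<rho>" using c(2) by auto
    then have "(u, v) = (x 0, psi L a + flip L a N * d) \<or> (u, v) = (x 0, psi L b + flip L b N * d)"
      using True j(6) ya yb by auto
    then show False using D strip_off_drawing[OF tail j(1,2) d] strip_off_drawing[OF tailb j(1,3) d] by metis
  next
    case False
    then have up: "0 < orient n * (u - crit_pos n)" using q'(2) orient_cases[of n] by auto
    from D show False
    proof (cases rule: drawing_cases)
      case (seg e w)
      show False
      proof (cases "kmatch n e")
        case True
        then show False using crit_side[OF seg(1,2) True] up seg(3) by simp
      next
        case False
        then obtain i where i: "i < n" "e i \<noteq> a i" using kmatch_differ[OF j(4)] by blast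
        have "\<bar>v - ctr L n a\<bar> \<ge> 3 * gap n"
          using ctr_separated[of i n e a L, OF i] psi_ctr[of L e n] seg(3) by auto
        then show False using qh \<rho>2 gap_pos[of n] by linarith
      qed
    next
      case (arch m e f w)
      note j' = joined_props[OF arch(1)]
      have a2: "0 \<le> orient m * (u - crit_pos m)"
        "(u - crit_pos m)\<^sup>2 + (v - ctr L m e)\<^sup>2 = (psi L e - ctr L m e)\<^sup>2"
        using arch(2) by (auto simp: arch_def)
      have ah: "\<bar>v - ctr L m e\<bar> \<le> gap m" "\<bar>u - crit_pos m\<bar> \<le> gap m"
        using arch_height[OF arch(2)] arch_width[OF arch(2)] psi_ctr[of L e m] by auto
      consider "m = n" | "n < m" | "m < n" by linarith
      then show False
      proof cases
        case 1
        have ce: "ctr L m e = ctr L n a" using j'(4) j(4) kmatch_ctr 1 by blast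
        then have "(psi L e - ctr L n a)\<^sup>2 = \<rho>\<^sup>2" using a2(2) q'(1) 1 by simp
        then have "psi L e = ctr L n a + c * \<rho> \<or> psi L e = ctr L n a - c * \<rho>"
          using c(2) by (auto simp: power2_eq_iff)
        then show False using ya yb gap_psi[of N a L d e, OF tail d] gap_psi[of N b L d e, OF tailb d] by auto
      next
        case 2
        have me: "kmatch n e"
        proof (rule ccontr)
          assume "\<not> kmatch n e"
          then obtain i where i: "i < n" "e i \<noteq> a i" using kmatch_differ[OF j(4)] by blast
          show False
            using ctr_separated[of i n e a L, OF i] ctr_ctr[of n m L e] 2 ah(1) qh(1) \<rho>2 gap_pos[of n] by linarith
        qed
        have cm: "orient n * (crit_pos m - crit_pos n) \<le> 0"
        proof -
          have "orient n * (w 0 - crit_pos n) \<le> 0" by (rule crit_side[OF j'(1,2) me])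
          then show ?thesis using j'(6) by simp
        qed
        \<comment> \<open>The point is strictly on the open side of \<open>crit_pos n\<close>, and
          \<open>crit_pos m\<close> is not. So an arch of level \<open>m\<close> through the point
          opens the same way, and by \<open>joined\<close> neither \<open>a\<close> nor
          \<open>b\<close> matches at level \<open>m\<close>.\<close>
        have om: "orient m = orient n" using cm up a2(1) orient_cases[of m] orient_cases[of n] by auto
        then have nm: "\<not> kmatch m a" "\<not> kmatch m b" using jn 2 unfolding joined_def by blast+
        define \<sigma> where "\<sigma> = flip L e (Suc n)"
        have fl: "flip L e n = flip L a n" "flip L e n = flip L b n"
          by (intro flip_agree kmatch_agree[OF me] j; simp)+
        \<comment> \<open>The distance of the two centres in height. A common point of both arches
          has a height within \<open>gap m\<close> of the level-\<open>m\<close> centre and is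
          within \<open>gap m\<close> of \<open>crit_pos n\<close> horizontally. This forces \<rho>
          near \<open>H\<close>, which \<open>far\<close> excludes.\<close>
        define H where "H = \<sigma> * (ctr L m e - ctr L n e)"
        have H: "gap (Suc n) + gap m \<le> H" unfolding H_def \<sigma>_def by (rule ctr_upper[OF 2])
        have s1: "\<sigma> = 1 \<or> \<sigma> = - 1" unfolding \<sigma>_def by (rule flip_cases)
        have ce: "ctr L n e = ctr L n a" using kmatch_ctr[OF me j(4)] .
        have far: "2 * gap m \<le> \<bar>ctr L n a + \<sigma> * \<rho> - ctr L m e\<bar>"
        proof (cases "e n = a n")
          case True
          then have "\<sigma> = c" unfolding \<sigma>_def c_def flip_Suc fl(1) by simp
          moreover obtain i where "i < m" "a i \<noteq> e i" using kmatch_differ[OF j'(4) nm(1)] by blast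
          ultimately show ?thesis using gap_ctr[of N a L d i m e, OF tail] d unfolding ya by auto
        next
          case False
          then have "e n = b n" using jn unfolding joined_def by auto
          then have "\<sigma> = flip L b (Suc n)" unfolding \<sigma>_def flip_Suc fl(2) by simp
          then have "\<sigma> = - c" using fb[of "Suc n"] by (simp add: c_def)
          moreover obtain i where "i < m" "b i \<noteq> e i" using kmatch_differ[OF j'(4) nm(2)] by blast
          ultimately show ?thesis using gap_ctr[of N b L d i m e, OF tailb] d unfolding yb by auto
        qed
        have "\<bar>\<rho> - H\<bar> < 3 / 2 * gap m"
        proof (rule pythagoras_bound)
          show "(u - crit_pos n)\<^sup>2 + (\<sigma> * (v - ctr L n a))\<^sup>2 = \<rho>\<^sup>2" using q'(1) s1
            by (auto simp: power_mult_distrib power2_commute[of "ctr L n a"])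
          have "\<bar>u - crit_pos n\<bar> \<le> \<bar>u - crit_pos m\<bar>" using om cm up a2(1) orient_cases[of n] by auto
          then show "\<bar>u - crit_pos n\<bar> \<le> gap m" using ah(2) by simp
          have "\<sigma> * (v - ctr L n a) - H = \<sigma> * (v - ctr L m e)" unfolding H_def ce by (simp add: algebra_simps)
          then show "\<bar>\<sigma> * (v - ctr L n a) - H\<bar> \<le> gap m" using ah(1) s1 by auto
          show "0 < gap m" by (rule gap_pos)
          show "gap m \<le> H" using H gap_pos[of "Suc n"] by linarith
        qed (rule \<rho>0)
        moreover have "\<bar>ctr L n a + \<sigma> * \<rho> - ctr L m e\<bar> = \<bar>\<rho> - H\<bar>" using s1 unfolding H_def ce by auto
        ultimately show False using far gap_pos[of m] by linarith
      next
        case 3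
        have me: "kmatch m a"
        proof (rule ccontr)
          assume "\<not> kmatch m a"
          then obtain i where i: "i < m" "a i \<noteq> e i" using kmatch_differ[OF j'(4)] by blast
          have "3 * gap n \<le> gap m"
          proof -
            have "gap n \<le> gap (Suc m)" using gap_mono[of "Suc m" n] 3 by simp
            then show ?thesis using gap_Suc[of m] by simp
          qed
          then show False
            using ctr_separated[of i m a e L, OF i] ctr_ctr[of m n L a] 3 ah(1) qh(1) \<rho>2 gap_pos[of n] by linarith
        qed
        have cm: "orient m * (crit_pos n - crit_pos m) \<le> 0"
        proof -
          have "orient m * (x 0 - crit_pos m) \<le> 0" by (rule crit_side[OF j(1,2) me])
          then show ?thesis using j(6) by simp
        qed
        have om: "orient n = orient m" using cm up a2(1) orient_cases[of m] orient_cases[of n] by auto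
        then have nm: "\<not> kmatch n e" "\<not> kmatch n f" using arch(1) 3 unfolding joined_def by blast+
        define \<sigma> where "\<sigma> = flip L a (Suc m)"
        have fl: "flip L a m = flip L e m" "flip L a m = flip L f m"
          by (intro flip_agree kmatch_agree[OF me] j'; simp)+
        \<comment> \<open>Now the roles are exchanged: the common point is within
          \<open>2 * gap n\<close> of the level-\<open>n\<close> centre, which forces the radius
          \<open>r\<close> of the drawn semicircle near \<open>H\<close>. But \<open>e\<close> and
          \<open>f\<close> do not match at level \<open>n\<close>, so their heights are at least
          \<open>3 * gap n\<close> from that centre.\<close>
        define H where "H = \<sigma> * (ctr L n a - ctr L m a)"
        have H: "gap (Suc m) + gap n \<le> H" unfolding H_def \<sigma>_def by (rule ctr_upper[OF 3])
        have s1: "\<sigma> = 1 \<or> \<sigma> = - 1" unfolding \<sigma>_def by (rule flip_cases)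
        have ce: "ctr L m e = ctr L m a" using kmatch_ctr[OF j'(4) me] .
        define r where "r = flip L e (Suc m) * (psi L e - ctr L m e)"
        have r0: "0 \<le> r" using psi_upper[of m L e] gap_pos[of "Suc m"] unfolding r_def by linarith
        have "psi L e - ctr L m e = flip L e (Suc m) * r"
          using flip_sq[of L e "Suc m"] by (simp add: r_def mult.assoc[symmetric])
        then have pe: "psi L e = ctr L m a + flip L e (Suc m) * r" using ce by simp
        have pf: "psi L f = ctr L m a - flip L e (Suc m) * r"
          using pe joined_psi(1)[OF arch(1), of L] ce by simp
        have rr: "r\<^sup>2 = (psi L e - ctr L m e)\<^sup>2" using flip_cases[of L e "Suc m"] by (auto simp: r_def power2_commute)
        have sep: "3 * gap n \<le> \<bar>psi L g - ctr L n a\<bar>" if ng: "\<not> kmatch n g" for g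
        proof -
          obtain i where "i < n" "g i \<noteq> a i" using kmatch_differ[OF j(4) ng] by blast
          then have "4 * gap n \<le> \<bar>ctr L n g - ctr L n a\<bar>" by (rule ctr_separated)
          then show ?thesis using psi_ctr[of L g n] by linarith
        qed
        have far: "3 * gap n \<le> \<bar>ctr L m a + \<sigma> * r - ctr L n a\<bar>"
        proof (cases "e m = a m")
          case True
          then have "\<sigma> = flip L e (Suc m)" unfolding \<sigma>_def flip_Suc fl(1) by simp
          then show ?thesis using sep[OF nm(1)] pe by simp
        next
          case False
          then have "f m = a m" using arch(1) unfolding joined_def by auto
          then have "\<sigma> = flip L f (Suc m)" unfolding \<sigma>_def flip_Suc fl(2) by simp
          then have "\<sigma> = - flip L e (Suc m)" using joined_flip[OF arch(1), of "Suc m" L] by simp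
          then show ?thesis using sep[OF nm(2)] pf by simp
        qed
        have "\<bar>r - H\<bar> < 3 / 2 * (2 * gap n)"
        proof (rule pythagoras_bound)
          show "(u - crit_pos m)\<^sup>2 + (\<sigma> * (v - ctr L m a))\<^sup>2 = r\<^sup>2" using a2(2) rr ce s1
            by (auto simp: power_mult_distrib power2_commute[of "ctr L m a"])
          have "\<bar>u - crit_pos m\<bar> \<le> \<bar>u - crit_pos n\<bar>" using om cm up a2(1) orient_cases[of m] by auto
          then show "\<bar>u - crit_pos m\<bar> \<le> 2 * gap n" using qh(2) \<rho>2 by simp
          have "\<sigma> * (v - ctr L m a) - H = \<sigma> * (v - ctr L n a)" unfolding H_def by (simp add: algebra_simps)
          then show "\<bar>\<sigma> * (v - ctr L m a) - H\<bar> \<le> 2 * gap n" using qh(1) \<rho>2 s1 by auto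
          show "0 < 2 * gap n" using gap_pos by simp
          have "gap n \<le> gap (Suc m)" using 3 gap_mono[of "Suc m" n] by simp
          then show "2 * gap n \<le> H" using H by linarith
        qed (rule r0)
        moreover have "\<bar>ctr L m a + \<sigma> * r - ctr L n a\<bar> = \<bar>r - H\<bar>" using s1 unfolding H_def by auto
        ultimately show False using far by simp
      qed
    qed
  qed
qed

end

section \<open>Accessibility\<close>

lemma accessible_path:
  assumes "path h" "pathfinish h \<in> K" "\<And>t. 0 \<le> t \<Longrightarrow> t < 1 \<Longrightarrow> h t \<notin> K"
  shows "accessible K (pathfinish h)"
proof -
  have "pathstart h \<noteq> pathfinish h" using assms(2) assms(3)[of 0] by (auto simp: pathstart_def)
  then obtain g where g: "arc g" "path_image g \<subseteq> path_image h" "pathfinish g = pathfinish h"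
    using path_contains_arc[OF assms(1) refl refl] by blast
  have "path_image h \<inter> K \<subseteq> {pathfinish h}"
  proof
    fix z assume z: "z \<in> path_image h \<inter> K"
    then obtain t where "t \<in> {0..1}" "z = h t" by (auto simp: path_image_def)
    then have "t = 1" using z assms(3)[of t] by force
    then show "z \<in> {pathfinish h}" using \<open>z = h t\<close> by (simp add: pathfinish_def)
  qed
  moreover have "pathfinish h \<in> path_image g" using g(3) by (metis pathfinish_in_path_image)
  ultimately show ?thesis unfolding accessible_def using g assms(2) by blast
qed

locale tent_embedding = tent_map +
  fixes L :: "nat \<Rightarrow> bool" and \<phi> :: "(nat \<Rightarrow> real) \<Rightarrow> real \<times> real"
    and F :: "real \<times> real \<Rightarrow> real \<times> real" and \<phi>' :: "real \<times> real \<Rightarrow> nat \<Rightarrow> real"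
  assumes shrinks: "shrinks_semicircles s L F"
    and homeo: "homeomorphism (inv_limit s) (F ` drawing s L) \<phi> \<phi>'"
    and placement: "\<And>a. left_admissible s a \<Longrightarrow> F ` segment s L a \<subseteq> \<phi> ` basic_arc s a"
      "\<And>a. left_admissible s a \<Longrightarrow> \<phi> ` basic_arc s a \<subseteq> F ` (segment s L a \<union> \<Union> (semicircles_at s L a))"
begin

abbreviation D where "D \<equiv> drawing s L"

abbreviation K where "K \<equiv> \<phi> ` inv_limit s"

lemma K_eq: "K = F ` D" using homeo by (simp add: homeomorphism_def)

lemma F_cont: "continuous_on S F"
  using shrinks continuous_on_subset unfolding shrinks_semicircles_def by blast

lemma F_fibre: "(\<exists>p. F -` {q} = {p}) \<or> connected (F -` {q}) \<and> (\<exists>J \<in> semicircles s L. F -` {q} \<subseteq> J)"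
  using shrinks unfolding shrinks_semicircles_def by blast

text \<open>A fibre with more than one point lies in a semicircle, so a fibre through a point off
  the drawing is a singleton.\<close>

lemma F_off: assumes "q \<notin> D" shows "F q \<notin> K"
proof
  assume "F q \<in> K"
  then obtain p where p: "p \<in> D" "F p = F q" unfolding K_eq by auto
  from F_fibre[of "F q"] show False
  proof
    assume "\<exists>p. F -` {F q} = {p}"
    then have "p = q" using p(2) by (metis singletonD vimage_singleton_eq)
    then show False using p assms by simp
  next
    assume "connected (F -` {F q}) \<and> (\<exists>J \<in> semicircles s L. F -` {F q} \<subseteq> J)"
    then have "q \<in> D" unfolding drawing_def by auto
    then show False using assms by simp
  qed
qed

lemma accessible_off:
  assumes "path h" "F (pathfinish h) \<in> K" "\<And>t. 0 \<le> t \<Longrightarrow> t < 1 \<Longrightarrow> h t \<notin> D"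
  shows "accessible K (F (pathfinish h))"
proof -
  have "path (F \<circ> h)" using assms(1) F_cont by (rule path_continuous_image)
  then show ?thesis using accessible_path[of "F \<circ> h" K] assms F_off by (simp add: pathfinish_compose)
qed

text \<open>Vertical segments reach the points of a segment, radial ones those of a semicircle.\<close>

lemma accessible_tail:
  assumes tail: "\<forall>i\<ge>N. a i = L i" and a: "left_admissible s a"
    and z: "z \<in> segment s L a \<union> \<Union> (semicircles_at s L a)"
  shows "accessible K (F z)"
proof -
  have zD: "z \<in> D" using z a unfolding drawing_def semicircles_def by auto
  then have zK: "F z \<in> K" unfolding K_eq by auto
  from z show ?thesis
  proof
    assume "z \<in> segment s L a"
    then obtain w where w: "w \<in> basic_arc s a" "z = (w 0, psi L a)" unfolding segment_def by auto
    then have wX: "w \<in> X" "lvalid a w"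
      using representsD(2) represents_lvalid unfolding basic_arc_def by blast+
    define h where "h t = (w 0, psi L a + flip L a N * ((1 - t) * gap N))" for t
    have "path h" unfolding path_def h_def by (intro continuous_intros)
    moreover have "pathfinish h = z" by (simp add: pathfinish_def h_def w)
    moreover have "h t \<notin> D" if "0 \<le> t" "t < 1" for t
      unfolding h_def using that gap_pos[of N]
      by (intro strip_off_drawing[OF tail wX]) (auto simp: mult_le_cancel_right1)
    ultimately show ?thesis using accessible_off zK by metis
  next
    assume "z \<in> \<Union> (semicircles_at s L a)"
    then obtain n b x where j: "joined n a b x" and zJ: "z \<in> arch L n a (psi L a - ctr L n a)"
      using semicircles_atD by (metis UnionE)
    obtain u v where uv: "z = (u, v)" by fastforce
    define M where "M = max N (Suc n)"
    have tailM: "\<forall>i\<ge>M. a i = L i" using tail by (simp add: M_def)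
    define r where "r = psi L a - ctr L n a"
    have rg: "gap M \<le> \<bar>r\<bar>"
      using psi_upper[of n L a] flip_cases[of L a "Suc n"] gap_mono[of "Suc n" M] unfolding r_def M_def by auto
    then have r0: "r \<noteq> 0" using gap_pos[of M] by auto
    \<comment> \<open>Scaling about the centre changes the signed radius from \<open>r\<close> to
      \<open>r\<close> plus the offset, which vanishes at \<open>t = 1\<close>. The bound
      \<open>rg\<close> keeps the factor nonnegative, so the path stays on the open side.\<close>
    define k where "k t = (r + flip L a M * ((1 - t) * gap M)) / r" for t
    define h where "h t = (crit_pos n + k t * (u - crit_pos n), ctr L n a + k t * (v - ctr L n a))" for t
    have "path h" unfolding path_def h_def k_def by (intro continuous_intros) (use r0 in auto)
    moreover have "pathfinish h = z" using r0 by (simp add: pathfinish_def h_def uv k_def)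
    moreover have "h t \<notin> D" if t: "0 \<le> t" "t < 1" for t
    proof -
      have d: "0 < (1 - t) * gap M" "(1 - t) * gap M \<le> gap M"
        using t gap_pos[of M] by (auto simp: mult_le_cancel_right1)
      have "k t = 1 + flip L a M * ((1 - t) * gap M) / r" using r0 by (simp add: k_def field_simps)
      moreover have "\<bar>flip L a M * ((1 - t) * gap M) / r\<bar> \<le> 1"
        using d rg r0 flip_cases[of L a M] by (auto simp: abs_divide divide_le_eq)
      ultimately have k0: "0 \<le> k t" by linarith
      have "0 \<le> orient n * (u - crit_pos n)" "(u - crit_pos n)\<^sup>2 + (v - ctr L n a)\<^sup>2 = r\<^sup>2"
        using zJ uv by (auto simp: arch_def r_def)
      then have "0 \<le> k t * (orient n * (u - crit_pos n))"
        "(k t)\<^sup>2 * ((u - crit_pos n)\<^sup>2 + (v - ctr L n a)\<^sup>2) = (k t * r)\<^sup>2"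
        using k0 by (simp_all add: power_mult_distrib)
      moreover have "k t * r = psi L a + flip L a M * ((1 - t) * gap M) - ctr L n a"
        using r0 by (simp add: k_def r_def)
      ultimately have "h t \<in> arch L n a (psi L a + flip L a M * ((1 - t) * gap M) - ctr L n a)"
        unfolding h_def arch_def by (simp add: power_mult_distrib distrib_left mult.left_commute)
      moreover have "Suc n \<le> M" by (simp add: M_def)
      ultimately show ?thesis unfolding h_def using arch_off_drawing[OF j tailM _ d] by blast
    qed
    ultimately show ?thesis using accessible_off zK by metis
  qed
qed

lemma accessible_same_tail:
  assumes "x \<in> X" "same_tail s L x" shows "accessible K (\<phi> x)"
proof -
  obtain \<sigma> N where r: "represents s \<sigma> x" and N: "\<forall>i\<ge>N. left_part \<sigma> i = L i"
    using assms(2) unfolding same_tail_def by blast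
  note a = represents_left_admissible[OF r]
  have "x \<in> basic_arc s (left_part \<sigma>)" using r unfolding basic_arc_def by auto
  then obtain z where "z \<in> segment s L (left_part \<sigma>) \<union> \<Union> (semicircles_at s L (left_part \<sigma>))" "\<phi> x = F z"
    using placement(2)[OF a] by blast
  then show ?thesis using accessible_tail[OF N a] by simp
qed

end

section \<open>Arcs in the inverse limit\<close>

lemma arc_coord_cont:
  fixes g :: "real \<Rightarrow> nat \<Rightarrow> real"
  assumes "arc g" "S \<subseteq> {0..1}" shows "continuous_on S (\<lambda>t. g t n)"
proof -
  have "continuous_on S g" using assms unfolding arc_def path_def by (meson continuous_on_subset)
  then show ?thesis by (rule continuous_on_product_then_coordinatewise)
qed

text \<open>The library's \<open>subpath\<close> is confined to normed spaces.\<close>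

definition sub_arc :: "real \<Rightarrow> real \<Rightarrow> (real \<Rightarrow> 'a) \<Rightarrow> real \<Rightarrow> 'a" where
  "sub_arc u v g t = g ((1 - t) * u + t * v)"

lemma sub_arc:
  fixes g :: "real \<Rightarrow> 'a::topological_space"
  assumes "arc g" "u \<in> {0..1}" "v \<in> {0..1}" "u \<noteq> v"
  shows "arc (sub_arc u v g)" "path_image (sub_arc u v g) \<subseteq> path_image g"
    "sub_arc u v g 0 = g u" "sub_arc u v g 1 = g v"
proof -
  have r: "(1 - t) * u + t * v \<in> {0..1}" if "t \<in> {0..1}" for t
  proof -
    have "(1 - t) * u \<le> (1 - t) * 1" "t * v \<le> t * 1"
      using that assms(2,3) by (intro mult_left_mono; simp)+
    moreover have "0 \<le> (1 - t) * u" "0 \<le> t * v" using that assms(2,3) by simp_all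
    ultimately show ?thesis by simp
  qed
  have c: "continuous_on {0..1} g" "inj_on g {0..1}" using assms(1) by (auto simp: arc_def path_def)
  have "path (sub_arc u v g)" unfolding path_def sub_arc_def
    by (rule continuous_on_compose2[OF c(1)]) (intro continuous_intros, use r in \<open>simp add: image_subset_iff\<close>)
  moreover have "inj_on (sub_arc u v g) {0..1}"
  proof
    fix t t' assume t: "t \<in> {0..1}" "t' \<in> {0..1}" "sub_arc u v g t = sub_arc u v g t'"
    then have "(1 - t) * u + t * v = (1 - t') * u + t' * v"
      using t(3) inj_on_eq_iff[OF c(2) r[OF t(1)] r[OF t(2)]] by (simp add: sub_arc_def)
    then have "(t - t') * (v - u) = 0" by (simp add: algebra_simps)
    then show "t = t'" using assms(4) by simp
  qed
  ultimately show "arc (sub_arc u v g)" by (simp add: arc_def)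
  show "path_image (sub_arc u v g) \<subseteq> path_image g" 
    unfolding path_image_def sub_arc_def using r by (simp add: image_subset_iff)
qed (auto simp: sub_arc_def)

lemma avoid_same_side:
  fixes f :: "real \<Rightarrow> real"
  assumes "continuous_on {a..b} f" "\<And>t. t \<in> {a..b} \<Longrightarrow> f t \<noteq> c" "t \<in> {a..b}" "u \<in> {a..b}"
  shows "c < f t \<longleftrightarrow> c < f u"
proof -
  have *: "c < f u" if "c < f t" "t \<in> {a..b}" "u \<in> {a..b}" for t u
  proof (rule ccontr)
    assume "\<not> c < f u"
    then have "f u \<le> c" by simp
    have "connected (f ` {a..b})" by (rule connected_continuous_image[OF assms(1)]) simp
    then have sub: "{f u..f t} \<subseteq> f ` {a..b}"
      by (rule connected_contains_Icc) (rule imageI, rule that)+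
    have "c \<in> {f u..f t}" using \<open>f u \<le> c\<close> that(1) by simp
    then have "c \<in> f ` {a..b}" using sub by (rule rev_subsetD)
    then show False using assms(2) by (metis imageE)
  qed
  show ?thesis using *[OF _ assms(3,4)] *[OF _ assms(4,3)] by blast
qed

context tent_map begin

lemma path_image_X: "path_image g \<subseteq> X \<Longrightarrow> t \<in> {0..1} \<Longrightarrow> g t \<in> X"
  unfolding path_image_def by auto

text \<open>Coordinate \<open>n\<close> determines all coordinates of smaller index. Parameters away
  from \<open>e\<close> that agree with it in ever deeper coordinates would accumulate at a
  parameter with the same image, against injectivity.\<close>

lemma arc_coord_separates:
  assumes "arc g" "path_image g \<subseteq> X" "e \<in> {0..1}" "0 < \<epsilon>"
  shows "\<exists>N. \<forall>n\<ge>N. \<forall>r\<in>{0..1}. g r n = g e n \<longrightarrow> \<bar>r - e\<bar> < \<epsilon>"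
proof (rule ccontr)
  assume "\<not> ?thesis"
  then have "\<forall>N. \<exists>r. \<exists>n\<ge>N. r \<in> {0..1} \<and> g r n = g e n \<and> \<not> \<bar>r - e\<bar> < \<epsilon>" by blast
  from choice[OF this] obtain r where "\<forall>N. \<exists>n\<ge>N. r N \<in> {0..1} \<and> g (r N) n = g e n \<and> \<not> \<bar>r N - e\<bar> < \<epsilon>" ..
  then have r: "\<exists>n\<ge>N. r N \<in> {0..1} \<and> g (r N) n = g e n \<and> \<epsilon> \<le> \<bar>r N - e\<bar>" for N
    by (simp only: not_less)
  have r01: "r N \<in> {0..1}" "\<epsilon> \<le> \<bar>r N - e\<bar>" for N using r[of N] by auto
  have eq: "g (r N) i = g e i" if "i \<le> N" for i N
  proof -
    obtain n where n: "n \<ge> N" "g (r N) n = g e n" using r[of N] by auto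
    have X: "g (r N) \<in> X" "g e \<in> X" using path_image_X[OF assms(2)] r01 assms(3) by auto
    show ?thesis using X_pow[OF X(1), of "n - i" i] X_pow[OF X(2), of "n - i" i] n that by simp
  qed
  obtain l \<rho> where l: "l \<in> {0..1}" "strict_mono \<rho>" "(r \<circ> \<rho>) \<longlonglongrightarrow> l"
    using compact_imp_seq_compact[OF compact_Icc[of "0::real" 1]] r01(1) unfolding seq_compact_def by blast
  have "g l = g e"
  proof
    fix i
    have "(\<lambda>k. g ((r \<circ> \<rho>) k) i) \<longlonglongrightarrow> g l i"
      using continuous_on_tendsto_compose[OF arc_coord_cont[OF assms(1) order_refl] l(3) l(1)] r01(1) by simp
    moreover have "(\<lambda>k. g ((r \<circ> \<rho>) k) i) \<longlonglongrightarrow> g e i"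
    proof (rule Lim_transform_eventually[OF tendsto_const])
      show "\<forall>\<^sub>F k in sequentially. g e i = g ((r \<circ> \<rho>) k) i"
      proof (rule eventually_sequentiallyI[of i])
        fix k assume "i \<le> k"
        then have "i \<le> \<rho> k" using seq_suble[OF l(2), of k] by simp
        then show "g e i = g ((r \<circ> \<rho>) k) i" using eq by simp
      qed
    qed
    ultimately show "g l i = g e i" by (rule LIMSEQ_unique)
  qed
  then have "l = e" using assms(1,3) l(1) inj_onD unfolding arc_def by metis
  moreover have "(\<lambda>k. \<bar>(r \<circ> \<rho>) k - e\<bar>) \<longlonglongrightarrow> \<bar>l - e\<bar>" by (intro tendsto_intros l(3))
  then have "\<epsilon> \<le> \<bar>l - e\<bar>" by (rule LIMSEQ_le_const) (use r01(2) in auto)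
  ultimately show False using assms(4) by simp
qed

text \<open>Where the coordinate \<open>Suc n\<close> is critical, the coordinate \<open>n\<close> attains its maximum along the
  arc. Between this place and a minimum of that coordinate, all its values along the arc occur; for
  large \<open>n\<close> this range must therefore come close to both ends of the arc.\<close>

lemma arc_critical_near_ends:
  assumes g: "arc g" "path_image g \<subseteq> X" and "0 < \<epsilon>"
  shows "\<exists>N. \<forall>n\<ge>N. \<forall>t\<in>{\<epsilon>..1 - \<epsilon>}. g t n \<noteq> 1/2"
proof -
  obtain N0 where N0: "\<And>n r. n \<ge> N0 \<Longrightarrow> r \<in> {0..1} \<Longrightarrow> g r n = g 0 n \<Longrightarrow> \<bar>r - 0\<bar> < \<epsilon>"
    using arc_coord_separates[OF g _ assms(3), of 0] that by force
  obtain N1 where N1: "\<And>n r. n \<ge> N1 \<Longrightarrow> r \<in> {0..1} \<Longrightarrow> g r n = g 1 n \<Longrightarrow> \<bar>r - 1\<bar> < \<epsilon>"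
    using arc_coord_separates[OF g _ assms(3), of 1] that by force
  have "g t n \<noteq> 1/2" if n: "n \<ge> Suc (max N0 N1)" and t: "t \<in> {\<epsilon>..1 - \<epsilon>}" for n t
  proof
    assume c: "g t n = 1/2"
    obtain m where m: "n = Suc m" "m \<ge> N0" "m \<ge> N1" using n by (cases n) auto
    have t01: "t \<in> {0..1}" using t assms(3) by auto
    have gX: "g r \<in> X" if "r \<in> {0..1}" for r using path_image_X[OF g(2) that] .
    have "g t m = tc" using X_step[OF gX[OF t01], of m, symmetric] c m(1) tent_c by (simp only:)
    then have mx: "g r m \<le> g t m" if "r \<in> {0..1}" for r using X_le_tc[OF gX[OF that], of m] by simp
    have ct: "continuous_on S (\<lambda>t. g t m)" if "S \<subseteq> {0..1}" for S using arc_coord_cont[OF g(1) that] .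
    obtain v where v: "v \<in> {0..1}" "\<And>r. r \<in> {0..1} \<Longrightarrow> g v m \<le> g r m"
      using continuous_attains_inf[OF compact_Icc _ ct[OF order_refl]] by auto
    show False
    proof (cases "t \<le> v")
      case True
      obtain r where r: "t \<le> r" "r \<le> v" "g r m = g 0 m"
        using IVT2'[of "\<lambda>t. g t m" v "g 0 m" t] v mx[of 0] True ct[of "{t..v}"] t01 by fastforce
      then have "r \<in> {0..1}" using v t01 by auto
      from N0[OF m(2) this r(3)] show False using r t by auto
    next
      case False
      obtain r where r: "v \<le> r" "r \<le> t" "g r m = g 1 m"
        using IVT'[of "\<lambda>t. g t m" v "g 1 m" t] v mx[of 1] False ct[of "{v..t}"] t01 by fastforce
      then have "r \<in> {0..1}" using v t01 by auto
      from N1[OF m(3) this r(3)] show False using r t by auto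
    qed
  qed
  then show ?thesis by blast
qed

text \<open>The midpoint stands for any interior point: by \<open>arc_tail_interior\<close> all of
  them give the same symbols from some index on, and the ambiguous value \<open>1/2\<close> no
  longer occurs there.\<close>

definition arc_tail :: "(real \<Rightarrow> nat \<Rightarrow> real) \<Rightarrow> nat \<Rightarrow> bool" where
  "arc_tail g n \<longleftrightarrow> 1/2 < g (1/2) (Suc n)"

lemma arc_tail_interior:
  assumes g: "arc g" "path_image g \<subseteq> X" and "0 < \<epsilon>"
  shows "\<exists>N. \<forall>n\<ge>N. \<forall>t\<in>{\<epsilon>..1 - \<epsilon>}. g t (Suc n) \<noteq> 1/2 \<and> arc_tail g n = (1/2 < g t (Suc n))"
proof -
  define \<delta> where "\<delta> = min \<epsilon> (1/2)"
  have d: "0 < \<delta>" "\<delta> \<le> 1/2" "\<delta> \<le> \<epsilon>" using assms(3) by (auto simp: \<delta>_def)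
  obtain N where N: "\<And>n t. n \<ge> N \<Longrightarrow> t \<in> {\<delta>..1 - \<delta>} \<Longrightarrow> g t n \<noteq> 1/2"
    using arc_critical_near_ends[OF g d(1)] by blast
  have "g t (Suc n) \<noteq> 1/2 \<and> arc_tail g n = (1/2 < g t (Suc n))" if "n \<ge> N" "t \<in> {\<epsilon>..1 - \<epsilon>}" for n t
  proof -
    have "continuous_on {\<delta>..1 - \<delta>} (\<lambda>t. g t (Suc n))" using d by (intro arc_coord_cont g) auto
    moreover have "t \<in> {\<delta>..1 - \<delta>}" "1/2 \<in> {\<delta>..1 - \<delta>}" using d that by auto
    ultimately show ?thesis
      using avoid_same_side[of \<delta> "1 - \<delta>" "\<lambda>t. g t (Suc n)" "1/2" "1/2" t] N[of "Suc n"] that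
      unfolding arc_tail_def by auto
  qed
  then show ?thesis by blast
qed

lemma arc_tail_at:
  assumes g: "arc g" "path_image g \<subseteq> X" and t: "0 < t" "t < 1"
  shows "\<exists>N. \<forall>n\<ge>N. g t (Suc n) \<noteq> 1/2 \<and> arc_tail g n = (1/2 < g t (Suc n))"
proof -
  have "0 < min t (1 - t)" "t \<in> {min t (1 - t)..1 - min t (1 - t)}" using t by auto
  then show ?thesis using arc_tail_interior[OF g, of "min t (1 - t)"] by blast
qed

lemma half_strict: "r \<in> half b \<Longrightarrow> r \<noteq> 1/2 \<Longrightarrow> b = (1/2 < r)"
  by (auto simp: half_iff split: if_splits)

lemma lvalid_arc_tail:
  assumes g: "arc g" "path_image g \<subseteq> X" and t: "0 < t" "t < 1" and a: "lvalid a (g t)"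
  shows "\<exists>N. \<forall>n\<ge>N. a n = arc_tail g n"
  using arc_tail_at[OF g t] half_strict a by metis

definition seg_between :: "(nat \<Rightarrow> real) \<Rightarrow> (nat \<Rightarrow> real) \<Rightarrow> real \<Rightarrow> nat \<Rightarrow> real" where
  "seg_between x w \<theta> n = (1 - \<theta>) * x n + \<theta> * w n"

lemma half_convex: "t \<in> half b \<Longrightarrow> u \<in> half b \<Longrightarrow> 0 \<le> \<theta> \<Longrightarrow> \<theta> \<le> 1 \<Longrightarrow> (1 - \<theta>) * t + \<theta> * u \<in> half b"
proof -
  assume "t \<in> half b" "u \<in> half b" "0 \<le> \<theta>" "\<theta> \<le> 1"
  moreover have "convex (half b)" by (simp add: half_def)
  ultimately show ?thesis unfolding convex_alt by simp
qed

text \<open>\<open>T\<close> is affine on each half, so the points with given symbols form a convex set.\<close>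

lemma seg_between:
  assumes x: "x \<in> X" "lvalid a x" and w: "w \<in> X" "lvalid a w"
  shows "0 \<le> \<theta> \<Longrightarrow> \<theta> \<le> 1 \<Longrightarrow> seg_between x w \<theta> \<in> X"
    "0 \<le> \<theta> \<Longrightarrow> \<theta> \<le> 1 \<Longrightarrow> lvalid a (seg_between x w \<theta>)"
    "x \<noteq> w \<Longrightarrow> arc (seg_between x w)"
    "seg_between x w 0 = x" "seg_between x w 1 = w"
proof -
  show lv: "lvalid a (seg_between x w \<theta>)" if "0 \<le> \<theta>" "\<theta> \<le> 1" for \<theta>
    unfolding seg_between_def using half_convex x(2) w(2) that by blast
  show "seg_between x w \<theta> \<in> X" if \<theta>: "0 \<le> \<theta>" "\<theta> \<le> 1" for \<theta>
  proof -
    have st: "T (seg_between x w \<theta> (Suc n)) = seg_between x w \<theta> n" for n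
    proof -
      have xn: "x (Suc n) \<in> half (a n)" and wn: "w (Suc n) \<in> half (a n)" using x w by auto
      have "seg_between x w \<theta> (Suc n) \<in> half (a n)" using lv[OF \<theta>] by blast
      from tent_half[OF this] tent_half[OF xn] tent_half[OF wn] X_step[OF x(1), of n] X_step[OF w(1), of n]
      show ?thesis unfolding seg_between_def by (auto split: if_splits simp: algebra_simps)
    qed
    have r: "0 \<le> seg_between x w \<theta> n" "seg_between x w \<theta> n \<le> 1" for n
      using X_range[OF x(1), of n] X_range[OF w(1), of n] \<theta>
        convex_real_interval(5)[of 0 1, unfolded convex_alt] by (auto simp: seg_between_def)
    show ?thesis unfolding inv_limit_def using st r by auto
  qed
  show "arc (seg_between x w)" if "x \<noteq> w"
  proof -
    obtain n where n: "x n \<noteq> w n" using \<open>x \<noteq> w\<close> by (meson ext)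
    have "path (seg_between x w)"
      unfolding path_def seg_between_def by (intro continuous_on_coordinatewise_then_product continuous_intros)
    moreover have "inj_on (seg_between x w) {0..1}"
    proof
      fix \<theta> \<theta>' assume "seg_between x w \<theta> = seg_between x w \<theta>'"
      then have "seg_between x w \<theta> n = seg_between x w \<theta>' n" by simp
      then have "(\<theta> - \<theta>') * (w n - x n) = 0" by (simp add: seg_between_def algebra_simps)
      then show "\<theta> = \<theta>'" using n by simp
    qed
    ultimately show ?thesis by (simp add: arc_def)
  qed
  show "seg_between x w 0 = x" "seg_between x w 1 = w" by (auto simp: seg_between_def)
qed

text \<open>The segment from \<open>g 0\<close> to \<open>w\<close> consists of points with left
  part \<open>a\<close>. Either \<open>g\<close> meets it again at an interior parameter, or the
  segment and a first piece of \<open>g\<close> together form an arc, whose interior has only one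
  tail.\<close>

lemma arc_start_tail:
  assumes g: "arc g" "path_image g \<subseteq> X" and a: "lvalid a (g 0)" and w: "w \<in> X" "lvalid a w" "g 0 \<noteq> w"
  shows "\<exists>N. \<forall>n\<ge>N. a n = arc_tail g n"
proof -
  have g0: "g 0 \<in> X" using path_image_X[OF g(2)] by simp
  define h where "h = seg_between (g 0) w"
  note sg = seg_between[OF g0 a w(1,2), folded h_def]
  show ?thesis
  proof (cases "\<exists>t. 0 < t \<and> t < 1 \<and> g t \<in> path_image h")
    case True
    then obtain t where t: "0 < t" "t < 1" "g t \<in> path_image h" by auto
    then have "lvalid a (g t)" using sg(2) unfolding path_image_def by auto
    then show ?thesis using lvalid_arc_tail[OF g t(1,2)] by blast
  next
    case False
    \<comment> \<open>Only half of \<open>g\<close> is used, because its far end \<open>g 1\<close>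
      may lie on the segment.\<close>
    define k where "k = sub_arc 0 (1/2) g"
    have k: "arc k" "path_image k \<subseteq> X" "pathstart k = g 0"
      using sub_arc[OF g(1), of 0 "1/2"] g unfolding k_def by (auto simp: pathstart_def)
    have kt: "k t = g (t / 2)" for t by (simp add: k_def sub_arc_def)
    have arcs: "arc (reversepath h +++ k)"
    proof (rule arc_join)
      show "arc (reversepath h)" using sg(3)[OF w(3)] by (rule arc_reversepath)
      show "pathfinish (reversepath h) = pathstart k" using sg(4) k(3) by (simp add: pathstart_def)
      show "path_image (reversepath h) \<inter> path_image k \<subseteq> {pathstart k}"
      proof
        fix p assume p: "p \<in> path_image (reversepath h) \<inter> path_image k"
        then obtain t where t: "0 \<le> t" "t \<le> 1" "p = g (t / 2)" unfolding path_image_def[of k] kt by auto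
        then have "t = 0" using p False[simplified, rule_format, of "t / 2"] by (cases "0 < t") auto
        then show "p \<in> {pathstart k}" using t k(3) by simp
      qed
    qed (rule k(1))
    define p where "p = reversepath h +++ k"
    have "path_image h \<subseteq> X" using sg(1) unfolding path_image_def by auto
    then have pX: "path_image p \<subseteq> X"
      unfolding p_def using k(2) path_image_join_subset[of "reversepath h" k] by auto
    have p1: "p (1/4) = h (1/2)" "p (3/4) = g (1/4)"
      by (simp_all add: p_def joinpaths_def reversepath_def kt)
    have "lvalid a (p (1/4))" unfolding p1 by (rule sg(2)) auto
    then obtain N1 where N1: "\<And>n. n \<ge> N1 \<Longrightarrow> a n = arc_tail p n"
      using lvalid_arc_tail[OF arcs[folded p_def] pX, of "1/4" a] by auto
    obtain N2 where N2: "\<And>n. n \<ge> N2 \<Longrightarrow> arc_tail p n = (1/2 < p (3/4) (Suc n))"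
      using arc_tail_at[OF arcs[folded p_def] pX, of "3/4"] by auto
    obtain N3 where N3: "\<And>n. n \<ge> N3 \<Longrightarrow> arc_tail g n = (1/2 < g (1/4) (Suc n))"
      using arc_tail_at[OF g, of "1/4"] by auto
    have "a n = arc_tail g n" if "n \<ge> max N1 (max N2 N3)" for n
      using N1[of n] N2[of n] N3[of n] that unfolding p1 by auto
    then show ?thesis by blast
  qed
qed

section \<open>Critical parameters of an arc, basic arcs and spiral points\<close>

lemma tent_preimage_finite: "finite {r. 0 \<le> r \<and> r \<le> 1 \<and> (T ^^ k) r = y}"
proof (induction k)
  case 0
  have "{r. 0 \<le> r \<and> r \<le> 1 \<and> (T ^^ 0) r = y} \<subseteq> {y}" by auto
  then show ?case by (rule finite_subset) simp
next
  case (Suc k)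
  let ?A = "{r. 0 \<le> r \<and> r \<le> 1 \<and> (T ^^ k) r = y}"
  have "{r. 0 \<le> r \<and> r \<le> 1 \<and> (T ^^ Suc k) r = y} \<subseteq> (\<Union>z\<in>?A. {z / s, 1 - z / s})"
  proof
    fix r assume "r \<in> {r. 0 \<le> r \<and> r \<le> 1 \<and> (T ^^ Suc k) r = y}"
    then have r: "0 \<le> r" "r \<le> 1" "(T ^^ k) (T r) = y" by (auto simp: funpow_swap1)
    then have "T r \<in> ?A" using tent_range by auto
    moreover have "r = T r / s \<or> r = 1 - T r / s"
      using tent_half[OF half_exists[OF r(1,2)]] s_pos by (auto simp: field_simps split: if_splits)
    ultimately show "r \<in> (\<Union>z\<in>?A. {z / s, 1 - z / s})" by blast
  qed
  then show ?case by (rule finite_subset) (use Suc in auto)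
qed

text \<open>Away from the ends the symbols are constant beyond some level \<open>N\<close>, so
  coordinate \<open>N\<close> is injective in the parameter. A critical coordinate of smaller index
  restricts it to finitely many preimages of \<open>1/2\<close>.\<close>

lemma arc_critical_finite:
  assumes g: "arc g" "path_image g \<subseteq> X" and "0 < \<epsilon>"
  shows "finite {t \<in> {\<epsilon>..1 - \<epsilon>}. \<exists>n. g t n = 1/2}"
proof -
  have E: "t \<in> {0..1}" if "t \<in> {\<epsilon>..1 - \<epsilon>}" for t using that assms(3) by auto
  obtain N where N: "\<And>n t. n \<ge> N \<Longrightarrow> t \<in> {\<epsilon>..1 - \<epsilon>} \<Longrightarrow> g t (Suc n) \<noteq> 1/2 \<and> arc_tail g n = (1/2 < g t (Suc n))"
    using arc_tail_interior[OF g assms(3)] by blast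
  have inj: "inj_on (\<lambda>t. g t N) {\<epsilon>..1 - \<epsilon>}"
  proof
    fix t u assume tu: "t \<in> {\<epsilon>..1 - \<epsilon>}" "u \<in> {\<epsilon>..1 - \<epsilon>}" "g t N = g u N"
    note X = path_image_X[OF g(2) E[OF tu(1)]] path_image_X[OF g(2) E[OF tu(2)]]
    have h: "g r (Suc i) \<in> half (arc_tail g i)" if "i \<ge> N" "r \<in> {\<epsilon>..1 - \<epsilon>}" for i r
      using N[OF that] X_range[OF path_image_X[OF g(2) E[OF that(2)]], of "Suc i"] by (auto simp: half_iff)
    have "g t = g u" using level_inj[OF X, of N "arc_tail g"] h tu by blast
    then show "t = u" using g(1) E tu unfolding arc_def inj_on_def by blast
  qed
  have "{t \<in> {\<epsilon>..1 - \<epsilon>}. \<exists>n. g t n = 1/2} \<subseteq>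
    (\<Union>n\<le>N. {t \<in> {\<epsilon>..1 - \<epsilon>}. g t N \<in> {r. 0 \<le> r \<and> r \<le> 1 \<and> (T ^^ (N - n)) r = 1/2}})"
  proof
    fix t assume "t \<in> {t \<in> {\<epsilon>..1 - \<epsilon>}. \<exists>n. g t n = 1/2}"
    then obtain n where t: "t \<in> {\<epsilon>..1 - \<epsilon>}" "g t n = 1/2" by auto
    then have "n \<le> N" using N[of "n - 1" t] by (cases n) (auto simp: not_less_eq_eq[symmetric])
    moreover have "(T ^^ (N - n)) (g t N) = 1/2"
      using X_pow[OF path_image_X[OF g(2) E[OF t(1)]], of "N - n" n] t(2) calculation by simp
    ultimately show "t \<in> (\<Union>n\<le>N. {t \<in> {\<epsilon>..1 - \<epsilon>}. g t N \<in> {r. 0 \<le> r \<and> r \<le> 1 \<and> (T ^^ (N - n)) r = 1/2}})"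
      using t(1) X_range[OF path_image_X[OF g(2) E[OF t(1)]], of N] by blast
  qed
  moreover have "finite {t \<in> {\<epsilon>..1 - \<epsilon>}. g t N \<in> {r. 0 \<le> r \<and> r \<le> 1 \<and> (T ^^ (N - n)) r = 1/2}}" for n
  proof -
    let ?A = "{r. 0 \<le> r \<and> r \<le> 1 \<and> (T ^^ (N - n)) r = 1/2}"
    have "{t \<in> {\<epsilon>..1 - \<epsilon>}. g t N \<in> ?A} = (\<lambda>t. g t N) -` ?A \<inter> {\<epsilon>..1 - \<epsilon>}" by blast
    then show ?thesis using finite_vimage_IntI[OF tent_preimage_finite inj] by (simp only:)
  qed
  ultimately show ?thesis by (meson finite_UN_I finite_atMost finite_subset)
qed

end

lemma closed_side:
  fixes f :: "real \<Rightarrow> real"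
  assumes "u < v" "continuous_on {u..v} f" "\<And>t. t \<in> {u..v} \<Longrightarrow> f t \<in> {0..1}"
    and "\<And>t. u < t \<Longrightarrow> t < v \<Longrightarrow> f t \<noteq> 1/2" and t: "t \<in> {u..v}"
  shows "f t \<in> half (1/2 < f ((u + v) / 2))"
proof (rule ccontr)
  define m where "m = (u + v) / 2"
  assume "f t \<notin> half (1/2 < f ((u + v) / 2))"
  then have side: "1/2 < f m \<and> f t < 1/2 \<or> f m \<le> 1/2 \<and> 1/2 < f t"
    using assms(3)[OF t] by (auto simp: half_iff m_def split: if_splits)
  have m: "u < m" "m < v" using assms(1) by (auto simp: m_def)
  let ?S = "{min t m..max t m}"
  have "?S \<subseteq> {u..v}" using t m by (simp add: min_def max_def)
  then have conn: "connected (f ` ?S)"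
    by (intro connected_continuous_image continuous_on_subset[OF assms(2)] connected_Icc)
  have im: "f t \<in> f ` ?S" "f m \<in> f ` ?S" by (rule imageI; simp)+
  have "{f t..f m} \<subseteq> f ` ?S" "{f m..f t} \<subseteq> f ` ?S"
    by (rule connected_contains_Icc[OF conn im] connected_contains_Icc[OF conn im(2,1)])+
  moreover have "1/2 \<in> {f t..f m} \<or> 1/2 \<in> {f m..f t}" using side by simp argo
  ultimately have "1/2 \<in> f ` ?S" by blast
  then obtain r where r: "r \<in> ?S" "f r = 1/2" by (metis imageE)
  then have "r \<noteq> t" using side by auto
  then have "u < r" "r < v" using r(1) t m by (auto simp: min_def max_def split: if_splits)
  then show False using assms(4) r(2) by blast
qed

context tent_map begin

lemma represents_same_tail:
  assumes "represents s \<sigma> x" "represents s \<tau> x"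
  shows "\<exists>N. \<forall>n\<ge>N. left_part \<sigma> n = left_part \<tau> n"
proof (cases "left_part \<sigma> = left_part \<tau>")
  case False
  then obtain k where k: "k < 0" "identified_at s k \<sigma> \<tau>" using represents_left_cases assms by blast
  have "left_part \<sigma> n = left_part \<tau> n" if "n \<ge> nat (- k)" for n
  proof -
    have "- int (Suc n) \<noteq> k" using that k(1) by linarith
    then show ?thesis using k(2) unfolding identified_at_def left_part_def by blast
  qed
  then show ?thesis by blast
qed auto

lemma basic_arc_iff: "x \<in> basic_arc s a \<longleftrightarrow> (\<exists>\<sigma>. represents s \<sigma> x \<and> left_part \<sigma> = a)"
  by (simp add: basic_arc_def)

lemma basic_arcD: "x \<in> basic_arc s a \<Longrightarrow> x \<in> X \<and> lvalid a x"
  unfolding basic_arc_iff using representsD(2) represents_lvalid by blast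

text \<open>A given point of the basic arc serves as the second point that
  \<open>lvalid_represents\<close> asks for.\<close>

lemma basic_arc_eq:
  assumes "basic_arc s a \<noteq> {}" shows "basic_arc s a = {x \<in> X. lvalid a x}"
proof -
  obtain b where b: "b \<in> basic_arc s a" using assms by auto
  have "x \<in> basic_arc s a" if "x \<in> X" "lvalid a x" for x
    using lvalid_represents[of x a b] that b basic_arcD[OF b] unfolding basic_arc_iff by metis
  then show ?thesis using basic_arcD by blast
qed

lemma no_critical_lvalid:
  assumes g: "arc g" "path_image g \<subseteq> X" and uv: "0 \<le> u" "u < v" "v \<le> 1"
    and nc: "\<And>t n. u < t \<Longrightarrow> t < v \<Longrightarrow> g t (Suc n) \<noteq> 1/2"
  shows "\<exists>a. \<forall>t\<in>{u..v}. lvalid a (g t)"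
proof -
  have "g t (Suc n) \<in> half (1/2 < g ((u + v) / 2) (Suc n))" if "t \<in> {u..v}" for t n
  proof (rule closed_side[OF uv(2) _ _ nc that])
    show "continuous_on {u..v} (\<lambda>t. g t (Suc n))" using uv by (intro arc_coord_cont g) auto
    show "g r (Suc n) \<in> {0..1}" if "r \<in> {u..v}" for r
      using X_range[OF path_image_X[OF g(2)], of r] uv that by auto
  qed
  then show ?thesis by (intro exI[of _ "\<lambda>n. 1/2 < g ((u + v) / 2) (Suc n)"]) blast
qed

text \<open>On points with symbols \<open>a\<close>, coordinate 0 is an affine function of
  coordinate \<open>Suc n\<close>, and \<open>1/2\<close> is an end of \<open>half (a n)\<close>. So
  a critical coordinate marks an extreme value of coordinate 0; \<open>e\<close> tells which
  one.\<close>

lemma critical_end_bound: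
  assumes x: "x \<in> X" "lvalid a x" "x (Suc n) = 1/2"
  shows "\<exists>e. (e = 1 \<or> e = - 1) \<and> (\<forall>w\<in>X. lvalid a w \<longrightarrow> 0 \<le> e * (w 0 - x 0))"
proof -
  define k where "k = ones (map (\<lambda>j. a (0 + Suc n - 1 - j)) [0..<Suc n])"
  define e :: real where "e = (- 1) ^ k * (if a n then 1 else - 1)"
  have kk: "(- 1 :: real) ^ k * (- 1) ^ k = 1" by (cases "even k") auto
  have "0 \<le> e * (w 0 - x 0)" if w: "w \<in> X" "lvalid a w" for w
  proof -
    have "w 0 - x 0 = s ^ Suc n * (- 1) ^ k * (w (Suc n) - x (Suc n))"
      using level_diff[OF w(1) x(1), of 0 "Suc n" a] w(2) x(2) unfolding k_def by simp
    then have "e * (w 0 - x 0) = s ^ Suc n * ((- 1) ^ k * (- 1) ^ k) * ((if a n then 1 else - 1) * (w (Suc n) - 1/2))"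
      unfolding x(3) e_def by (simp only: mult_ac)
    also have "\<dots> = s ^ Suc n * ((if a n then 1 else - 1) * (w (Suc n) - 1/2))" unfolding kk by simp
    finally have eq: "e * (w 0 - x 0) = s ^ Suc n * ((if a n then 1 else - 1) * (w (Suc n) - 1/2))" .
    have "0 \<le> (if a n then 1 else - 1) * (w (Suc n) - 1/2)"
      using w(2)[rule_format, of n] by (auto simp: half_iff split: if_splits)
    then show ?thesis unfolding eq using s_pos by (intro mult_nonneg_nonneg[of "s ^ Suc n"]) auto
  qed
  moreover have "e = 1 \<or> e = - 1" unfolding e_def by (cases "even k") auto
  ultimately show ?thesis by blast
qed

text \<open>All points between the two parameters have a common left part, and both ends are extreme
  in coordinate 0. By continuity the piece takes all values in between, and \<open>level_inj\<close>
  turns equal values into equal points.\<close>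

lemma consecutive_critical_basic_arc:
  assumes g: "arc g" "path_image g \<subseteq> X" and uv: "0 \<le> u" "u < v" "v \<le> 1"
    and nc: "\<And>t n. u < t \<Longrightarrow> t < v \<Longrightarrow> g t (Suc n) \<noteq> 1/2"
    and c: "g u (Suc n) = 1/2" "g v (Suc m) = 1/2"
  shows "\<exists>a. left_admissible s a \<and> basic_arc s a = g ` {u..v}"
proof -
  obtain a where a: "\<And>t. t \<in> {u..v} \<Longrightarrow> lvalid a (g t)" using no_critical_lvalid[OF g uv nc] by blast
  have gX: "g t \<in> X" if "t \<in> {u..v}" for t using path_image_X[OF g(2), of t] that uv by auto
  have inj: "g t \<noteq> g r" if "t \<in> {u..v}" "r \<in> {u..v}" "t \<noteq> r" for t r
  proof -
    have "t \<in> {0..1}" "r \<in> {0..1}" using that uv by auto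
    then show ?thesis using g(1) that(3) unfolding arc_def by (metis inj_onD)
  qed
  have uvm: "u \<in> {u..v}" "v \<in> {u..v}" using uv by auto
  obtain \<sigma> where \<sigma>: "represents s \<sigma> (g u)" "left_part \<sigma> = a"
    using lvalid_represents[OF gX[OF uvm(1)] a[OF uvm(1)] gX[OF uvm(2)] a[OF uvm(2)]] inj[OF uvm] uv by auto
  then have ne: "basic_arc s a \<noteq> {}" and adm: "left_admissible s a"
    using represents_left_admissible unfolding basic_arc_def by blast+
  have "w \<in> g ` {u..v}" if w: "w \<in> X" "lvalid a w" for w
  proof -
    from critical_end_bound[OF gX[OF uvm(1)] a[OF uvm(1)] c(1)] obtain e
      where "(e = 1 \<or> e = - 1) \<and> (\<forall>w\<in>X. lvalid a w \<longrightarrow> 0 \<le> e * (w 0 - g u 0))" ..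
    then have e: "e = 1 \<or> e = - 1" "\<And>w. w \<in> X \<Longrightarrow> lvalid a w \<Longrightarrow> 0 \<le> e * (w 0 - g u 0)"
      by simp_all
    from critical_end_bound[OF gX[OF uvm(2)] a[OF uvm(2)] c(2)] obtain f
      where "(f = 1 \<or> f = - 1) \<and> (\<forall>w\<in>X. lvalid a w \<longrightarrow> 0 \<le> f * (w 0 - g v 0))" ..
    then have f: "f = 1 \<or> f = - 1" "\<And>w. w \<in> X \<Longrightarrow> lvalid a w \<Longrightarrow> 0 \<le> f * (w 0 - g v 0)"
      by simp_all
    have ne0: "g u 0 \<noteq> g v 0"
      using level_inj[OF gX[OF uvm(1)] gX[OF uvm(2)], of 0 a] a[OF uvm(1)] a[OF uvm(2)] inj[OF uvm] uv(2) by blast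
    have "w 0 \<in> {g u 0..g v 0} \<or> w 0 \<in> {g v 0..g u 0}"
    proof -
      have "P \<le> W \<and> W \<le> Q \<or> Q \<le> W \<and> W \<le> P"
        if "0 \<le> e * (W - P)" "0 \<le> f * (W - Q)" "0 \<le> e * (Q - P)" "0 \<le> f * (P - Q)" "P \<noteq> Q" for P Q W :: real
        using e(1) f(1) that by (elim disjE) simp_all
      from this[OF e(2)[OF w] f(2)[OF w] e(2)[OF gX[OF uvm(2)] a[OF uvm(2)]] f(2)[OF gX[OF uvm(1)] a[OF uvm(1)]] ne0]
      show ?thesis by simp
    qed
    moreover have conn: "connected ((\<lambda>t. g t 0) ` {u..v})"
      using uv by (intro connected_continuous_image arc_coord_cont g) auto
    have im: "g u 0 \<in> (\<lambda>t. g t 0) ` {u..v}" "g v 0 \<in> (\<lambda>t. g t 0) ` {u..v}" using uvm by blast+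
    have "{g u 0..g v 0} \<subseteq> (\<lambda>t. g t 0) ` {u..v}" "{g v 0..g u 0} \<subseteq> (\<lambda>t. g t 0) ` {u..v}"
      by (rule connected_contains_Icc[OF conn im] connected_contains_Icc[OF conn im(2,1)])+
    ultimately have "w 0 \<in> (\<lambda>t. g t 0) ` {u..v}" by blast
    then obtain r where r: "r \<in> {u..v}" "w 0 = g r 0" by blast
    then have "w = g r" using level_inj[OF w(1) gX[OF r(1)], of 0 a] w(2) a[OF r(1)] by blast
    then show ?thesis using r(1) by blast
  qed
  moreover have "g t \<in> basic_arc s a" if "t \<in> {u..v}" for t
    unfolding basic_arc_eq[OF ne] using gX[OF that] a[OF that] by simp
  ultimately have "basic_arc s a = g ` {u..v}" using basic_arcD by blast
  then show ?thesis using adm by blast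
qed

text \<open>Critical parameters are finite in number away from the ends, so arbitrarily close to 0
  there are consecutive ones, and the piece between them is a whole basic arc.\<close>

lemma critical_accumulation_spiral:
  assumes g: "arc g" "path_image g \<subseteq> X"
    and acc: "\<And>\<delta>. 0 < \<delta> \<Longrightarrow> \<exists>t n. 0 < t \<and> t < \<delta> \<and> t < 1 \<and> g t (Suc n) = 1/2"
  shows "spiral_point s (g 0)"
proof -
  have small: "\<exists>u v a. 0 < u \<and> u < v \<and> v < \<epsilon> \<and> v < 1 \<and> left_admissible s a \<and> basic_arc s a = g ` {u..v}"
    if \<epsilon>: "0 < \<epsilon>" for \<epsilon>
  proof -
    obtain v m where v: "0 < v" "v < \<epsilon>" "v < 1" "g v (Suc m) = 1/2" using acc[OF \<epsilon>] by auto
    obtain t0 k where t0: "0 < t0" "t0 < v" "g t0 (Suc k) = 1/2" using acc[OF v(1)] by auto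
    define C where "C = {t \<in> {t0..<v}. \<exists>n. g t (Suc n) = 1/2}"
    define \<delta> where "\<delta> = min t0 (1 - v)"
    have "0 < \<delta>" "\<delta> \<le> t0" "v \<le> 1 - \<delta>" using t0 v by (auto simp: \<delta>_def)
    then have "C \<subseteq> {t \<in> {\<delta>..1 - \<delta>}. \<exists>n. g t n = 1/2}" unfolding C_def by fastforce
    moreover have "finite {t \<in> {\<delta>..1 - \<delta>}. \<exists>n. g t n = 1/2}"
      using \<open>0 < \<delta>\<close> by (rule arc_critical_finite[OF g])
    ultimately have fC: "finite C" by (rule finite_subset)
    have C0: "t0 \<in> C" using t0 by (auto simp: C_def)
    define u where "u = Max C"
    have "u \<in> C" using fC C0 unfolding u_def by (intro Max_in) auto
    then obtain n where u: "t0 \<le> u" "u < v" "g u (Suc n) = 1/2" by (auto simp: C_def)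
    have "g t (Suc n) \<noteq> 1/2" if "u < t" "t < v" for t n
    proof
      assume "g t (Suc n) = 1/2"
      then have "t \<in> C" using that u by (auto simp: C_def)
      then show False using Max_ge[OF fC] that(1) unfolding u_def by force
    qed
    then have "\<exists>a. left_admissible s a \<and> basic_arc s a = g ` {u..v}"
      using u v t0 by (intro consecutive_critical_basic_arc[OF g]) auto
    then show ?thesis using u v t0 by (meson less_le_trans)
  qed
  define \<B> where "\<B> b = {B. (\<exists>a. left_admissible s a \<and> B = basic_arc s a) \<and> B \<subseteq> g ` {0..b}}" for b
  have inf: "infinite (\<B> b)" if b: "0 < b" "b < 1" for b
  proof
    assume fin: "finite (\<B> b)"
    define \<C> where "\<C> = {B \<in> \<B> b. \<exists>u v. 0 < u \<and> u < v \<and> v < 1 \<and> B = g ` {u..v}}"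
    have fC: "finite \<C>" using fin by (simp add: \<C>_def)
    \<comment> \<open>Each such basic arc stays away from parameter 0, hence so do finitely many;
      one lying still closer to 0 is then new as a set.\<close>
    have "\<forall>B\<in>\<C>. \<exists>u. 0 < u \<and> (\<forall>t\<in>{0..1}. g t \<in> B \<longrightarrow> u \<le> t)"
    proof
      fix B assume "B \<in> \<C>"
      then obtain u v where uv: "0 < u" "u < v" "v < 1" "B = g ` {u..v}" by (auto simp: \<C>_def)
      have "u \<le> t" if t: "t \<in> {0..1}" "g t \<in> B" for t
      proof -
        obtain r where r: "r \<in> {u..v}" "g t = g r" using t(2) uv(4) by auto
        moreover have "r \<in> {0..1}" using r(1) uv by auto
        ultimately have "t = r" using g(1) t(1) unfolding arc_def by (metis inj_onD)
        then show ?thesis using r by simp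
      qed
      then show "\<exists>u. 0 < u \<and> (\<forall>t\<in>{0..1}. g t \<in> B \<longrightarrow> u \<le> t)" using uv(1) by blast
    qed
    from bchoice[OF this] obtain f
      where "\<forall>B\<in>\<C>. 0 < f B \<and> (\<forall>t\<in>{0..1}. g t \<in> B \<longrightarrow> f B \<le> t)" ..
    then have f: "\<And>B. B \<in> \<C> \<Longrightarrow> 0 < f B"
      "\<And>B t. B \<in> \<C> \<Longrightarrow> t \<in> {0..1} \<Longrightarrow> g t \<in> B \<Longrightarrow> f B \<le> t" by blast+
    define \<epsilon> where "\<epsilon> = Min (insert b (f ` \<C>))"
    have "0 < \<epsilon>" using fC f(1) b unfolding \<epsilon>_def by (subst Min_gr_iff) auto
    then obtain u v a where uva: "0 < u" "u < v" "v < \<epsilon>" "v < 1" "left_admissible s a" "basic_arc s a = g ` {u..v}"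
      using small by blast
    have "\<epsilon> \<le> b" using fC unfolding \<epsilon>_def by (intro Min_le) auto
    then have "{u..v} \<subseteq> {0..b}" using uva by auto
    then have "g ` {u..v} \<subseteq> g ` {0..b}" by (rule image_mono)
    then have B: "g ` {u..v} \<in> \<C>" using uva unfolding \<C>_def \<B>_def by blast
    have "f (g ` {u..v}) \<le> u" by (rule f(2)[OF B]) (use uva in auto)
    moreover have "\<epsilon> \<le> f (g ` {u..v})" using fC B unfolding \<epsilon>_def by (intro Min_le) auto
    ultimately show False using uva by simp
  qed
  \<comment> \<open>This takes \<open>{0..}\<close> onto \<open>{0..<1}\<close>: the ray is the arc
    without its far end.\<close>
  define r where "r t = g (t / (1 + t))" for t
  have sc: "t / (1 + t) \<in> {0..1}" if "0 \<le> t" for t :: real using that by (auto simp: field_simps)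
  have cg: "continuous_on {0..1} g" "inj_on g {0..1}" using g(1) by (auto simp: arc_def path_def)
  have "continuous_on {0..} r" unfolding r_def
    by (rule continuous_on_compose2[OF cg(1)]) (intro continuous_intros, auto simp: field_simps)
  moreover have "inj_on r {0..}"
  proof
    fix t t' :: real assume t: "t \<in> {0..}" "t' \<in> {0..}" "r t = r t'"
    then have "t / (1 + t) = t' / (1 + t')"
      using inj_onD[OF cg(2) t(3)[unfolded r_def] sc sc] by simp
    then show "t = t'" using t(1,2) by (simp add: divide_eq_eq eq_divide_eq algebra_simps)
  qed
  moreover have "r ` {0..} \<subseteq> X" unfolding r_def using path_image_X[OF g(2) sc] by auto
  moreover have "r 0 = g 0" by (simp add: r_def)
  moreover have "infinite {B. (\<exists>a. left_admissible s a \<and> B = basic_arc s a) \<and> B \<subseteq> r ` {0..t}}" if "t > 0" for t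
  proof -
    have "g ` {0..t / (1 + t)} \<subseteq> r ` {0..t}"
    proof
      fix p assume "p \<in> g ` {0..t / (1 + t)}"
      then obtain b where b: "0 \<le> b" "b \<le> t / (1 + t)" "p = g b" by auto
      have "t / (1 + t) < 1" using that by simp
      then have b1: "b < 1" using b(2) by simp
      have "b / (1 - b) \<le> t" using b that b1 by (simp add: field_simps)
      moreover have "(b / (1 - b)) / (1 + b / (1 - b)) = b" using b1 by (simp add: field_simps)
      ultimately show "p \<in> r ` {0..t}" using b b1 by (intro image_eqI[of _ _ "b / (1 - b)"]) (auto simp: r_def)
    qed
    then have "\<B> (t / (1 + t)) \<subseteq> {B. (\<exists>a. left_admissible s a \<and> B = basic_arc s a) \<and> B \<subseteq> r ` {0..t}}"
      unfolding \<B>_def by blast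
    moreover have "infinite (\<B> (t / (1 + t)))" using that by (intro inf) (auto simp: field_simps)
    ultimately show ?thesis using finite_subset by blast
  qed
  ultimately show ?thesis unfolding spiral_point_def by blast
qed

text \<open>If the basic arc has a second point, \<open>arc_start_tail\<close> applies. If not, a
  start that is no spiral point has no critical coordinates just after it, so a first piece of the
  arc has a constant left part; this represents \<open>g 0\<close> as \<open>L\<close> does, and two
  representations share their tail.\<close>

lemma arc_tail_of_basic_arc:
  assumes g: "arc g" "path_image g \<subseteq> X" and L: "g 0 \<in> basic_arc s L"
    and ns: "\<not> (basic_arc s L = {g 0} \<and> spiral_point s (g 0))"
  shows "\<exists>N. \<forall>n\<ge>N. L n = arc_tail g n"
proof (cases "basic_arc s L = {g 0}")
  case False
  then obtain w where w: "w \<in> basic_arc s L" "w \<noteq> g 0" using L by blast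
  then show ?thesis using arc_start_tail[OF g, of L w] basic_arcD[OF L] basic_arcD[OF w(1)] by blast
next
  case True
  then have "\<not> spiral_point s (g 0)" using ns by blast
  then obtain \<delta> where \<delta>: "0 < \<delta>" "\<And>t n. 0 < t \<Longrightarrow> t < \<delta> \<Longrightarrow> t < 1 \<Longrightarrow> g t (Suc n) \<noteq> 1/2"
    using critical_accumulation_spiral[OF g] by blast
  define v where "v = min \<delta> (1/2)"
  have v: "0 < v" "v \<le> 1/2" "v \<le> \<delta>" using \<delta>(1) by (auto simp: v_def)
  have "\<exists>a. \<forall>t\<in>{0..v}. lvalid a (g t)"
    by (rule no_critical_lvalid[OF g]) (use \<delta>(2) v in auto)
  then obtain a where a: "\<And>t. t \<in> {0..v} \<Longrightarrow> lvalid a (g t)" by blast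
  have gX: "g 0 \<in> X" "g v \<in> X" using path_image_X[OF g(2)] v by auto
  have "g 0 \<noteq> g v" using g(1) v unfolding arc_def inj_on_def by force
  then obtain \<sigma> where \<sigma>: "represents s \<sigma> (g 0)" "left_part \<sigma> = a"
    using lvalid_represents[OF gX(1) a gX(2) a] v by auto
  obtain \<tau> where \<tau>: "represents s \<tau> (g 0)" "left_part \<tau> = L" using L unfolding basic_arc_iff by auto
  obtain N1 where N1: "\<And>n. n \<ge> N1 \<Longrightarrow> a n = L n" using represents_same_tail[OF \<sigma>(1) \<tau>(1)] \<sigma> \<tau> by auto
  obtain N2 where N2: "\<And>n. n \<ge> N2 \<Longrightarrow> a n = arc_tail g n"
    using lvalid_arc_tail[OF g, of v a] a[of v] v by auto
  have "L n = arc_tail g n" if "n \<ge> max N1 N2" for n using N1[of n] N2[of n] that by auto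
  then show ?thesis by blast
qed

end

text \<open>The \<open>j\<close>-th path is run through on the interval from \<open>j\<close> to
  \<open>j + 1\<close>, and the half-line is compressed to \<open>{0..<1}\<close>. Continuity at 1
  is the shrinking of the balls.\<close>

lemma infinite_concatenation:
  fixes z :: "nat \<Rightarrow> 'a::metric_space"
  assumes pc: "\<And>j. path_component (S j) (z j) (z (Suc j))"
    and sub: "\<And>j. S j \<subseteq> ball p (\<eta> j)" and \<eta>: "\<eta> \<longlonglongrightarrow> 0"
  shows "\<exists>h. path h \<and> pathfinish h = p \<and> (\<forall>t. 0 \<le> t \<longrightarrow> t < 1 \<longrightarrow> h t \<in> (\<Union>j. S j))"
proof -
  have "\<exists>g. path g \<and> path_image g \<subseteq> S j \<and> pathstart g = z j \<and> pathfinish g = z (Suc j)" for j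
    using pc unfolding path_component_def .
  then obtain \<beta> where \<beta>: "\<And>j. path (\<beta> j)" "\<And>j. path_image (\<beta> j) \<subseteq> S j"
    "\<And>j. \<beta> j 0 = z j" "\<And>j. \<beta> j 1 = z (Suc j)"
    unfolding pathstart_def pathfinish_def by metis
  define G where "G u = \<beta> (nat \<lfloor>u\<rfloor>) (u - of_int \<lfloor>u\<rfloor>)" for u :: real
  have fl: "\<lfloor>u\<rfloor> = int j" if "real j \<le> u" "u < real j + 1" for u j
    using that by (intro floor_unique) auto
  \<comment> \<open>The right end is included although the floor has already jumped there:
    consecutive paths share this point.\<close>
  have Gj: "G u = \<beta> j (u - real j)" if "real j \<le> u" "u \<le> real j + 1" for u j
  proof (cases "u = real j + 1")
    case True
    have "\<lfloor>u\<rfloor> = int (Suc j)" by (rule fl) (auto simp: True)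
    then show ?thesis using \<beta>(3)[of "Suc j"] \<beta>(4)[of j]
      by (simp add: G_def True del: of_nat_Suc) (metis Suc_eq_plus1 nat_int of_nat_Suc add.commute)
  next
    case False
    then show ?thesis using fl[of j u] that by (simp add: G_def)
  qed
  have GS: "G u \<in> S (nat \<lfloor>u\<rfloor>)" if "0 \<le> u" for u
  proof -
    have "u - of_int \<lfloor>u\<rfloor> \<in> {0..1}" by simp linarith
    then show ?thesis using \<beta>(2) unfolding G_def path_image_def by blast
  qed
  have Gc: "continuous_on {0..real k} G" for k
  proof (induction k)
    case (Suc k)
    have "continuous_on {real k..real k + 1} (\<lambda>u. \<beta> k (u - real k))"
      using \<beta>(1)[of k, unfolded path_def]
      by (rule continuous_on_compose2) (intro continuous_intros, auto)
    then have "continuous_on {real k..real k + 1} G"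
      by (rule continuous_on_eq) (use Gj in auto)
    moreover have "{0..real (Suc k)} = {0..real k} \<union> {real k..real k + 1}" by auto
    ultimately show ?case using Suc continuous_on_closed_Un[of "{0..real k}" "{real k..real k + 1}" G] by simp
  qed simp
  define h where "h t = (if t < 1 then G (t / (1 - t)) else p)" for t
  have "continuous (at t within {0..1}) h" if t: "t \<in> {0..1}" for t
  proof (cases "t < 1")
    case True
    define c where "c = (1 + t) / 2"
    have c: "t < c" "c < 1" using True by (auto simp: c_def)
    obtain k where k: "c / (1 - c) \<le> real k" using real_arch_simple by blast
    have mono: "u / (1 - u) \<le> c / (1 - c)" if "u \<le> c" for u using that c by (simp add: field_simps)
    have "continuous_on {0..c} (\<lambda>u. G (u / (1 - u)))"
    proof (rule continuous_on_compose2[OF Gc[of k]])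
      show "continuous_on {0..c} (\<lambda>u. u / (1 - u))" using c by (intro continuous_intros) auto
      show "(\<lambda>u. u / (1 - u)) ` {0..c} \<subseteq> {0..real k}" using mono k c by force
    qed
    then have "continuous_on {0..c} h" by (rule continuous_on_eq) (use c in \<open>auto simp: h_def\<close>)
    then have "continuous (at t within {0..c}) h" using t c by (auto simp: continuous_on_eq_continuous_within)
    moreover have "at t within {0..c} = at t within {0..1}"
      using c by (intro at_within_nhd[of _ "{..<c}"]) auto
    ultimately show ?thesis by simp
  next
    case False
    then have t1: "t = 1" using t by simp
    show ?thesis unfolding t1 continuous_within Lim_within
    proof (intro allI impI)
      fix e :: real assume "0 < e"
      then obtain J where J: "\<And>j. j \<ge> J \<Longrightarrow> \<eta> j < e"
        using order_tendstoD(2)[OF \<eta>] unfolding eventually_sequentially by blast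
      show "\<exists>d>0. \<forall>x\<in>{0..1}. 0 < dist x 1 \<and> dist x 1 < d \<longrightarrow> dist (h x) (h 1) < e"
      proof (intro exI[of _ "1 / (real J + 1)"] conjI ballI impI)
        fix x :: real assume x: "x \<in> {0..1}" "0 < dist x 1 \<and> dist x 1 < 1 / (real J + 1)"
        then have x1: "x < 1" "1 - x < 1 / (real J + 1)" by (auto simp: dist_real_def)
        have "real J \<le> x / (1 - x)" using x1 by (simp add: field_simps)
        then have "J \<le> nat \<lfloor>x / (1 - x)\<rfloor>" by (simp add: le_nat_floor)
        moreover have "h x \<in> S (nat \<lfloor>x / (1 - x)\<rfloor>)" using GS[of "x / (1 - x)"] x x1 by (simp add: h_def)
        ultimately have "dist p (h x) < e" using sub J by (metis mem_ball order_less_trans subsetD)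
        then show "dist (h x) (h 1) < e" by (simp add: h_def dist_commute)
      qed simp
    qed
  qed
  then have "path h" unfolding path_def by (simp add: continuous_on_eq_continuous_within)
  moreover have "h t \<in> (\<Union>j. S j)" if "0 \<le> t" "t < 1" for t
    using GS[of "t / (1 - t)"] that by (auto simp: h_def)
  moreover have "pathfinish h = p" by (simp add: pathfinish_def h_def)
  ultimately show ?thesis by blast
qed

section \<open>Compactness and limits\<close>

lemma coord_continuous: "continuous_on A (\<lambda>x::nat \<Rightarrow> real. x n)"
  by (rule continuous_on_product_then_coordinatewise) (rule continuous_on_id)

lemma coord_tendsto: "(f \<longlongrightarrow> (l :: nat \<Rightarrow> real)) G \<Longrightarrow> ((\<lambda>t. f t n) \<longlongrightarrow> l n) G"
  using continuous_on_tendsto_compose[OF coord_continuous[of UNIV n], of f l G] by simp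

context tent_map begin

lemma tent_continuous: "continuous_on A T"
  unfolding tent_def by (intro continuous_intros)

lemma compact_X: "compact X"
proof -
  have c: "compact (Pi\<^sub>E UNIV (\<lambda>_::nat. {0..1::real}))"
    using compactin_PiE[of "\<lambda>_::nat. euclidean" UNIV "\<lambda>_. {0..1::real}"]
    unfolding euclidean_product_topology compactin_euclidean_iff by (simp add: compact_Icc)
  have "closed {x::nat \<Rightarrow> real. T (x (Suc n)) = x n}" for n
  proof (rule closed_Collect_eq)
    show "continuous_on UNIV (\<lambda>x::nat \<Rightarrow> real. T (x (Suc n)))"
      by (rule continuous_on_compose2[OF tent_continuous[of UNIV] coord_continuous]) simp
  qed (rule coord_continuous)
  then have "closed (\<Inter>n. {x::nat \<Rightarrow> real. T (x (Suc n)) = x n})" by (intro closed_INT ballI)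
  then have "compact (Pi\<^sub>E UNIV (\<lambda>_::nat. {0..1}) \<inter> (\<Inter>n. {x. T (x (Suc n)) = x n}))"
    by (rule compact_Int_closed[OF c])
  also have "Pi\<^sub>E UNIV (\<lambda>_. {0..1}) \<inter> (\<Inter>n. {x. T (x (Suc n)) = x n}) = X"
    unfolding inv_limit_def PiE_UNIV_domain Pi_def by fast
  finally show ?thesis .
qed

text \<open>The common symbols may change with \<open>j\<close>, but in each coordinate lying in a
  common half is a closed condition on pairs.\<close>

lemma common_symbols_limit:
  assumes "x \<longlonglongrightarrow> (x0 :: nat \<Rightarrow> real)" "v \<longlonglongrightarrow> v0" "\<And>j. \<exists>a. lvalid a (x j) \<and> lvalid a (v j)"
  shows "\<exists>a. lvalid a x0 \<and> lvalid a v0"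
proof -
  let ?S = "half True \<times> half True \<union> half False \<times> half False"
  have "\<exists>b. x0 (Suc n) \<in> half b \<and> v0 (Suc n) \<in> half b" for n
  proof -
    have "closed ?S" by (intro closed_Un closed_Times) (auto simp: half_def)
    moreover have "(x j (Suc n), v j (Suc n)) \<in> ?S" for j
    proof -
      obtain a where "lvalid a (x j)" "lvalid a (v j)" using assms(3) by blast
      then show ?thesis by (cases "a n") (metis SigmaI UnI1 UnI2)+
    qed
    moreover have "(\<lambda>j. (x j (Suc n), v j (Suc n))) \<longlonglongrightarrow> (x0 (Suc n), v0 (Suc n))"
      using assms(1,2) by (intro tendsto_Pair coord_tendsto)
    ultimately have "(x0 (Suc n), v0 (Suc n)) \<in> ?S" by (rule closed_sequentially)
    then show ?thesis by blast
  qed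
  then show ?thesis by metis
qed

text \<open>Either \<open>a\<close> and \<open>e\<close> differ within the first \<open>m\<close>
  symbols, and their cylinders are apart, or they share the level-\<open>m\<close> centre, from
  which the level-\<open>n\<close> centre has moved away for good by
  \<open>ctr_upper\<close>.\<close>

lemma ctr_level_unique:
  assumes "ctr L m e = ctr L n a" "m < n" shows False
proof (cases "\<exists>i<m. a i \<noteq> e i")
  case True
  then obtain i where "i < m" "a i \<noteq> e i" by blast
  then have "4 * gap m \<le> \<bar>ctr L m a - ctr L m e\<bar>" by (rule ctr_separated)
  then show False using ctr_ctr[of m n L a] assms gap_pos[of m] gap_pos[of n] by linarith
next
  case False
  then have "ctr L m a = ctr L m e" by (intro ctr_agree) auto
  then show False using ctr_upper[OF assms(2), of L a] gap_pos[of "Suc m"] gap_pos[of n] assms(1) by simp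
qed

lemma arch_same_height:
  assumes "(u, v) \<in> arch L n a \<rho>" "(u', v) \<in> arch L n a \<rho>" shows "u = u'"
proof -
  have "(u - crit_pos n)\<^sup>2 = (u' - crit_pos n)\<^sup>2"
    and o: "0 \<le> orient n * (u - crit_pos n)" "0 \<le> orient n * (u' - crit_pos n)"
    using assms by (auto simp: arch_def)
  then have "u - crit_pos n = u' - crit_pos n \<or> u - crit_pos n = - (u' - crit_pos n)"
    by (simp only: power2_eq_iff)
  moreover have "0 \<le> u - crit_pos n \<and> 0 \<le> u' - crit_pos n \<or> u - crit_pos n \<le> 0 \<and> u' - crit_pos n \<le> 0"
    using orient_cases[of n] o by (elim disjE) simp_all
  ultimately show ?thesis by linarith
qed

end

context tent_embedding begin

text \<open>If \<open>F\<close> maps two points of the same vertical line through a level-\<open>n\<close> turning value to one point,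
  the fibre lies in one semicircle; as centres of different levels differ, this is the semicircle with
  these ends, and the fibre, being connected, is all of it.\<close>

lemma fibre_arch:
  assumes eq: "F (crit_pos n, y) = p" "F (crit_pos n, y') = p" and ne: "y \<noteq> y'"
    and mid: "(y + y') / 2 = ctr L n a" and a: "kmatch n a" and z: "z \<in> arch L n a (y - ctr L n a)"
  shows "F z = p"
proof -
  let ?A = "F -` {p}"
  have in_A: "(crit_pos n, y) \<in> ?A" "(crit_pos n, y') \<in> ?A" using eq by auto
  then have "?A \<noteq> {q}" for q using ne by (metis prod.inject singletonD)
  then obtain J where J: "connected ?A" "J \<in> semicircles s L" "?A \<subseteq> J" using F_fibre[of p] by blast
  then obtain m e f x where j: "joined m e f x" "J = arch L m e (psi L e - ctr L m e)"
    unfolding semicircles_def using semicircles_atD by (metis UN_E)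
  have in_J: "(crit_pos n, y) \<in> J" "(crit_pos n, y') \<in> J" using in_A J(3) by blast+
  then have "(crit_pos n - crit_pos m)\<^sup>2 + (y - ctr L m e)\<^sup>2 = (crit_pos n - crit_pos m)\<^sup>2 + (y' - ctr L m e)\<^sup>2"
    unfolding j(2) arch_def by simp
  then have "(y - ctr L m e)\<^sup>2 = (y' - ctr L m e)\<^sup>2" by simp
  then have "y - ctr L m e = y' - ctr L m e \<or> y - ctr L m e = - (y' - ctr L m e)" by (simp only: power2_eq_iff)
  then have c: "ctr L m e = ctr L n a" using ne mid by argo
  then have "\<not> m < n" "\<not> n < m" using ctr_level_unique[of L m e n a] ctr_level_unique[of L n a m e] by auto
  then have mn: "m = n" by simp
  then have "(y - ctr L n a)\<^sup>2 = (psi L e - ctr L m e)\<^sup>2"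
    using in_J(1) c unfolding j(2) arch_def by simp
  then have JA: "J = arch L n a (y - ctr L n a)" unfolding j(2) mn arch_def using c mn by auto
  obtain u v where uv: "z = (u, v)" by fastforce
  have "\<bar>v - ctr L n a\<bar> \<le> \<bar>y - ctr L n a\<bar>" using arch_height z uv by blast
  moreover have y': "y' = 2 * ctr L n a - y" using mid by simp
  ultimately have vb: "v \<in> {y..y'} \<or> v \<in> {y'..y}"
    unfolding y' atLeastAtMost_iff by linarith
  have conn: "connected (snd ` ?A)"
    by (rule connected_continuous_image[OF _ J(1)]) (intro continuous_intros)
  have im: "y \<in> snd ` ?A" "y' \<in> snd ` ?A" using in_A by force+
  have "{y..y'} \<subseteq> snd ` ?A" "{y'..y} \<subseteq> snd ` ?A"
    by (rule connected_contains_Icc[OF conn im] connected_contains_Icc[OF conn im(2,1)])+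
  then obtain u' where u': "(u', v) \<in> ?A" using vb by force
  then have "u' = u" using J(3) z uv arch_same_height unfolding JA by blast
  then show ?thesis using u' uv by simp
qed

end

lemma flip_limit: "\<forall>i\<ge>N. a i = L i \<Longrightarrow> lim (\<lambda>n. flip L a n) = flip L a N"
proof (rule limI, rule tendsto_eventually)
  assume "\<forall>i\<ge>N. a i = L i"
  then show "\<forall>\<^sub>F n in sequentially. flip L a n = flip L a N"
    using flip_tail by (intro eventually_sequentiallyI[of N]) blast
qed

text \<open>The end to be reached is \<open>g 0\<close>. The last assumption covers every fitting
  left part, admissible or not, because limits of symbols are only known to fit.\<close>

locale degenerate_end = tent_embedding +
  fixes g :: "real \<Rightarrow> nat \<Rightarrow> real"
  assumes g: "arc g" "path_image g \<subseteq> inv_limit s"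
    and g_tail: "\<exists>N. \<forall>n\<ge>N. L n = arc_tail g n"
    and end_degenerate: "\<And>a w. \<forall>i. g 0 (Suc i) \<in> half (a i) \<Longrightarrow> w \<in> inv_limit s \<Longrightarrow>
      \<forall>i. w (Suc i) \<in> half (a i) \<Longrightarrow> w = g 0"
begin

subsection \<open>Following an arc to a degenerate end\<close>

abbreviation p where "p \<equiv> \<phi> (g 0)"

definition lefts where "lefts t = {a. g t \<in> basic_arc s a}"

lemma g_X: "0 \<le> t \<Longrightarrow> t \<le> 1 \<Longrightarrow> g t \<in> X" using path_image_X[OF g(2)] by simp

lemma g_tendsto: assumes "t \<longlonglongrightarrow> 0" "\<And>j. 0 < t j \<and> t j < 1" shows "(\<lambda>j. g (t j)) \<longlonglongrightarrow> g 0"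
proof -
  have "continuous_on {0..1} g" using g(1) by (simp add: arc_def path_def)
  then show ?thesis by (rule continuous_on_tendsto_compose[OF _ assms(1)]) (simp_all add: assms(2) less_imp_le)
qed

lemma lefts_ne: "0 < t \<Longrightarrow> t < 1 \<Longrightarrow> lefts t \<noteq> {}"
  using represents_exists[OF g_X, of t] unfolding lefts_def basic_arc_iff by auto

lemma lefts_adm: "a \<in> lefts t \<Longrightarrow> left_admissible s a"
  using represents_left_admissible unfolding lefts_def basic_arc_iff by blast

lemma lefts_arc: "a \<in> lefts t \<Longrightarrow> basic_arc s a = {x \<in> X. lvalid a x}"
  unfolding lefts_def by (intro basic_arc_eq) auto

lemma lefts_tail:
  assumes "0 < t" "t < 1" "a \<in> lefts t" shows "\<exists>N. \<forall>i\<ge>N. a i = L i"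
proof -
  have "lvalid a (g t)" using assms(3) basic_arcD unfolding lefts_def by blast
  then obtain N1 where N1: "\<forall>n\<ge>N1. a n = arc_tail g n" using lvalid_arc_tail[OF g assms(1,2)] by blast
  obtain N2 where N2: "\<forall>n\<ge>N2. L n = arc_tail g n" using g_tail by blast
  show ?thesis using N1 N2 by (intro exI[of _ "max N1 N2"]) auto
qed

lemma phi_cont: "continuous_on X \<phi>" using homeo by (simp add: homeomorphism_def)

lemma null_sequence:
  assumes "\<And>j. 0 < t j" "\<And>j. t j < 1 / real (Suc j)"
  shows "t \<longlonglongrightarrow> 0" "t j < 1"
proof -
  show "t \<longlonglongrightarrow> 0"
    by (rule tendsto_sandwich[OF _ _ tendsto_const LIMSEQ_inverse_real_of_nat])
      (use assms in \<open>auto intro!: eventually_sequentiallyI less_imp_le simp: inverse_eq_divide\<close>)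
  have "1 / real (Suc j) \<le> 1" by simp
  then show "t j < 1" using assms(2)[of j] by linarith
qed

text \<open>Otherwise points of basic arcs passed at parameters tending to 0 have images far from
  \<open>p\<close>. A limit of these points shares left symbols with \<open>g 0\<close>, hence is
  \<open>g 0\<close>, and continuity of \<phi> gives a contradiction.\<close>

lemma segments_near_end:
  assumes "0 < \<eta>"
  shows "\<exists>T>0. T \<le> 1 \<and> (\<forall>t a w. 0 < t \<longrightarrow> t < T \<longrightarrow> a \<in> lefts t \<longrightarrow> w \<in> basic_arc s a \<longrightarrow>
    dist (F (w 0, psi L a)) p < \<eta>)"
proof (rule ccontr)
  assume neg: "\<not> ?thesis"
  have "\<exists>t a w. 0 < t \<and> t < 1 / real (Suc j) \<and> a \<in> lefts t \<and> w \<in> basic_arc s a \<and>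
      \<not> dist (F (w 0, psi L a)) p < \<eta>" for j
  proof (rule ccontr)
    assume "\<not> ?thesis"
    moreover have "0 < 1 / real (Suc j)" "1 / real (Suc j) \<le> 1" by simp_all
    ultimately show False using neg by blast
  qed
  then obtain t a w where taw: "\<And>j. 0 < t j" "\<And>j. t j < 1 / real (Suc j)" "\<And>j. a j \<in> lefts (t j)"
    "\<And>j. w j \<in> basic_arc s (a j)" "\<And>j. \<not> dist (F (w j 0, psi L (a j))) p < \<eta>"
    by metis
  have "\<exists>v. v \<in> basic_arc s (a j) \<and> F (w j 0, psi L (a j)) = \<phi> v" for j
    using placement(1)[OF lefts_adm[OF taw(3)[of j]]] taw(4)[of j] unfolding segment_def by blast
  then obtain v where v: "\<And>j. v j \<in> basic_arc s (a j)" "\<And>j. F (w j 0, psi L (a j)) = \<phi> (v j)" by metis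
  have vX: "v j \<in> X" for j using v(1) basic_arcD by blast
  obtain v0 \<rho> where v0: "v0 \<in> X" "strict_mono \<rho>" "(v \<circ> \<rho>) \<longlonglongrightarrow> v0"
    using compact_imp_seq_compact[OF compact_X] vX unfolding seq_compact_def by metis
  note t0 = null_sequence(1)[OF taw(1,2)]
  note t1 = null_sequence(2)[OF taw(1,2)]
  have "(\<lambda>j. g (t j)) \<longlonglongrightarrow> g 0" using t0 taw(1) t1 by (intro g_tendsto) auto
  then have "((\<lambda>j. g (t j)) \<circ> \<rho>) \<longlonglongrightarrow> g 0" using v0(2) by (rule LIMSEQ_subseq_LIMSEQ)
  then have "\<exists>b. lvalid b (g 0) \<and> lvalid b v0"
  proof (rule common_symbols_limit[OF _ v0(3)])
    fix j show "\<exists>b. lvalid b (((\<lambda>j. g (t j)) \<circ> \<rho>) j) \<and> lvalid b ((v \<circ> \<rho>) j)"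
      using taw(3)[of "\<rho> j"] v(1)[of "\<rho> j"] basic_arcD unfolding lefts_def comp_def by blast
  qed
  then have "v0 = g 0" using end_degenerate v0(1) by blast
  have "(\<lambda>j. \<phi> ((v \<circ> \<rho>) j)) \<longlonglongrightarrow> \<phi> v0"
    by (rule continuous_on_tendsto_compose[OF phi_cont v0(3,1)]) (simp add: vX)
  then have "(\<lambda>j. dist (\<phi> ((v \<circ> \<rho>) j)) p) \<longlonglongrightarrow> dist (\<phi> v0) p" by (intro tendsto_intros)
  then have "\<eta> \<le> dist (\<phi> v0) p"
    by (rule LIMSEQ_le_const) (use taw(5) v(2) in \<open>auto simp: not_less intro!: exI[of _ 0]\<close>)
  then show False using \<open>v0 = g 0\<close> assms by simp
qed

lemma psi_range: "psi L a \<in> {0..1}"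
proof -
  have "\<bar>psi L a - 1/2\<bar> \<le> 1/2" using psi_ctr[of L a 0] by (simp add: ctr_def gap_def)
  then show ?thesis unfolding atLeastAtMost_iff by linarith
qed

lemma arch_range:
  assumes "z \<in> arch L n a (psi L a - ctr L n a)" shows "z \<in> {- 1..2} \<times> {- 1..2}"
proof -
  obtain u v where uv: "z = (u, v)" by fastforce
  have "0 \<le> crit_pos n \<and> crit_pos n \<le> 1"
    unfolding crit_pos_def using s_pos s_le_2 by (intro tent_pow_range) auto
  moreover have "\<bar>psi L a - ctr L n a\<bar> \<le> 1/2" 
  proof -
    have "gap 0 = 1/2" by (simp add: gap_def)
    then show ?thesis using psi_ctr[of L a n] gap_mono[of 0 n] by simp
  qed
  moreover have "0 \<le> psi L a \<and> psi L a \<le> 1" using psi_range[of a] by simp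
  moreover note arch_height[OF assms[unfolded uv]] arch_width[OF assms[unfolded uv]]
  ultimately have "- 1 \<le> u \<and> u \<le> 2" "- 1 \<le> v \<and> v \<le> 2" by (intro conjI; linarith)+
  then show ?thesis unfolding uv by simp
qed

text \<open>The ends of the semicircles are under control by \<open>segments_near_end\<close>. If
  the radii tend to 0, the other points follow; otherwise some level recurs, and
  \<open>fibre_arch\<close> shows that the limit semicircle is mapped to \<open>p\<close> as a
  whole.\<close>

lemma arches_near_end:
  assumes "0 < \<eta>"
  shows "\<exists>T>0. T \<le> 1 \<and> (\<forall>t n a b z. 0 < t \<longrightarrow> t < T \<longrightarrow> joined n a b (g t) \<longrightarrow> a \<in> lefts t \<longrightarrow> b \<in> lefts t \<longrightarrow>
    z \<in> arch L n a (psi L a - ctr L n a) \<longrightarrow> dist (F z) p < \<eta>)"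
proof (rule ccontr)
  assume neg: "\<not> ?thesis"
  have "\<exists>t n a b z. 0 < t \<and> t < 1 / real (Suc j) \<and> joined n a b (g t) \<and> a \<in> lefts t \<and> b \<in> lefts t \<and>
      z \<in> arch L n a (psi L a - ctr L n a) \<and> \<not> dist (F z) p < \<eta>" for j
  proof (rule ccontr)
    assume "\<not> ?thesis"
    moreover have "0 < 1 / real (Suc j)" "1 / real (Suc j) \<le> 1" by simp_all
    ultimately show False using neg by blast
  qed
  then obtain t n a b z where c: "\<And>j. 0 < t j" "\<And>j. t j < 1 / real (Suc j)" "\<And>j. joined (n j) (a j) (b j) (g (t j))"
    "\<And>j. a j \<in> lefts (t j)" "\<And>j. b j \<in> lefts (t j)" "\<And>j. z j \<in> arch L (n j) (a j) (psi L (a j) - ctr L (n j) (a j))"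
    "\<And>j. \<not> dist (F (z j)) p < \<eta>"
    by metis
  note t1 = null_sequence(2)[OF c(1,2)]
  note t0 = null_sequence(1)[OF c(1,2)]
  have Fe: "(\<lambda>j. F (g (t j) 0, psi L (d j))) \<longlonglongrightarrow> p" if d: "\<And>j. d j \<in> lefts (t j)" for d
  proof (rule tendstoI)
    fix e :: real assume "0 < e"
    from segments_near_end[OF this] obtain T where T: "0 < T" "\<And>t a w. 0 < t \<Longrightarrow> t < T \<Longrightarrow> a \<in> lefts t \<Longrightarrow> w \<in> basic_arc s a \<Longrightarrow>
      dist (F (w 0, psi L a)) p < e" by blast
    from order_tendstoD(2)[OF t0 T(1)] show "\<forall>\<^sub>F j in sequentially. dist (F (g (t j) 0, psi L (d j))) p < e"
    proof eventually_elim
      case (elim j)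
      show ?case by (rule T(2)[OF c(1) elim d]) (use d in \<open>simp add: lefts_def\<close>)
    qed
  qed
  let ?C = "({- 1..2} \<times> {- 1..2}) \<times> ({0..1} \<times> {0..1}) :: ((real \<times> real) \<times> (real \<times> real)) set"
  define Y where "Y j = (z j, (psi L (a j), psi L (b j)))" for j
  have "compact ?C" by (intro compact_Times compact_Icc)
  moreover have "Y j \<in> ?C" for j unfolding Y_def using arch_range[OF c(6)] psi_range by blast
  ultimately obtain Z \<rho> where Z: "strict_mono \<rho>" "(Y \<circ> \<rho>) \<longlonglongrightarrow> Z"
    using compact_imp_seq_compact unfolding seq_compact_def by metis
  obtain z0 y y' where zy: "Z = (z0, (y, y'))" by (metis surj_pair)
  have lim: "(\<lambda>j. z (\<rho> j)) \<longlonglongrightarrow> z0" "(\<lambda>j. psi L (a (\<rho> j))) \<longlonglongrightarrow> y" "(\<lambda>j. psi L (b (\<rho> j))) \<longlonglongrightarrow> y'"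
    using tendsto_fst[OF Z(2)] tendsto_fst[OF tendsto_snd[OF Z(2)]] tendsto_snd[OF tendsto_snd[OF Z(2)]]
    by (simp_all add: Y_def zy comp_def)
  have gl: "(\<lambda>j. g (t j) 0) \<longlonglongrightarrow> g 0 0"
    by (intro coord_tendsto g_tendsto t0) (use c(1) t1 in auto)
  have gl: "(\<lambda>j. g (t (\<rho> j)) 0) \<longlonglongrightarrow> g 0 0"
    using LIMSEQ_subseq_LIMSEQ[OF gl Z(1)] by (simp add: comp_def)
  have Fc: "(\<lambda>j. F (f j)) \<longlonglongrightarrow> F l" if "f \<longlonglongrightarrow> l" for f l
    using continuous_on_tendsto_compose[OF F_cont[of UNIV] that] by simp
  have Fends: "F (g 0 0, y) = p" "F (g 0 0, y') = p"
    using LIMSEQ_unique[OF Fc[OF tendsto_Pair[OF gl lim(2)]]] LIMSEQ_unique[OF Fc[OF tendsto_Pair[OF gl lim(3)]]]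
      LIMSEQ_subseq_LIMSEQ[OF Fe[OF c(4)] Z(1)] LIMSEQ_subseq_LIMSEQ[OF Fe[OF c(5)] Z(1)] by (auto simp: comp_def)
  have "(\<lambda>j. dist (F (z (\<rho> j))) p) \<longlonglongrightarrow> dist (F z0) p" by (intro tendsto_intros Fc lim)
  then have far: "\<eta> \<le> dist (F z0) p"
    by (rule LIMSEQ_le_const) (use c(7) in \<open>auto simp: not_less\<close>)
  note r = joined_psi[OF c(3)]
  have crit: "g (t j) 0 = crit_pos (n j)" for j using joined_props(6)[OF c(3)] .
  let ?r = "\<lambda>j. (psi L (a (\<rho> j)) - psi L (b (\<rho> j))) / 2" and ?e = "\<lambda>j. dist (z (\<rho> j)) (g (t (\<rho> j)) 0, psi L (a (\<rho> j)))"
  have rl: "(\<lambda>j. ?r j) \<longlonglongrightarrow> (y - y') / 2" by (intro tendsto_intros lim) simp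
  show False
  proof (cases "y = y'")
    case True
    have "(\<lambda>j. ?e j) \<longlonglongrightarrow> 0"
    proof (rule tendsto_sandwich[OF _ _ tendsto_const])
      \<comment> \<open>A point of the semicircle differs from its end by at most one radius
        horizontally and two vertically.\<close>
      show "(\<lambda>j. 3 * \<bar>?r j\<bar>) \<longlonglongrightarrow> 0"
        using tendsto_mult[OF tendsto_const[of 3] tendsto_rabs[OF rl]] True by simp
      show "\<forall>\<^sub>F j in sequentially. ?e j
          \<le> 3 * \<bar>?r j\<bar>"
      proof (rule always_eventually, rule allI)
        fix j
        obtain u v where uv: "z (\<rho> j) = (u, v)" by fastforce
        have "?e j \<le> \<bar>u - g (t (\<rho> j)) 0\<bar> + \<bar>v - psi L (a (\<rho> j))\<bar>"
          unfolding uv dist_Pair_Pair dist_real_def using sqrt_sum_squares_le_sum_abs by simp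
        moreover have "\<bar>v - psi L (a (\<rho> j))\<bar> \<le> \<bar>v - ctr L (n (\<rho> j)) (a (\<rho> j))\<bar> + \<bar>psi L (a (\<rho> j)) - ctr L (n (\<rho> j)) (a (\<rho> j))\<bar>"
          by linarith
        ultimately show "?e j \<le> 3 * \<bar>?r j\<bar>"
          using arch_height[OF c(6)[of "\<rho> j", unfolded uv]] arch_width[OF c(6)[of "\<rho> j", unfolded uv]]
          unfolding r(3)[of L] crit by linarith
      qed
    qed simp
    moreover have "(\<lambda>j. ?e j) \<longlonglongrightarrow> dist z0 (g 0 0, y)"
      by (intro tendsto_intros lim gl)
    ultimately have "z0 = (g 0 0, y)" using LIMSEQ_unique by fastforce
    then show False using Fends(1) far assms by simp
  next
    case False
    \<comment> \<open>Half of the limiting radius. As a semicircle of level \<open>n\<close> has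
      radius at most \<open>gap n\<close>, radii above \<open>k\<close> leave only finitely many
      levels.\<close>
    define k where "k = \<bar>y - y'\<bar> / 4"
    have k: "0 < k" "k < \<bar>(y - y') / 2\<bar>" using False by (auto simp: k_def)
    obtain J where J: "\<And>j. j \<ge> J \<Longrightarrow> k < \<bar>?r j\<bar>"
      using order_tendstoD(1)[OF tendsto_rabs[OF rl] k(2)] unfolding eventually_sequentially by blast
    obtain M where M: "\<And>m. m \<ge> M \<Longrightarrow> gap m < k"
      using order_tendstoD(2)[OF gap_lim k(1)] unfolding eventually_sequentially by blast
    have nM: "n (\<rho> j) < M" if "j \<ge> J" for j
      using J[OF that] psi_ctr[of L "a (\<rho> j)" "n (\<rho> j)"] M[of "n (\<rho> j)"] unfolding r(3) by force
    have "(\<lambda>j. n (\<rho> j)) ` {J..} \<subseteq> {..<M}" using nM by auto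
    then have "finite ((\<lambda>j. n (\<rho> j)) ` {J..})" by (rule finite_subset) simp
    then obtain j0 where j0: "infinite {j \<in> {J..}. n (\<rho> j) = n (\<rho> j0)}"
      using pigeonhole_infinite[of "{J..}" "\<lambda>j. n (\<rho> j)"] by (metis infinite_Ici)
    then obtain q :: "nat \<Rightarrow> nat" where q: "strict_mono q" "\<And>j. q j \<in> {j \<in> {J..}. n (\<rho> j) = n (\<rho> j0)}"
      using infinite_enumerate by blast
    define m where "m = n (\<rho> j0)"
    have nq: "n (\<rho> (q j)) = m" for j using q(2) by (simp add: m_def)
    have sub: "(\<lambda>j. f (q j)) \<longlonglongrightarrow> l" if "f \<longlonglongrightarrow> l" for f and l :: "'z::topological_space"
      using LIMSEQ_subseq_LIMSEQ[OF that q(1)] by (simp add: comp_def)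
    have km: "kmatch m (a (\<rho> (q j)))" for j using joined_props(4)[OF c(3)[of "\<rho> (q j)"]] nq by simp
    define h where "h = ctr L m (a (\<rho> (q 0)))"
    have hq: "ctr L m (a (\<rho> (q j))) = h" for j unfolding h_def by (rule kmatch_ctr[OF km km])
    have g0: "g 0 0 = crit_pos m"
      using LIMSEQ_unique[OF sub[OF gl]] crit nq by simp
    have mid: "(y + y') / 2 = h"
    proof -
      have "(\<lambda>j. (psi L (a (\<rho> (q j))) + psi L (b (\<rho> (q j)))) / 2) \<longlonglongrightarrow> (y + y') / 2"
        by (intro tendsto_intros sub[OF lim(2)] sub[OF lim(3)]) simp
      then show ?thesis using LIMSEQ_unique unfolding r(2) nq hq by blast
    qed
    obtain u v where uv: "z0 = (u, v)" by fastforce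
    have zl: "(\<lambda>j. fst (z (\<rho> (q j)))) \<longlonglongrightarrow> u" "(\<lambda>j. snd (z (\<rho> (q j)))) \<longlonglongrightarrow> v"
      using tendsto_fst[OF sub[OF lim(1)]] tendsto_snd[OF sub[OF lim(1)]] by (simp_all add: uv)
    have zq: "0 \<le> orient m * (fst (z (\<rho> (q j))) - crit_pos m)"
      "(fst (z (\<rho> (q j))) - crit_pos m)\<^sup>2 + (snd (z (\<rho> (q j))) - h)\<^sup>2 = (psi L (a (\<rho> (q j))) - h)\<^sup>2" for j
      using c(6)[of "\<rho> (q j)"] unfolding arch_def nq hq by (auto simp: case_prod_unfold)
    have "(\<lambda>j. orient m * (fst (z (\<rho> (q j))) - crit_pos m)) \<longlonglongrightarrow> orient m * (u - crit_pos m)"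
      by (intro tendsto_intros zl)
    then have "0 \<le> orient m * (u - crit_pos m)" by (rule LIMSEQ_le_const) (use zq(1) in blast)
    moreover have "(u - crit_pos m)\<^sup>2 + (v - h)\<^sup>2 = (y - h)\<^sup>2"
    proof (rule LIMSEQ_unique)
      show "(\<lambda>j. (fst (z (\<rho> (q j))) - crit_pos m)\<^sup>2 + (snd (z (\<rho> (q j))) - h)\<^sup>2) \<longlonglongrightarrow> (u - crit_pos m)\<^sup>2 + (v - h)\<^sup>2"
        by (intro tendsto_intros zl)
      show "(\<lambda>j. (fst (z (\<rho> (q j))) - crit_pos m)\<^sup>2 + (snd (z (\<rho> (q j))) - h)\<^sup>2) \<longlonglongrightarrow> (y - h)\<^sup>2"
        unfolding zq(2) by (intro tendsto_intros sub[OF lim(2)])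
    qed
    ultimately have "z0 \<in> arch L m (a (\<rho> (q 0))) (y - ctr L m (a (\<rho> (q 0))))"
      unfolding arch_def uv h_def[symmetric] by simp
    then have "F z0 = p"
      using fibre_arch[of m y p y' "a (\<rho> (q 0))" z0] Fends False mid km unfolding g0 h_def by blast
    then show False using far assms by simp
  qed
qed

text \<open>\<open>gate a u d\<close> lies at distance \<open>d\<close> from the segment of \<open>a\<close>, on the side that \<open>strip_off_drawing\<close>
  shows to be free: the sign \<open>flip L a n\<close> is eventually constant.\<close>

definition gate where "gate a u d = (u, psi L a + lim (\<lambda>n. flip L a n) * d)"

section \<open>Paths off the drawing near the end\<close>

definition outside where "outside \<eta> = {q. q \<notin> D \<and> F q \<in> ball p \<eta>}"

definition linked where
  "linked \<eta> a b \<longleftrightarrow> (\<exists>\<delta>>0. \<forall>w\<in>basic_arc s a. \<forall>w'\<in>basic_arc s b. \<forall>d d'.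
     0 < d \<and> d < \<delta> \<and> 0 < d' \<and> d' < \<delta> \<longrightarrow> path_component (outside \<eta>) (gate a (w 0) d) (gate b (w' 0) d'))"

lemma linked_sym: "linked \<eta> a b \<Longrightarrow> linked \<eta> b a"
  unfolding linked_def by (meson path_component_sym)

lemma linked_trans:
  assumes "linked \<eta> a b" "linked \<eta> b c" "basic_arc s b \<noteq> {}" shows "linked \<eta> a c"
proof -
  obtain \<delta>1 where 1: "0 < \<delta>1" "\<And>w w' d d'. w \<in> basic_arc s a \<Longrightarrow> w' \<in> basic_arc s b \<Longrightarrow> 0 < d \<and> d < \<delta>1 \<and> 0 < d' \<and> d' < \<delta>1 \<Longrightarrow>
    path_component (outside \<eta>) (gate a (w 0) d) (gate b (w' 0) d')" using assms(1) unfolding linked_def by blast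
  obtain \<delta>2 where 2: "0 < \<delta>2" "\<And>w w' d d'. w \<in> basic_arc s b \<Longrightarrow> w' \<in> basic_arc s c \<Longrightarrow> 0 < d \<and> d < \<delta>2 \<and> 0 < d' \<and> d' < \<delta>2 \<Longrightarrow>
    path_component (outside \<eta>) (gate b (w 0) d) (gate c (w' 0) d')" using assms(2) unfolding linked_def by blast
  obtain v where v: "v \<in> basic_arc s b" using assms(3) by blast
  show ?thesis unfolding linked_def
  proof (intro exI[of _ "min \<delta>1 \<delta>2"] conjI ballI allI impI)
    fix w w' d d' assume h: "w \<in> basic_arc s a" "w' \<in> basic_arc s c" "0 < d \<and> d < min \<delta>1 \<delta>2 \<and> 0 < d' \<and> d' < min \<delta>1 \<delta>2"
    define e where "e = min \<delta>1 \<delta>2 / 2"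
    have e: "0 < e" "e < \<delta>1" "e < \<delta>2" using 1(1) 2(1) by (auto simp: e_def min_def)
    have "path_component (outside \<eta>) (gate a (w 0) d) (gate b (v 0) e)"
      by (rule 1(2)[OF h(1) v]) (use h(3) e in simp)
    moreover have "path_component (outside \<eta>) (gate b (v 0) e) (gate c (w' 0) d')"
      by (rule 2(2)[OF v h(2)]) (use h(3) e in simp)
    ultimately show "path_component (outside \<eta>) (gate a (w 0) d) (gate c (w' 0) d')"
      by (rule path_component_trans)
  qed (use 1(1) 2(1) in auto)
qed

text \<open>\<open>A\<close> need not be closed. The bound with \<eta>/2 survives in its closure,
  where compactness provides a uniform distance.\<close>

lemma near_compact:
  assumes "bounded A" "0 < \<eta>" "\<And>z. z \<in> A \<Longrightarrow> dist (F z) p < \<eta> / 2"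
  obtains \<epsilon> where "0 < \<epsilon>" "\<And>z q. z \<in> A \<Longrightarrow> dist z q < \<epsilon> \<Longrightarrow> F q \<in> ball p \<eta>"
proof -
  have "closed (F -` cball p (\<eta> / 2))" using F_cont[of UNIV] closed_vimage[OF closed_cball] by blast
  moreover have "A \<subseteq> F -` cball p (\<eta> / 2)"
    using assms(3) by (meson dist_commute_lessI less_imp_le mem_cball subsetI vimageI2)
  ultimately have "closure A \<subseteq> F -` cball p (\<eta> / 2)" by (rule closure_minimal[rotated])
  moreover have "cball p (\<eta> / 2) \<subseteq> ball p \<eta>" using assms(2) by (intro subsetI) simp
  ultimately have "closure A \<subseteq> F -` ball p \<eta>" by blast
  moreover have "open (F -` ball p \<eta>)" using F_cont[of UNIV] open_vimage[OF open_ball] by blast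
  moreover have "compact (closure A)" using assms(1) by (simp add: compact_closure)
  ultimately obtain \<epsilon> where e: "0 < \<epsilon>" "(\<Union>x\<in>closure A. ball x \<epsilon>) \<subseteq> F -` ball p \<eta>"
    using compact_subset_open_imp_ball_epsilon_subset by metis
  have "F q \<in> ball p \<eta>" if "z \<in> A" "dist z q < \<epsilon>" for z q
    using e(2) that closure_subset[of A] by (meson UN_I mem_ball subsetD vimageD)
  then show thesis using that e(1) by blast
qed

text \<open>By convexity of the basic arc the strip beside its segment is convex, so gates are
  joined by straight lines.\<close>

lemma linked_refl:
  assumes t: "0 < t" "t < 1" "a \<in> lefts t" and "0 < \<eta>"
    and near: "\<And>w. w \<in> basic_arc s a \<Longrightarrow> dist (F (w 0, psi L a)) p < \<eta> / 2"
  shows "linked \<eta> a a"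
proof -
  obtain N where N: "\<forall>i\<ge>N. a i = L i" using lefts_tail[OF t] by blast
  note lim = flip_limit[OF N]
  note arc = lefts_arc[OF t(3)]
  let ?A = "(\<lambda>w. (w 0, psi L a)) ` basic_arc s a"
  have "w 0 \<in> {0..1}" if "w \<in> basic_arc s a" for w using X_range[of w 0] basic_arcD[OF that] by simp
  then have "?A \<subseteq> {0..1} \<times> {psi L a}" by blast
  then have "bounded ?A" by (rule bounded_subset[rotated]) (intro bounded_Times bounded_closed_interval, simp)
  then obtain \<epsilon> where \<epsilon>: "0 < \<epsilon>" "\<And>z q. z \<in> ?A \<Longrightarrow> dist z q < \<epsilon> \<Longrightarrow> F q \<in> ball p \<eta>"
    using near_compact[OF _ assms(4), of ?A] near by blast
  have out: "gate a (w 0) d \<in> outside \<eta>" if w: "w \<in> basic_arc s a" and d: "0 < d" "d < min \<epsilon> (gap N)" for w d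
  proof -
    have "w \<in> X" "lvalid a w" using basic_arcD[OF w] by auto
    then have "gate a (w 0) d \<notin> D" using d unfolding gate_def lim by (intro strip_off_drawing[OF N]) auto
    moreover have "dist (w 0, psi L a) (gate a (w 0) d) = d"
      using flip_cases[of L a N] d by (auto simp: gate_def lim dist_Pair_Pair dist_real_def)
    then have "F (gate a (w 0) d) \<in> ball p \<eta>" using \<epsilon>(2)[of "(w 0, psi L a)"] w d by auto
    ultimately show ?thesis by (simp add: outside_def)
  qed
  show ?thesis unfolding linked_def
  proof (intro exI[of _ "min \<epsilon> (gap N)"] conjI ballI allI impI)
    fix w w' d d' assume w: "w \<in> basic_arc s a" "w' \<in> basic_arc s a"
      and d: "0 < d \<and> d < min \<epsilon> (gap N) \<and> 0 < d' \<and> d' < min \<epsilon> (gap N)"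
    define k where "k \<theta> = gate a ((1 - \<theta>) * w 0 + \<theta> * w' 0) ((1 - \<theta>) * d + \<theta> * d')" for \<theta> :: real
    have "path k" unfolding path_def k_def gate_def by (intro continuous_intros)
    moreover have "k \<theta> \<in> outside \<eta>" if \<theta>: "\<theta> \<in> {0..1}" for \<theta>
    proof -
      note wX = basic_arcD[OF w(1)] basic_arcD[OF w(2)]
      have "seg_between w w' \<theta> \<in> basic_arc s a"
        unfolding arc using seg_between(1,2)[of w a w' \<theta>] wX \<theta> by simp
      moreover have "0 < (1 - \<theta>) * d + \<theta> * d' \<and> (1 - \<theta>) * d + \<theta> * d' < min \<epsilon> (gap N)"
      proof -
        define m where "m = min \<epsilon> (gap N)"
        have "(1 - \<theta>) *\<^sub>R d + \<theta> *\<^sub>R d' \<in> {0<..<m}"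
          by (rule convexD_alt[OF convex_real_interval(8)]) (use d \<theta> in \<open>simp_all add: m_def\<close>)
        then show ?thesis unfolding m_def[symmetric] by simp
      qed
      ultimately have "gate a (seg_between w w' \<theta> 0) ((1 - \<theta>) * d + \<theta> * d') \<in> outside \<eta>"
        by (intro out) auto
      then show ?thesis by (simp only: k_def seg_between_def)
    qed
    ultimately show "path_component (outside \<eta>) (gate a (w 0) d) (gate a (w' 0) d')"
      unfolding path_component_def
      by (intro exI[of _ k]) (auto simp: path_image_def pathstart_def pathfinish_def k_def)
  qed (use \<epsilon>(1) gap_pos in auto)
qed

text \<open>The signs of \<open>a\<close> and \<open>b\<close> beyond level \<open>n\<close> are
  opposite, so one concentric arch of radius \<open>r + f * d\<close> ends at the gates of height
  \<open>d\<close> over both arcs.\<close>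

lemma linked_joined:
  assumes t: "0 < t" "t < 1" "a \<in> lefts t" "b \<in> lefts t" and j: "joined n a b (g t)" and \<eta>: "0 < \<eta>"
    and near: "\<And>c w. c \<in> lefts t \<Longrightarrow> w \<in> basic_arc s c \<Longrightarrow> dist (F (w 0, psi L c)) p < \<eta> / 2"
    and near_arch: "\<And>z. z \<in> arch L n a (psi L a - ctr L n a) \<Longrightarrow> dist (F z) p < \<eta> / 2"
  shows "linked \<eta> a b"
proof -
  obtain N1 where N1: "\<forall>i\<ge>N1. a i = L i" using lefts_tail[OF t(1-3)] by blast
  obtain N2 where N2: "\<forall>i\<ge>N2. b i = L i" using lefts_tail[OF t(1,2,4)] by blast
  define N where "N = max (Suc n) (max N1 N2)"
  have Na: "\<forall>i\<ge>N. a i = L i" and Nb: "\<forall>i\<ge>N. b i = L i" and nN: "Suc n \<le> N"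
    using N1 N2 by (auto simp: N_def)
  define r where "r = psi L a - ctr L n a"
  define f where "f = flip L a N"
  have fb: "flip L b N = - f" unfolding f_def using joined_flip[OF j] nN by simp
  have f1: "f = 1 \<or> f = - 1" unfolding f_def by (rule flip_cases)
  have rg: "gap N \<le> \<bar>r\<bar>"
    using psi_upper[of n L a] flip_cases[of L a "Suc n"] gap_mono[OF nN] unfolding r_def by auto
  then have r0: "r \<noteq> 0" using gap_pos[of N] by auto
  have "bounded (arch L n a r)"
    using arch_range unfolding r_def
    by (intro bounded_subset[OF bounded_Times[OF bounded_closed_interval bounded_closed_interval]]) blast
  then obtain \<epsilon> where \<epsilon>: "0 < \<epsilon>" "\<And>z q. z \<in> arch L n a r \<Longrightarrow> dist z q < \<epsilon> \<Longrightarrow> F q \<in> ball p \<eta>"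
    using near_compact[OF _ \<eta>, of "arch L n a r"] near_arch unfolding r_def by blast
  have out: "(u, v) \<in> outside \<eta>" if uv: "(u, v) \<in> arch L n a (r + f * d)" and d: "0 < d" "d < min \<epsilon> (gap N)" for u v d
  proof -
    have "psi L a + flip L a N * d - ctr L n a = r + f * d" by (simp add: r_def f_def)
    then have "(u, v) \<notin> D" using arch_off_drawing[OF j Na nN, of d u v] uv d by simp
    define \<rho> where "\<rho> = r + f * d"
    have ratio: "0 < r / \<rho>"
    proof -
      have "\<bar>f * d\<bar> < \<bar>r\<bar>" using f1 d rg by auto
      then have "0 < r * \<rho>" unfolding \<rho>_def using r0
        by (cases "0 < r") (auto intro!: mult_pos_pos mult_neg_neg)
      then show ?thesis by (simp add: zero_less_divide_iff zero_less_mult_iff)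
    qed
    then have \<rho>0: "\<rho> \<noteq> 0" by auto
    \<comment> \<open>Radial projection back to the drawn semicircle, which moves the point by
      exactly \<open>d\<close>.\<close>
    define k where "k = r / \<rho>"
    let ?c = "crit_pos n" and ?h = "ctr L n a"
    define z where "z = (?c + k * (u - ?c), ?h + k * (v - ?h))"
    have uv2: "0 \<le> orient n * (u - ?c)" "(u - ?c)\<^sup>2 + (v - ?h)\<^sup>2 = \<rho>\<^sup>2"
      using uv by (auto simp: arch_def \<rho>_def)
    have "0 \<le> k" using ratio by (simp add: k_def)
    then have "0 \<le> k * (orient n * (u - ?c))" using uv2(1) by (rule mult_nonneg_nonneg)
    moreover have "(k * (u - ?c))\<^sup>2 + (k * (v - ?h))\<^sup>2 = r\<^sup>2"
    proof -
      have "(k * (u - ?c))\<^sup>2 + (k * (v - ?h))\<^sup>2 = k\<^sup>2 * ((u - ?c)\<^sup>2 + (v - ?h)\<^sup>2)"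
        by (simp add: power_mult_distrib distrib_left)
      also have "\<dots> = (k * \<rho>)\<^sup>2" unfolding uv2(2) by (simp add: power_mult_distrib)
      also have "k * \<rho> = r" using \<rho>0 by (simp add: k_def)
      finally show ?thesis .
    qed
    ultimately have zA: "z \<in> arch L n a r" unfolding z_def arch_def by (simp add: mult.left_commute)
    have "dist z (u, v) = sqrt (((k - 1) * (u - ?c))\<^sup>2 + ((k - 1) * (v - ?h))\<^sup>2)"
      unfolding z_def dist_Pair_Pair dist_real_def power2_abs by (simp add: algebra_simps)
    also have "((k - 1) * (u - ?c))\<^sup>2 + ((k - 1) * (v - ?h))\<^sup>2 = (k - 1)\<^sup>2 * ((u - ?c)\<^sup>2 + (v - ?h)\<^sup>2)"
      by (simp add: power_mult_distrib distrib_left)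
    also have "\<dots> = ((k - 1) * \<rho>)\<^sup>2" unfolding uv2(2) by (simp add: power_mult_distrib)
    also have "(k - 1) * \<rho> = - (f * d)" using \<rho>0 by (simp add: k_def left_diff_distrib \<rho>_def)
    also have "sqrt ((- (f * d))\<^sup>2) = d" using f1 d by auto
    finally have "F (u, v) \<in> ball p \<eta>" using \<epsilon>(2)[OF zA] d by simp
    then show ?thesis using \<open>(u, v) \<notin> D\<close> by (simp add: outside_def)
  qed
  have across: "path_component (outside \<eta>) (gate a (g t 0) d) (gate b (g t 0) d)"
    if d: "0 < d" "d < min \<epsilon> (gap N)" for d
  proof -
    define \<rho> where "\<rho> = r + f * d"
    \<comment> \<open>The angle runs from pi/2 to -pi/2. The signed \<rho> in the second component
      starts the arch at the gate of \<open>a\<close>, above or below the centre;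
      \<open>orient n\<close> selects the open side.\<close>
    define k where "k \<theta> = (crit_pos n + orient n * \<bar>\<rho>\<bar> * cos (pi / 2 - pi * \<theta>), ctr L n a + \<rho> * sin (pi / 2 - pi * \<theta>))" for \<theta>
    have "path k" unfolding path_def k_def by (intro continuous_intros)
    moreover have "k \<theta> \<in> outside \<eta>" if \<theta>: "\<theta> \<in> {0..1}" for \<theta>
      unfolding k_def
    proof (rule out[OF _ d], unfold arch_def \<rho>_def[symmetric], clarsimp, intro conjI)
      let ?x = "pi / 2 - pi * \<theta>"
      have "0 \<le> pi * \<theta>" "pi * \<theta> \<le> pi * 1" using \<theta> by (auto intro!: mult_left_mono)
      then have "0 \<le> cos ?x" by (intro cos_ge_zero) auto
      moreover have "orient n * orient n = 1" using orient_cases[of n] by auto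
      ultimately show "0 \<le> orient n * (orient n * \<bar>\<rho>\<bar> * cos ?x)"
        by (simp add: mult.assoc[symmetric])
      have "(orient n * \<bar>\<rho>\<bar> * cos ?x)\<^sup>2 + (\<rho> * sin ?x)\<^sup>2 = \<rho>\<^sup>2 * (cos ?x)\<^sup>2 + \<rho>\<^sup>2 * (sin ?x)\<^sup>2"
        using orient_cases[of n] by (auto simp: power_mult_distrib)
      also have "\<dots> = \<rho>\<^sup>2" by (simp only: distrib_left[symmetric] sin_cos_squared_add2 mult_1_right)
      finally show "(orient n * \<bar>\<rho>\<bar> * cos ?x)\<^sup>2 + (\<rho> * sin ?x)\<^sup>2 = \<rho>\<^sup>2" .
    qed
    moreover have "k 0 = gate a (g t 0) d"
      using joined_props(6)[OF j] by (simp add: k_def gate_def flip_limit[OF Na] \<rho>_def r_def f_def)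
    moreover have "k 1 = gate b (g t 0) d"
    proof -
      have "pi / 2 - pi * 1 = - (pi / 2)" by simp
      then have "k 1 = (crit_pos n, ctr L n a - \<rho>)" unfolding k_def by (simp only: cos_minus sin_minus cos_pi_half sin_pi_half) simp
      then show ?thesis
        using joined_props(6)[OF j] joined_psi(1)[OF j, of L] by (simp add: gate_def flip_limit[OF Nb] fb \<rho>_def r_def)
    qed
    ultimately show ?thesis unfolding path_component_def
      by (intro exI[of _ k]) (auto simp: path_image_def pathstart_def pathfinish_def)
  qed
  have gt: "g t \<in> basic_arc s a" "g t \<in> basic_arc s b" using t(3,4) by (auto simp: lefts_def)
  have "linked \<eta> a a" "linked \<eta> b b" using linked_refl t \<eta> near by blast+
  then obtain \<delta>1 \<delta>2 where 1: "0 < \<delta>1" "\<And>w w' d d'. w \<in> basic_arc s a \<Longrightarrow> w' \<in> basic_arc s a \<Longrightarrow> 0 < d \<and> d < \<delta>1 \<and> 0 < d' \<and> d' < \<delta>1 \<Longrightarrow>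
    path_component (outside \<eta>) (gate a (w 0) d) (gate a (w' 0) d')"
    and 2: "0 < \<delta>2" "\<And>w w' d d'. w \<in> basic_arc s b \<Longrightarrow> w' \<in> basic_arc s b \<Longrightarrow> 0 < d \<and> d < \<delta>2 \<and> 0 < d' \<and> d' < \<delta>2 \<Longrightarrow>
    path_component (outside \<eta>) (gate b (w 0) d) (gate b (w' 0) d')" unfolding linked_def by metis
  define \<delta> where "\<delta> = min (min \<delta>1 \<delta>2) (min \<epsilon> (gap N))"
  have \<delta>: "0 < \<delta>" "\<delta> \<le> \<delta>1" "\<delta> \<le> \<delta>2" "\<delta> \<le> min \<epsilon> (gap N)" using 1(1) 2(1) \<epsilon>(1) gap_pos[of N] by (auto simp: \<delta>_def)
  show ?thesis unfolding linked_def
  proof (intro exI[of _ \<delta>] conjI ballI allI impI)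
    fix w w' d d' assume h: "w \<in> basic_arc s a" "w' \<in> basic_arc s b" "0 < d \<and> d < \<delta> \<and> 0 < d' \<and> d' < \<delta>"
    have "path_component (outside \<eta>) (gate a (w 0) d) (gate a (g t 0) d)" by (rule 1(2)[OF h(1) gt(1)]) (use h(3) \<delta> in auto)
    moreover have "path_component (outside \<eta>) (gate a (g t 0) d) (gate b (g t 0) d)" by (rule across) (use h(3) \<delta> in auto)
    moreover have "path_component (outside \<eta>) (gate b (g t 0) d) (gate b (w' 0) d')" by (rule 2(2)[OF gt(2) h(2)]) (use h(3) \<delta> in auto)
    ultimately show "path_component (outside \<eta>) (gate a (w 0) d) (gate b (w' 0) d')" by (meson path_component_trans)
  qed (rule \<delta>(1))
qed

lemma lefts_cases:
  assumes "a \<in> lefts t" "b \<in> lefts t" "a \<noteq> b" shows "\<exists>n. joined n a b (g t)"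
proof -
  obtain \<sigma> \<tau> where r: "represents s \<sigma> (g t)" "left_part \<sigma> = a" "represents s \<tau> (g t)" "left_part \<tau> = b"
    using assms(1,2) unfolding lefts_def basic_arc_iff by blast
  then obtain k where k: "k < 0" "identified_at s k \<sigma> \<tau>" using represents_left_cases[OF r(1,3)] assms(3) by blast
  from identified_joined(2)[OF k(2,1) r(1,3)] show ?thesis unfolding r(2,4) by blast
qed

text \<open>Finitely many noncritical coordinates keep their side by continuity, and beyond
  \<open>N\<close> the sides are constant anyway. So a left part of a nearby point fits
  \<open>g t\<close> too, and that nearby point is the second one needed for
  \<open>lvalid_represents\<close>.\<close>

lemma lefts_near:
  assumes t: "0 < t" "t < 1"
  shows "\<exists>e>0. \<forall>t'. \<bar>t' - t\<bar> < e \<longrightarrow> lefts t' \<subseteq> lefts t"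
proof -
  define \<mu> where "\<mu> = min t (1 - t) / 2"
  have \<mu>: "0 < \<mu>" "2 * \<mu> \<le> t" "2 * \<mu> \<le> 1 - t" using t by (simp_all add: \<mu>_def)
  obtain N where N: "\<And>n r. n \<ge> N \<Longrightarrow> r \<in> {\<mu>..1 - \<mu>} \<Longrightarrow> g r (Suc n) \<noteq> 1/2 \<and> arc_tail g n = (1/2 < g r (Suc n))"
    using arc_tail_interior[OF g \<mu>(1)] by blast
  have "\<exists>e>0. \<forall>t'\<in>{0..1}. \<bar>t' - t\<bar> < e \<longrightarrow> (g t (Suc n) \<noteq> 1/2 \<longrightarrow> g t' (Suc n) \<noteq> 1/2 \<and> (1/2 < g t' (Suc n)) = (1/2 < g t (Suc n)))" for n
  proof (cases "g t (Suc n) = 1/2")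
    case False
    have "continuous_on {0..1} (\<lambda>t. g t (Suc n))" by (rule arc_coord_cont[OF g(1) order_refl])
    moreover have "t \<in> {0..1}" "0 < \<bar>g t (Suc n) - 1/2\<bar>" using t False by auto
    ultimately obtain e where e: "0 < e" "\<And>t'. t' \<in> {0..1} \<Longrightarrow> dist t' t < e \<Longrightarrow> dist (g t' (Suc n)) (g t (Suc n)) < \<bar>g t (Suc n) - 1/2\<bar>"
      unfolding continuous_on_iff by blast
    have "g t' (Suc n) \<noteq> 1/2 \<and> (1/2 < g t' (Suc n)) = (1/2 < g t (Suc n))"
      if "t' \<in> {0..1}" "\<bar>t' - t\<bar> < e" for t'
    proof -
      have "dist (g t' (Suc n)) (g t (Suc n)) < \<bar>g t (Suc n) - 1/2\<bar>"
        using that by (intro e(2)) (simp_all add: dist_real_def)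
      then have "1/2 < g t (Suc n) \<and> 1/2 < g t' (Suc n) \<or> g t (Suc n) < 1/2 \<and> g t' (Suc n) < 1/2"
        unfolding dist_real_def by linarith
      then show ?thesis by auto
    qed
    then show ?thesis using e(1) by blast
  qed (auto intro: exI[of _ 1])
  then obtain e where e: "\<And>n. 0 < e n" "\<And>n t'. t' \<in> {0..1} \<Longrightarrow> \<bar>t' - t\<bar> < e n \<Longrightarrow> g t (Suc n) \<noteq> 1/2 \<Longrightarrow>
      g t' (Suc n) \<noteq> 1/2 \<and> (1/2 < g t' (Suc n)) = (1/2 < g t (Suc n))" by metis
  define E where "E = Min (insert \<mu> (e ` {..<N}))"
  have E0: "0 < E" unfolding E_def using e(1) \<mu>(1) by (subst Min_gr_iff) auto
  have E: "E \<le> \<mu>" "\<And>n. n < N \<Longrightarrow> E \<le> e n" unfolding E_def by (auto intro!: Min_le)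
  have "a \<in> lefts t" if t': "\<bar>t' - t\<bar> < E" and a: "a \<in> lefts t'" for t' a
  proof (cases "t' = t")
    case False
    have tm: "t' \<in> {\<mu>..1 - \<mu>}" "t \<in> {\<mu>..1 - \<mu>}" using t' E(1) \<mu> unfolding atLeastAtMost_iff
      by (intro conjI; linarith)+
    then have t01: "t' \<in> {0..1}" "t \<in> {0..1}" using \<mu>(1) by auto
    have gX: "g t' \<in> X" "g t \<in> X" using g_X t01 by auto
    have av: "lvalid a (g t')" using a basic_arcD unfolding lefts_def by blast
    have "g t (Suc n) \<in> half (a n)" for n
    proof (cases "g t (Suc n) = 1/2")
      case True then show ?thesis by (simp add: half_iff)
    next
      case ne: False
      have "g t' (Suc n) \<noteq> 1/2 \<and> (1/2 < g t' (Suc n)) = (1/2 < g t (Suc n))"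
      proof (cases "n < N")
        case True
        then show ?thesis using e(2)[OF t01(1) _ ne] t' E(2)[OF True] by simp
      next
        case False
        then show ?thesis using N[of n t] N[of n t'] tm by simp
      qed
      then show ?thesis using av[rule_format, of n] X_range[OF gX(2), of "Suc n"] by (auto simp: half_iff split: if_splits)
    qed
    moreover have "g t \<noteq> g t'" using False t01 g(1) unfolding arc_def by (metis inj_onD)
    ultimately obtain \<sigma> where "represents s \<sigma> (g t)" "left_part \<sigma> = a"
      using lvalid_represents[OF gX(2) _ gX(1) av] by blast
    then show ?thesis unfolding lefts_def basic_arc_iff by blast
  qed (use a in simp)
  then show ?thesis using E0 by blast
qed

text \<open>Having all left parts linked is a symmetric and transitive relation of parameters that
  holds locally, since nearby no new left parts occur and those of one point are equal or joined.
  Connectedness of the interval replaces an enumeration of the zigzag.\<close>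

lemma linked_near_end:
  assumes "0 < \<eta>"
  shows "\<exists>T>0. T \<le> 1 \<and> (\<forall>t t' a b. 0 < t \<longrightarrow> t < T \<longrightarrow> 0 < t' \<longrightarrow> t' < T \<longrightarrow> a \<in> lefts t \<longrightarrow> b \<in> lefts t' \<longrightarrow> linked \<eta> a b)"
proof -
  have h: "0 < \<eta> / 2" using assms by simp
  obtain T1 where T1: "0 < T1" "T1 \<le> 1" "\<And>t a w. 0 < t \<Longrightarrow> t < T1 \<Longrightarrow> a \<in> lefts t \<Longrightarrow> w \<in> basic_arc s a \<Longrightarrow>
    dist (F (w 0, psi L a)) p < \<eta> / 2" using segments_near_end[OF h] by blast
  obtain T2 where T2: "0 < T2" "T2 \<le> 1" "\<And>t n a b z. 0 < t \<Longrightarrow> t < T2 \<Longrightarrow> joined n a b (g t) \<Longrightarrow> a \<in> lefts t \<Longrightarrow> b \<in> lefts t \<Longrightarrow>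
    z \<in> arch L n a (psi L a - ctr L n a) \<Longrightarrow> dist (F z) p < \<eta> / 2" using arches_near_end[OF h] by blast
  define T where "T = min T1 T2"
  have T: "0 < T" "T \<le> 1" "T \<le> T1" "T \<le> T2" using T1 T2 by (auto simp: T_def)
  have same: "linked \<eta> a b" if "0 < t" "t < T" "a \<in> lefts t" "b \<in> lefts t" for t a b
  proof (cases "a = b")
    case True
    then show ?thesis using linked_refl[of t a \<eta>] T1(3)[of t a] that T assms by simp
  next
    case False
    then have "\<exists>n. joined n a b (g t)" using lefts_cases that by blast
    then obtain n where "joined n a b (g t)" ..
    then show ?thesis
      using linked_joined[of t a b n \<eta>] T1(3)[of t] T2(3)[of t n a b] that T assms by simp
  qed
  define R where "R t t' \<longleftrightarrow> (\<forall>a\<in>lefts t. \<forall>b\<in>lefts t'. linked \<eta> a b)" for t t'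
  have "R t t'" if tt: "t \<in> {0<..<T}" "t' \<in> {0<..<T}" for t t'
  proof (rule connected_equivalence_relation[of "{0<..<T}"])
    show "R y x" if "R x y" for x y using that linked_sym unfolding R_def by blast
    show "R x z" if R: "R x y" "R y z" and y: "y \<in> {0<..<T}" for x y z
    proof -
      obtain c where c: "c \<in> lefts y" using lefts_ne[of y] y T by fastforce
      then have "basic_arc s c \<noteq> {}" unfolding lefts_def by blast
      then show ?thesis using R c linked_trans unfolding R_def by blast
    qed
    show "\<exists>U. openin (top_of_set {0<..<T}) U \<and> x \<in> U \<and> (\<forall>y\<in>U. R x y)" if x: "x \<in> {0<..<T}" for x
    proof -
      obtain e where e: "0 < e" "\<And>y. \<bar>y - x\<bar> < e \<Longrightarrow> lefts y \<subseteq> lefts x" using lefts_near[of x] x T by auto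
      have "R x y" if "y \<in> {0<..<T} \<inter> ball x e" for y
      proof -
        have "lefts y \<subseteq> lefts x" using e(2)[of y] that by (simp add: dist_real_def abs_minus_commute)
        then show ?thesis using same[of x] x unfolding R_def by auto
      qed
      then show ?thesis using e(1) x by (intro exI[of _ "{0<..<T} \<inter> ball x e"]) (auto simp: openin_open_Int)
    qed
  qed (use tt in auto)
  then show ?thesis unfolding R_def using T by (intro exI[of _ T]) auto
qed

text \<open>Successive gates are joined off the drawing. \<open>F\<close> is applied before the
  paths are concatenated, because only their images are known to lie in shrinking balls about
  \<open>p\<close>.\<close>

lemma accessible_end: "accessible K p"
proof -
  have "\<exists>T>0. T \<le> 1 \<and> (\<forall>t t' a b. 0 < t \<longrightarrow> t < T \<longrightarrow> 0 < t' \<longrightarrow> t' < T \<longrightarrow> a \<in> lefts t \<longrightarrow> b \<in> lefts t' \<longrightarrow>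
      linked (1 / real (Suc j)) a b)" for j by (rule linked_near_end) simp
  then obtain T where T: "\<And>j. 0 < T j" "\<And>j. T j \<le> 1"
    "\<And>j t t' a b. 0 < t \<Longrightarrow> t < T j \<Longrightarrow> 0 < t' \<Longrightarrow> t' < T j \<Longrightarrow> a \<in> lefts t \<Longrightarrow> b \<in> lefts t' \<Longrightarrow> linked (1 / real (Suc j)) a b"
    by metis
  \<comment> \<open>The minimum over all indices up to \<open>j\<close> keeps
    \<open>t (Suc j)\<close> below \<open>T j\<close> as well; the heights \<open>d\<close> are
    chosen in the same way.\<close>
  define t where "t j = Min (T ` {..j}) / 2" for j
  have m0: "0 < Min (T ` {..j})" for j using T(1) by (subst Min_gr_iff) auto
  then have t0: "0 < t j" for j by (simp add: t_def)
  have tT: "t j < T i" if "i \<le> j" for i j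
  proof -
    have "Min (T ` {..j}) \<le> T i" using that by (intro Min_le) auto
    then show ?thesis using m0[of j] unfolding t_def by linarith
  qed
  have t1: "t j < 1" for j using tT[of j j] T(2)[of j] by simp
  have "\<exists>a. a \<in> lefts (t j)" for j using lefts_ne[OF t0 t1] by blast
  then obtain a where a: "\<And>j. a j \<in> lefts (t j)" by metis
  have "linked (1 / real (Suc j)) (a j) (a (Suc j))" for j
    by (rule T(3)[OF t0 _ t0 _ a a]) (auto intro: tT)
  then have "\<exists>\<delta>>0. \<forall>w\<in>basic_arc s (a j). \<forall>w'\<in>basic_arc s (a (Suc j)). \<forall>d d'. 0 < d \<and> d < \<delta> \<and> 0 < d' \<and> d' < \<delta> \<longrightarrow>
      path_component (outside (1 / real (Suc j))) (gate (a j) (w 0) d) (gate (a (Suc j)) (w' 0) d')" for j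
    unfolding linked_def .
  then obtain \<delta> where \<delta>: "\<And>j. 0 < \<delta> j" "\<And>j w w' d d'. w \<in> basic_arc s (a j) \<Longrightarrow> w' \<in> basic_arc s (a (Suc j)) \<Longrightarrow>
      0 < d \<and> d < \<delta> j \<and> 0 < d' \<and> d' < \<delta> j \<Longrightarrow>
      path_component (outside (1 / real (Suc j))) (gate (a j) (w 0) d) (gate (a (Suc j)) (w' 0) d')" by metis
  define d where "d j = Min (\<delta> ` {..j}) / 2" for j
  have md: "0 < Min (\<delta> ` {..j})" for j using \<delta>(1) by (subst Min_gr_iff) auto
  have d\<delta>: "d j < \<delta> i" if "i \<le> j" for i j
  proof -
    have "Min (\<delta> ` {..j}) \<le> \<delta> i" using that by (intro Min_le) auto
    then show ?thesis using md[of j] unfolding d_def by linarith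
  qed
  have d0: "0 < d j" for j using md by (simp add: d_def)
  define z where "z j = gate (a j) (g (t j) 0) (d j)" for j
  have ga: "g (t j) \<in> basic_arc s (a j)" for j using a by (simp add: lefts_def)
  have zc: "path_component (outside (1 / real (Suc j))) (z j) (z (Suc j))" for j
    unfolding z_def by (rule \<delta>(2)[OF ga ga]) (auto simp: d0 d\<delta>)
  define S where "S j = F ` outside (1 / real (Suc j))" for j
  have "path_component (S j) (F (z j)) (F (z (Suc j)))" for j
  proof -
    obtain k where k: "path k" "path_image k \<subseteq> outside (1 / real (Suc j))" "pathstart k = z j" "pathfinish k = z (Suc j)"
      using zc[of j] unfolding path_component_def by blast
    have "path (F \<circ> k)" using k(1) F_cont by (rule path_continuous_image)
    then show ?thesis unfolding path_component_def S_def
      using k by (intro exI[of _ "F \<circ> k"]) (auto simp: path_image_compose pathstart_compose pathfinish_compose)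
  qed
  moreover have "S j \<subseteq> ball p (1 / real (Suc j))" for j by (auto simp: S_def outside_def)
  moreover have "(\<lambda>j. 1 / real (Suc j)) \<longlonglongrightarrow> 0" using LIMSEQ_inverse_real_of_nat by (simp only: inverse_eq_divide)
  ultimately obtain h where h: "path h" "pathfinish h = p" "\<And>t. 0 \<le> t \<Longrightarrow> t < 1 \<Longrightarrow> h t \<in> (\<Union>j. S j)"
    using infinite_concatenation[of S "\<lambda>j. F (z j)" p "\<lambda>j. 1 / real (Suc j)"] by blast
  have "F q \<notin> K" if "q \<in> outside (1 / real (Suc j))" for q j
    using F_off[of q] that by (simp add: outside_def)
  then have "S j \<inter> K = {}" for j unfolding S_def by blast
  then have "h t \<notin> K" if "0 \<le> t" "t < 1" for t using h(3)[OF that] by blast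
  moreover have "p \<in> K" by (rule imageI[OF g_X]) simp_all
  ultimately show ?thesis using accessible_path[OF h(1), of K] h(2) by simp
qed

end

section \<open>Points in the arc-component of \<open>A(L)\<close>\<close>

context tent_embedding begin

lemma accessible_arc_component:
  assumes y: "y \<in> basic_arc s L" and ns: "\<not> (basic_arc s L = {y} \<and> spiral_point s y)"
    and x: "x \<in> arc_component X y"
  shows "accessible K (\<phi> x)"
proof (cases "x = y")
  case True
  then obtain \<sigma> where "represents s \<sigma> x" "left_part \<sigma> = L" using y unfolding basic_arc_iff by blast
  then have "same_tail s L x" unfolding same_tail_def by blast
  then show ?thesis using accessible_same_tail basic_arcD[OF y] True by blast
next
  case False
  then obtain k where k: "arc k" "path_image k \<subseteq> X" "y \<in> path_image k" "x \<in> path_image k"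
    using x y unfolding arc_component_def by blast
  obtain u v where uv: "u \<in> {0..1}" "v \<in> {0..1}" "k u = x" "k v = y" using k(3,4) unfolding path_image_def by blast
  then have "u \<noteq> v" using False by auto
  \<comment> \<open>Oriented from \<open>x\<close> to \<open>y\<close>, since
    \<open>degenerate_end\<close> studies the end \<open>g 0\<close>. The reverse starts in
    \<open>A(L)\<close> and has the same \<open>arc_tail\<close>, as reversal fixes the
    midpoint.\<close>
  define g where "g = sub_arc u v k"
  note sa = sub_arc[OF k(1) uv(1,2) \<open>u \<noteq> v\<close>, folded g_def, unfolded uv]
  have gX: "path_image g \<subseteq> X" using sa(2) k(2) by blast
  define r where "r = reversepath g"
  have r: "arc r" "path_image r \<subseteq> X" "r 0 = y" "arc_tail r = arc_tail g"
    unfolding r_def using arc_reversepath[OF sa(1)] gX sa(4)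
    by (simp_all add: path_image_reversepath) (simp_all add: reversepath_def arc_tail_def[abs_def])
  obtain N where N: "\<forall>n\<ge>N. L n = arc_tail g n"
    using arc_tail_of_basic_arc[OF r(1,2)] y ns unfolding r(3,4) by blast
  have xX: "x \<in> X" using k(2,4) by blast
  show ?thesis
  \<comment> \<open>If a left part of \<open>x\<close> fits a second point, it has the tail of the
    arc and hence of \<open>L\<close>. Otherwise \<open>x\<close> is a degenerate end.\<close>
  proof (cases "\<exists>a w. lvalid a (g 0) \<and> w \<in> X \<and> lvalid a w \<and> w \<noteq> g 0")
    case True
    then obtain a w where aw: "lvalid a (g 0)" "w \<in> X" "lvalid a w" "g 0 \<noteq> w" by blast
    obtain M where M: "\<forall>n\<ge>M. a n = arc_tail g n" using arc_start_tail[OF sa(1) gX aw] by blast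
    obtain \<sigma> where \<sigma>: "represents s \<sigma> x" "left_part \<sigma> = a"
      using lvalid_represents[of x a w] xX aw sa(3) by blast
    have "\<forall>i\<ge>max M N. left_part \<sigma> i = L i" using \<sigma>(2) M N by simp
    then have "same_tail s L x" unfolding same_tail_def using \<sigma>(1) by blast
    then show ?thesis using accessible_same_tail xX by blast
  next
    case False
    interpret degenerate_end s L \<phi> F \<phi>' g
      by unfold_locales (use sa(1) gX N False in blast)+
    show ?thesis using accessible_end unfolding sa(3) .
  qed
qed

end

theorem proposition7p6:
  fixes s :: real and L :: "nat \<Rightarrow> bool" and \<phi> :: "(nat \<Rightarrow> real) \<Rightarrow> real \<times> real"
  assumes "sqrt 2 < s" and "s \<le> 2"
    and "left_admissible s L"
    and "embedding_wrt s L \<phi>"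
  shows "(\<forall>x \<in> inv_limit s. same_tail s L x \<longrightarrow> accessible (\<phi> ` inv_limit s) (\<phi> x)) \<and>
         ((\<nexists>x. basic_arc s L = {x} \<and> spiral_point s x) \<longrightarrow>
          (\<forall>x \<in> arc_component_of_left s L. accessible (\<phi> ` inv_limit s) (\<phi> x)))"
proof -
  have "1 < sqrt 2" by simp
  then have "1 < s" using assms(1) by linarith
  obtain F \<phi>' where F: "shrinks_semicircles s L F" "homeomorphism (inv_limit s) (F ` drawing s L) \<phi> \<phi>'"
    "\<forall>a. left_admissible s a \<longrightarrow> F ` segment s L a \<subseteq> \<phi> ` basic_arc s a \<and>
       \<phi> ` basic_arc s a \<subseteq> F ` (segment s L a \<union> \<Union> (semicircles_at s L a))"
    using assms(4) unfolding embedding_wrt_def by blast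
  interpret tent_embedding s L \<phi> F \<phi>'
    by unfold_locales (use \<open>1 < s\<close> assms(2) F in blast)+
  show ?thesis
    using accessible_same_tail accessible_arc_component unfolding arc_component_of_left_def by blast
qed

end
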